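(* Let $\boldsymbol\tau=(\tau_1,\tau_2)\in\mathbb{R}_{\ge 0}^2$ satisfy $\tau_1+\tau_2>1$ and $\tau_1\ge\tau_2$. Then for every ball $B\subseteq[0,1]^2$ (of positive radius), $$\dim_{\mathcal H}\bigl(B\cap\mathcal B_2(\Psi_{\boldsymbol\tau})\bigr)=\dim_{\mathcal H}\mathcal A_2(\Psi_{\boldsymbol\tau})=\min\left\{\frac{3+\tau_1-\tau_2}{1+\tau_1},\ \frac{3}{1+\tau_2}\right\}.$$
   Context: For $\Psi=(\psi_1,\psi_2):\mathbb{N}\to\mathbb{R}_{>0}^2$, the set of $\Psi$-approximable vectors is $\mathcal A_2(\Psi)=\{\mathbf x=(x_1,x_2)\in[0,1]^2: |qx_i-p_i|<\psi_i(q)$ for $i=1,2$, for infinitely many $q\in\mathbb{N}$ and $(p_1,p_2)\in\mathbb{Z}^2\}$. For $c>0$, $c\Psi=(c\psi_1,c\psi_2)$. The set of weighted $\Psi$-badly approximable vectors is $\mathcal B_2(\Psi)=\mathcal A_2(\Psi)\setminus\bigcap_{0<c<1}\mathcal A_2(c\Psi)$. For $\boldsymbol\tau=(\tau_1,\tau_2)$, $\Psi_{\boldsymbol\tau}$ denotes the function $q\mapsto(q^{-\tau_1},q^{-\tau_2})$ (for positive integers $q$). Balls are taken with respect to the supremum norm on $\mathbb{R}^2$ (so they are squares). $\dim_{\mathcal H}$ denotes Hausdorff dimension. *)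

theory Defs
  imports "HOL-Analysis.Analysis"
begin

text \<open>Hausdorff measure and dimension with respect to the metric of the type. On
  \<^typ>\<open>real^2\<close> this is the Euclidean metric; the dimension is the same for every metric induced
  by a norm.\<close>

text \<open>The convention \<open>|U|^0 = 1\<close> for nonempty \<open>U\<close> is spelled out because \<open>0 powr 0 = 0\<close>.\<close>

definition diam_pow :: "real \<Rightarrow> 'a::metric_space set \<Rightarrow> ennreal" where
  "diam_pow s U = (if U = {} then 0 else if s = 0 then 1 else ennreal (diameter U powr s))"

text \<open>Boundedness is required explicitly, since \<^const>\<open>diameter\<close> is real-valued and therefore
  meaningless on unbounded sets. Finite covers are included, as the \<open>U i\<close> may be empty.\<close>

definition hausdorff_premeasure :: "real \<Rightarrow> real \<Rightarrow> 'a::metric_space set \<Rightarrow> ennreal" where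
  "hausdorff_premeasure s \<delta> E =
     (INF U \<in> {U :: nat \<Rightarrow> 'a set. E \<subseteq> (\<Union>i. U i) \<and> (\<forall>i. bounded (U i) \<and> diameter (U i) \<le> \<delta>)}.
        \<Sum>i. diam_pow s (U i))"

definition hausdorff_measure :: "real \<Rightarrow> 'a::metric_space set \<Rightarrow> ennreal" where
  "hausdorff_measure s E = (SUP \<delta> \<in> {0<..}. hausdorff_premeasure s \<delta> E)"

definition hausdorff_dim :: "'a::metric_space set \<Rightarrow> ereal" where
  "hausdorff_dim E = (INF s \<in> {s. 0 \<le> s \<and> hausdorff_measure s E = 0}. ereal s)"

definition unit_square :: "(real^2) set" where
  "unit_square = {x. \<forall>i. 0 \<le> x $ i \<and> x $ i \<le> 1}"

text \<open>Balls of positive radius for the supremum norm, open or closed.\<close>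

definition is_sup_ball :: "(real^2) set \<Rightarrow> bool" where
  "is_sup_ball B \<longleftrightarrow>
     (\<exists>x r. 0 < r \<and> (B = {y. infnorm (y - x) < r} \<or> B = {y. infnorm (y - x) \<le> r}))"

text \<open>A function \<open>\<Psi>\<close> on the positive integers is represented by a function on \<^typ>\<open>nat\<close> whose
  value at \<open>0\<close> is irrelevant.\<close>

definition approximable :: "(nat \<Rightarrow> real^2) \<Rightarrow> (real^2) set" where
  "approximable \<Psi> =
     {x \<in> unit_square.
        infinite {(q :: nat, p :: int^2).
          0 < q \<and> (\<forall>i. \<bar>real q * x $ i - real_of_int (p $ i)\<bar> < \<Psi> q $ i)}}"

definition badly_approximable :: "(nat \<Rightarrow> real^2) \<Rightarrow> (real^2) set" where
  "badly_approximable \<Psi> = approximable \<Psi> - (\<Inter>c\<in>{0<..<1}. approximable (\<lambda>q. c *\<^sub>R \<Psi> q))"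

definition Psi_pow :: "real^2 \<Rightarrow> nat \<Rightarrow> real^2" where
  "Psi_pow \<tau> q = (\<chi> i. real q powr (- (\<tau> $ i)))"

end

theory Submission
  imports Defs
begin

text \<open>Lower bound. Choose \<open>s\<^sub>1 + s\<^sub>2 = 1\<close> with \<open>s\<^sub>i < \<tau>\<^sub>i\<close> (but \<open>s\<^sub>2 = 0\<close> if \<open>\<tau>\<^sub>2 = 0\<close>). By Dirichlet's theorem with weights \<open>s\<close> every point
  is within \<open>2 (Q powr - s\<^sub>i) / q\<close> of a rational point of denominator \<open>q \<le> Q\<close>. Inside a rectangle of sides
  \<open>Q\<^sub>0 powr (- 1 - \<tau>\<^sub>i)\<close>, discard from a grid of mesh about \<open>Q powr (- 1 - s\<^sub>i)\<close> the points near
  rationals of denominator below \<open>d Q\<close>: a block of sides \<open>N powr (- 1 - s\<^sub>i) / 13\<close> contains only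
  collinear rationals of denominator in \<open>[N, 2N)\<close>, because the determinant of three of them is an
  integer divided by the denominators, so that the discarded points lie in thin strips. For small \<open>d\<close> and \<open>c\<close> and
  large \<open>Q\<close> at least half of the grid survives. The rectangles of sides \<open>Q powr (- 1 - \<tau>\<^sub>i)\<close> around
  the Dirichlet approximations of the surviving points consist of points that no rational of
  denominator in \<open>[d Q\<^sub>0, d Q)\<close> approximates to within \<open>c \<Psi>\<close>. Iterating with rapidly increasing \<open>Q\<close>
  gives a Cantor set of badly approximable vectors, and the uniform mass on it satisfies a Frostman
  condition for every exponent below the asserted dimension.

  Upper bound. Cover each rectangle around a rational point by squares of side \<open>q powr (- 1 - h)\<close>; the choices
  \<open>h = \<tau>\<^sub>1\<close> and \<open>h = \<tau>\<^sub>2\<close> give the two terms of the minimum.\<close>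

subsection \<open>Grid points near a line\<close>

text \<open>The radius of the discarded neighbourhood of a rational of denominator about N has two
  parts with different jobs: about \<open>Q powr - s / N\<close> forces the denominator found by
  Dirichlet's theorem up to at least \<open>d Q\<close>, and \<open>c N powr (- 1 - t)\<close> keeps
  the new rectangle away from good approximations. Summed over dyadic N, the discarded proportion
  involves \<open>N powr - (t - s)\<close> and \<open>(N / Q) powr s\<close>, and these series are
  dominated by one end because 0 < s < t. Constants are chosen in the order d, c, Q: d makes the
  terms with N near \<open>d Q\<close> small, then c those that carry c, then Q the rest. The mesh
  \<open>8 / d * Q powr (- 1 - s)\<close> is four times the largest Dirichlet displacement, so
  distinct grid points keep separated centres. The same d and c serve on all levels; hence the
  ranges of denominators excluded on successive levels fit together, and a single c works for the
  whole limit set. The weights depend on the exponent: the Frostman condition asks s2 to be large,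
  while s2 < t2 (if t2 > 0) and s2 <= 1/2 must hold.\<close>

lemma card_int_interval:
  fixes A :: "int set" and a b :: real
  assumes "\<And>i. i \<in> A \<Longrightarrow> a \<le> real_of_int i \<and> real_of_int i \<le> b" "a \<le> b"
  shows "finite A" "real (card A) \<le> b - a + 1"
proof -
  have sub: "A \<subseteq> {\<lceil>a\<rceil>..\<lfloor>b\<rfloor>}"
    using assms(1) by (auto simp: ceiling_le_iff le_floor_iff)
  then show "finite A"
    by (rule finite_subset) simp
  have "card A \<le> nat (\<lfloor>b\<rfloor> - \<lceil>a\<rceil> + 1)"
    using card_mono[OF _ sub] by simp
  then show "real (card A) \<le> b - a + 1"
    using assms(2) by linarith
qed

lemma card_nat_interval:
  fixes A :: "nat set" and a b :: real
  assumes "\<And>i. i \<in> A \<Longrightarrow> a \<le> real i \<and> real i \<le> b" "a \<le> b"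
  shows "real (card A) \<le> b - a + 1"
proof -
  have "real (card (int ` A)) \<le> b - a + 1"
    by (rule card_int_interval(2)) (use assms in auto)
  then show ?thesis
    by (simp add: card_image)
qed

lemma card_le_fibres:
  assumes "finite J" "S \<subseteq> UNIV \<times> J" "finite S"
    and "\<And>j. j \<in> J \<Longrightarrow> real (card {i. (i, j) \<in> S}) \<le> b"
  shows "real (card S) \<le> real (card J) * b"
proof -
  have fin: "finite {i. (i, j) \<in> S}" for j
    by (rule finite_subset[OF _ finite_imageI[OF assms(3), of fst]]) force
  have "card S \<le> card (\<Union>j\<in>J. (\<lambda>i. (i, j)) ` {i. (i, j) \<in> S})"
    by (rule card_mono) (use assms fin in auto)
  also have "\<dots> \<le> (\<Sum>j\<in>J. card ((\<lambda>i. (i, j)) ` {i. (i, j) \<in> S}))"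
    by (rule card_UN_le) fact
  also have "\<dots> \<le> (\<Sum>j\<in>J. card {i. (i, j) \<in> S})"
    by (intro sum_mono card_image_le fin)
  finally have "real (card S) \<le> (\<Sum>j\<in>J. real (card {i. (i, j) \<in> S}))"
    by (simp flip: of_nat_sum)
  also have "\<dots> \<le> real (card J) * b"
    using sum_mono[of J "\<lambda>j. real (card {i. (i, j) \<in> S})" "\<lambda>_. b"] assms(4) by simp
  finally show ?thesis .
qed

text \<open>The summands \<open>g1\<close> and \<open>g2\<close> absorb the error \<open>1\<close> in counting the integers of an interval.\<close>

lemma strip_count_steep:
  fixes \<alpha> \<beta> \<gamma> u1 u2 g1 g2 \<rho>1 \<rho>2 :: real and I J :: "nat set"
  assumes "g1 > 0" "g2 > 0" "m1 > 0" "m2 > 0" "\<alpha> \<noteq> 0 \<or> \<beta> \<noteq> 0" "\<rho>1 \<ge> 0" "\<rho>2 \<ge> 0"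
    and "finite I" "finite J" "card J = m2"
    and steep: "\<bar>\<beta>\<bar> * (real m2 * g2) \<le> \<bar>\<alpha>\<bar> * (real m1 * g1)"
  shows "real (card {(i, j). i \<in> I \<and> j \<in> J \<and>
      \<bar>\<alpha> * (u1 + real i * g1) + \<beta> * (u2 + real j * g2) - \<gamma>\<bar> \<le> \<bar>\<alpha>\<bar> * \<rho>1 + \<bar>\<beta>\<bar> * \<rho>2})
    \<le> real m1 * real m2 * (2 * (\<rho>1 + g1) / (m1 * g1) + 2 * (\<rho>2 + g2) / (m2 * g2))"
    (is "real (card ?S) \<le> _")
proof -
  have \<alpha>: "\<alpha> \<noteq> 0"
  proof
    assume "\<alpha> = 0"
    then have "\<bar>\<beta>\<bar> * (real m2 * g2) \<le> 0" "\<bar>\<beta>\<bar> > 0" using steep assms(5) by auto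
    then show False using assms by (simp add: mult_le_0_iff not_le)
  qed
  define b1 b2 where "b1 = real m1 * g1" and "b2 = real m2 * g2"
  have b: "b1 > 0" "b2 > 0" using assms by (auto simp: b1_def b2_def)
  \<comment> \<open>In each row the strip cuts out an interval of half-width at most \<open>\<rho>1
    + \<rho>2 * \<bar>\<beta>\<bar> / \<bar>\<alpha>\<bar>\<close>. The assumption
    \<open>steep\<close> bounds the quotient by the ratio of the sides of the block, so the count no
    longer depends on the line.\<close>
  define h where "h = \<rho>1 + \<rho>2 * (b1 / b2)"
  have h0: "h \<ge> 0" using assms b by (auto simp: h_def)
  have ba: "\<bar>\<beta>\<bar> / \<bar>\<alpha>\<bar> \<le> b1 / b2"
    using steep \<alpha> b unfolding b1_def[symmetric] b2_def[symmetric] by (simp add: field_simps)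
  have fib: "real (card {i. (i, j) \<in> ?S}) \<le> 2 * h / g1 + 1" for j
  proof -
    define w where "w = (\<gamma> - \<beta> * (u2 + real j * g2)) / \<alpha> - u1"
    have "(w - h) / g1 \<le> real i \<and> real i \<le> (w + h) / g1" if "(i, j) \<in> ?S" for i
    proof -
      have "\<bar>\<alpha>\<bar> * \<bar>real i * g1 - w\<bar> = \<bar>\<alpha> * (real i * g1 - w)\<bar>" by (simp add: abs_mult)
      also have "\<alpha> * (real i * g1 - w) = \<alpha> * (u1 + real i * g1) + \<beta> * (u2 + real j * g2) - \<gamma>"
        using \<alpha> by (simp add: w_def field_simps)
      also have "\<bar>\<dots>\<bar> \<le> \<bar>\<alpha>\<bar> * \<rho>1 + \<bar>\<beta>\<bar> * \<rho>2" using that by simp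
      also have "\<dots> = \<bar>\<alpha>\<bar> * (\<rho>1 + \<rho>2 * (\<bar>\<beta>\<bar> / \<bar>\<alpha>\<bar>))" using \<alpha> by (simp add: field_simps)
      also have "\<dots> \<le> \<bar>\<alpha>\<bar> * h" unfolding h_def
        by (intro mult_left_mono add_left_mono ba) (use assms in auto)
      finally have "\<bar>real i * g1 - w\<bar> \<le> h" using \<alpha> by simp
      then have "w - h \<le> real i * g1" "real i * g1 \<le> w + h" by linarith+
      then show ?thesis using assms(1) by (simp add: pos_divide_le_eq pos_le_divide_eq)
    qed
    then have "real (card {i. (i, j) \<in> ?S}) \<le> (w + h) / g1 - (w - h) / g1 + 1"
      using h0 assms(1) by (intro card_nat_interval) (auto simp: divide_right_mono)
    also have "\<dots> = 2 * h / g1 + 1" by (simp add: diff_divide_distrib add_divide_distrib)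
    finally show ?thesis .
  qed
  have "finite ?S" by (rule finite_subset[of _ "I \<times> J"]) (use assms in auto)
  then have "real (card ?S) \<le> real (card J) * (2 * h / g1 + 1)"
    by (intro card_le_fibres fib) (use assms in auto)
  also have "\<dots> = real m1 * real m2 * (2 * \<rho>1 / b1 + 2 * \<rho>2 / b2 + 1 / m1)"
    using assms by (simp add: h_def b1_def b2_def field_simps)
  also have "\<dots> \<le> real m1 * real m2 * (2 * (\<rho>1 + g1) / b1 + 2 * (\<rho>2 + g2) / b2)"
  proof (intro mult_left_mono)
    have "2 * (\<rho>1 + g1) / b1 = 2 * \<rho>1 / b1 + 2 / m1"
      using assms by (simp add: b1_def add_divide_distrib distrib_left)
    moreover have "2 * \<rho>2 / b2 \<le> 2 * (\<rho>2 + g2) / b2"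
      using assms b by (intro divide_right_mono) auto
    moreover have "(1::real) / m1 \<le> 2 / m1" by (simp add: divide_right_mono)
    ultimately show "2 * \<rho>1 / b1 + 2 * \<rho>2 / b2 + 1 / m1 \<le> 2 * (\<rho>1 + g1) / b1 + 2 * (\<rho>2 + g2) / b2"
      by linarith
  qed auto
  finally show ?thesis unfolding b1_def b2_def .
qed

text \<open>The bound is symmetric in the two coordinates, so one may count along rows or along
  columns, whichever makes the line steep relative to the shape of the block.\<close>

lemma strip_count:
  fixes \<alpha> \<beta> \<gamma> u1 u2 g1 g2 \<rho>1 \<rho>2 :: real and I J :: "nat set"
  assumes "g1 > 0" "g2 > 0" "m1 > 0" "m2 > 0" "\<alpha> \<noteq> 0 \<or> \<beta> \<noteq> 0" "\<rho>1 \<ge> 0" "\<rho>2 \<ge> 0"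
    and "finite I" "finite J" "card I = m1" "card J = m2"
  shows "real (card {(i, j). i \<in> I \<and> j \<in> J \<and>
      \<bar>\<alpha> * (u1 + real i * g1) + \<beta> * (u2 + real j * g2) - \<gamma>\<bar> \<le> \<bar>\<alpha>\<bar> * \<rho>1 + \<bar>\<beta>\<bar> * \<rho>2})
    \<le> real m1 * real m2 * (2 * (\<rho>1 + g1) / (m1 * g1) + 2 * (\<rho>2 + g2) / (m2 * g2))"
    (is "real (card ?S) \<le> _")
proof (cases "\<bar>\<beta>\<bar> * (real m2 * g2) \<le> \<bar>\<alpha>\<bar> * (real m1 * g1)")
  case True
  then show ?thesis using assms by (intro strip_count_steep) auto
next
  case False
  let ?T = "{(j, i). j \<in> J \<and> i \<in> I \<and>
      \<bar>\<beta> * (u2 + real j * g2) + \<alpha> * (u1 + real i * g1) - \<gamma>\<bar> \<le> \<bar>\<beta>\<bar> * \<rho>2 + \<bar>\<alpha>\<bar> * \<rho>1}"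
  have "?S = prod.swap ` ?T"
    by (auto simp: image_iff add.commute)
  then have "card ?S = card ?T"
    by (simp add: card_image)
  also have "real (card ?T) \<le> real m2 * real m1 * (2 * (\<rho>2 + g2) / (m2 * g2) + 2 * (\<rho>1 + g1) / (m1 * g1))"
    by (rule strip_count_steep) (use assms False in auto)
  finally show ?thesis by (simp add: ac_simps)
qed

text \<open>If the radii are at most the sides of the block, every point of P that can reach the
  block lies in the concentric box of three times its sides, hence on one line, and the affected
  grid points lie in a strip about that line. If a radius exceeds its side, the factor on the right
  is at least 1 and the trivial count suffices.\<close>

lemma block_count:
  fixes u1 u2 g1 g2 \<rho>1 \<rho>2 :: real and P :: "(real \<times> real) set"
  assumes pos: "g1 > 0" "g2 > 0" "m1 > 0" "m2 > 0" "\<rho>1 \<ge> 0" "\<rho>2 \<ge> 0"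
    and lines: "\<And>v1 v2. \<exists>\<alpha> \<beta> \<gamma>. (\<alpha> \<noteq> 0 \<or> \<beta> \<noteq> 0) \<and> (\<forall>X Y. (X, Y) \<in> P \<longrightarrow> v1 \<le> X \<longrightarrow> X \<le> v1 + 3 * (real m1 * g1) \<longrightarrow>
       v2 \<le> Y \<longrightarrow> Y \<le> v2 + 3 * (real m2 * g2) \<longrightarrow> \<alpha> * X + \<beta> * Y = \<gamma>)"
  shows "real (card {(i, j). i \<in> {k1..<k1+m1} \<and> j \<in> {k2..<k2+m2} \<and>
      (\<exists>(X, Y)\<in>P. \<bar>u1 + real i * g1 - X\<bar> \<le> \<rho>1 \<and> \<bar>u2 + real j * g2 - Y\<bar> \<le> \<rho>2)})
    \<le> real m1 * real m2 * (2 * (\<rho>1 + g1) / (m1 * g1) + 2 * (\<rho>2 + g2) / (m2 * g2))"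
    (is "real (card ?S) \<le> real m1 * real m2 * ?c")
proof (cases "\<rho>1 \<le> real m1 * g1 \<and> \<rho>2 \<le> real m2 * g2")
  case True
  \<comment> \<open>The box starts one block side before the block.\<close>
  define v1 v2 where "v1 = u1 + k1 * g1 - real m1 * g1" and "v2 = u2 + k2 * g2 - real m2 * g2"
  obtain \<alpha> \<beta> \<gamma> where l: "\<alpha> \<noteq> 0 \<or> \<beta> \<noteq> 0" and on: "\<And>X Y. (X, Y) \<in> P \<Longrightarrow> v1 \<le> X \<Longrightarrow> X \<le> v1 + 3 * (real m1 * g1) \<Longrightarrow>
       v2 \<le> Y \<Longrightarrow> Y \<le> v2 + 3 * (real m2 * g2) \<Longrightarrow> \<alpha> * X + \<beta> * Y = \<gamma>"
    using lines[of v1 v2] by metis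
  let ?T = "{(i, j). i \<in> {k1..<k1+m1} \<and> j \<in> {k2..<k2+m2} \<and>
      \<bar>\<alpha> * (u1 + real i * g1) + \<beta> * (u2 + real j * g2) - \<gamma>\<bar> \<le> \<bar>\<alpha>\<bar> * \<rho>1 + \<bar>\<beta>\<bar> * \<rho>2}"
  have "?S \<subseteq> ?T"
  proof
    fix p assume "p \<in> ?S"
    then obtain i j X Y where p: "p = (i, j)"
      and ij: "i \<in> {k1..<k1+m1}" "j \<in> {k2..<k2+m2}" and "(X, Y) \<in> P"
      and X: "\<bar>u1 + real i * g1 - X\<bar> \<le> \<rho>1" and Y: "\<bar>u2 + real j * g2 - Y\<bar> \<le> \<rho>2"
      by auto
    have "real k1 * g1 \<le> real i * g1" "real i * g1 \<le> (real k1 + m1) * g1"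
      "real k2 * g2 \<le> real j * g2" "real j * g2 \<le> (real k2 + m2) * g2"
      using ij pos by (auto intro!: mult_right_mono)
    then have "\<alpha> * X + \<beta> * Y = \<gamma>"
      using X Y True by (intro on \<open>(X, Y) \<in> P\<close>) (auto simp: v1_def v2_def algebra_simps)
    then have "\<bar>\<alpha> * (u1 + real i * g1) + \<beta> * (u2 + real j * g2) - \<gamma>\<bar>
        = \<bar>\<alpha> * (u1 + real i * g1 - X) + \<beta> * (u2 + real j * g2 - Y)\<bar>" by (simp add: algebra_simps)
    also have "\<dots> \<le> \<bar>\<alpha>\<bar> * \<bar>u1 + real i * g1 - X\<bar> + \<bar>\<beta>\<bar> * \<bar>u2 + real j * g2 - Y\<bar>"
      by (metis abs_mult abs_triangle_ineq)
    also have "\<dots> \<le> \<bar>\<alpha>\<bar> * \<rho>1 + \<bar>\<beta>\<bar> * \<rho>2"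
      by (intro add_mono mult_left_mono X Y) auto
    finally show "p \<in> ?T" using ij p by blast
  qed
  moreover have "finite ?T"
    by (rule finite_subset[of _ "{k1..<k1+m1} \<times> {k2..<k2+m2}"]) auto
  ultimately have "card ?S \<le> card ?T" by (intro card_mono)
  also have "real (card ?T) \<le> real m1 * real m2 * ?c"
    by (rule strip_count) (use pos l in auto)
  finally show ?thesis by simp
next
  case False
  have "card ?S \<le> card ({k1..<k1+m1} \<times> {k2..<k2+m2})"
    by (rule card_mono) auto
  then have "real (card ?S) \<le> real m1 * real m2 * 1"
    by (simp flip: of_nat_mult)
  also have "\<dots> \<le> real m1 * real m2 * ?c"
  proof (intro mult_left_mono)
    have "0 \<le> 2 * (\<rho>1 + g1) / (m1 * g1)" "0 \<le> 2 * (\<rho>2 + g2) / (m2 * g2)" using pos by auto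
    moreover have "1 \<le> 2 * (\<rho>1 + g1) / (m1 * g1) \<or> 1 \<le> 2 * (\<rho>2 + g2) / (m2 * g2)"
      using False pos by (auto simp: pos_le_divide_eq)
    ultimately show "1 \<le> ?c" by linarith
  qed auto
  finally show ?thesis .
qed

text \<open>The grid is covered by blocks. Since m <= M, rounding their number up at most doubles
  the points covered in each direction; together with the 2 of \<open>block_count\<close> this gives
  the factor 8.\<close>

lemma grid_count:
  fixes u1 u2 g1 g2 \<rho>1 \<rho>2 :: real and P :: "(real \<times> real) set"
  assumes pos: "g1 > 0" "g2 > 0" "m1 > 0" "m2 > 0" "\<rho>1 \<ge> 0" "\<rho>2 \<ge> 0"
    and le: "m1 \<le> M1" "m2 \<le> M2"
    and lines: "\<And>v1 v2. \<exists>\<alpha> \<beta> \<gamma>. (\<alpha> \<noteq> 0 \<or> \<beta> \<noteq> 0) \<and> (\<forall>X Y. (X, Y) \<in> P \<longrightarrow> v1 \<le> X \<longrightarrow> X \<le> v1 + 3 * (real m1 * g1) \<longrightarrow>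
       v2 \<le> Y \<longrightarrow> Y \<le> v2 + 3 * (real m2 * g2) \<longrightarrow> \<alpha> * X + \<beta> * Y = \<gamma>)"
  shows "real (card {(i, j). i < M1 \<and> j < M2 \<and>
      (\<exists>(X, Y)\<in>P. \<bar>u1 + real i * g1 - X\<bar> \<le> \<rho>1 \<and> \<bar>u2 + real j * g2 - Y\<bar> \<le> \<rho>2)})
    \<le> real M1 * real M2 * (8 * ((\<rho>1 + g1) / (m1 * g1) + (\<rho>2 + g2) / (m2 * g2)))"
proof -
  let ?B = "\<lambda>k1 k2. {(i, j). i \<in> {k1..<k1+m1} \<and> j \<in> {k2..<k2+m2} \<and>
      (\<exists>(X, Y)\<in>P. \<bar>u1 + real i * g1 - X\<bar> \<le> \<rho>1 \<and> \<bar>u2 + real j * g2 - Y\<bar> \<le> \<rho>2)}"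
  let ?S = "{(i, j). i < M1 \<and> j < M2 \<and>
      (\<exists>(X, Y)\<in>P. \<bar>u1 + real i * g1 - X\<bar> \<le> \<rho>1 \<and> \<bar>u2 + real j * g2 - Y\<bar> \<le> \<rho>2)}"
  let ?c = "2 * (\<rho>1 + g1) / (m1 * g1) + 2 * (\<rho>2 + g2) / (m2 * g2)"
  define n1 n2 where "n1 = M1 div m1 + 1" and "n2 = M2 div m2 + 1"
  have c0: "?c \<ge> 0" using pos by simp
  have fin: "finite (?B k1 k2)" for k1 k2
    by (rule finite_subset[of _ "{k1..<k1+m1} \<times> {k2..<k2+m2}"]) auto
  have "?S \<subseteq> (\<Union>(a, b)\<in>{..<n1} \<times> {..<n2}. ?B (a * m1) (b * m2))"
  proof
    fix x assume "x \<in> ?S"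
    then obtain i j where x: "x = (i, j)" "i < M1" "j < M2"
      and P: "\<exists>(X, Y)\<in>P. \<bar>u1 + real i * g1 - X\<bar> \<le> \<rho>1 \<and> \<bar>u2 + real j * g2 - Y\<bar> \<le> \<rho>2" by auto
    have "i div m1 < n1" "j div m2 < n2"
      using x by (auto simp: n1_def n2_def div_le_mono less_Suc_eq_le)
    moreover have "i div m1 * m1 \<le> i" "i < i div m1 * m1 + m1" "j div m2 * m2 \<le> j" "j < j div m2 * m2 + m2"
      using pos dividend_less_div_times[of m1 i] dividend_less_div_times[of m2 j] by (auto simp: add.commute)
    ultimately have "(i div m1, j div m2) \<in> {..<n1} \<times> {..<n2}" "x \<in> ?B (i div m1 * m1) (j div m2 * m2)"
      using P x by auto
    then show "x \<in> (\<Union>(a, b)\<in>{..<n1} \<times> {..<n2}. ?B (a * m1) (b * m2))"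
      by blast
  qed
  then have "card ?S \<le> card (\<Union>(a, b)\<in>{..<n1} \<times> {..<n2}. ?B (a * m1) (b * m2))"
    using fin by (intro card_mono) auto
  also have "\<dots> \<le> (\<Sum>(a, b)\<in>{..<n1} \<times> {..<n2}. card (?B (a * m1) (b * m2)))"
    using card_UN_le[of "{..<n1} \<times> {..<n2}" "\<lambda>(a, b). ?B (a * m1) (b * m2)"] by (simp add: case_prod_unfold)
  finally have "real (card ?S) \<le> (\<Sum>(a, b)\<in>{..<n1} \<times> {..<n2}. real (card (?B (a * m1) (b * m2))))"
    by (simp add: case_prod_unfold flip: of_nat_sum)
  also have "\<dots> \<le> (\<Sum>(a, b)\<in>{..<n1} \<times> {..<n2}. real m1 * real m2 * ?c)"
  proof (rule sum_mono)
    fix p assume "p \<in> {..<n1} \<times> {..<n2}"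
    show "(case p of (a, b) \<Rightarrow> real (card (?B (a * m1) (b * m2)))) \<le> (case p of (a, b) \<Rightarrow> real m1 * real m2 * ?c)"
      by (cases p) (simp only: prod.case block_count[OF pos lines])
  qed
  also have "\<dots> = (real n1 * real m1) * (real n2 * real m2) * ?c"
    by (simp add: case_prod_unfold)
  also have "\<dots> \<le> (2 * real M1) * (2 * real M2) * ?c"
  proof (rule mult_right_mono[OF mult_mono c0])
    have "n1 * m1 = M1 div m1 * m1 + m1" "n2 * m2 = M2 div m2 * m2 + m2" by (auto simp: n1_def n2_def)
    moreover have "M1 div m1 * m1 \<le> M1" "M2 div m2 * m2 \<le> M2" by auto
    ultimately have "n1 * m1 \<le> 2 * M1" "n2 * m2 \<le> 2 * M2" using le by linarith+
    then show "real n1 * real m1 \<le> 2 * real M1" "real n2 * real m2 \<le> 2 * real M2"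
      by (metis of_nat_le_iff of_nat_mult of_nat_numeral)+
  qed auto
  also have "\<dots> = real M1 * real M2 * (8 * ((\<rho>1 + g1) / (m1 * g1) + (\<rho>2 + g2) / (m2 * g2)))"
    by (simp add: algebra_simps)
  finally show ?thesis .
qed


subsection \<open>Collinearity of rational points, Dirichlet approximation, separated sets\<close>

lemma collinear_if_dets_zero:
  fixes P :: "(real \<times> real) set"
  assumes "\<And>x1 y1 x2 y2 x3 y3. (x1, y1) \<in> P \<Longrightarrow> (x2, y2) \<in> P \<Longrightarrow> (x3, y3) \<in> P \<Longrightarrow>
    (x2 - x1) * (y3 - y1) = (x3 - x1) * (y2 - y1)"
  shows "\<exists>\<alpha> \<beta> \<gamma>. (\<alpha> \<noteq> 0 \<or> \<beta> \<noteq> 0) \<and> (\<forall>X Y. (X, Y) \<in> P \<longrightarrow> \<alpha> * X + \<beta> * Y = \<gamma>)"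
proof (cases "\<exists>x1 y1 x2 y2. (x1, y1) \<in> P \<and> (x2, y2) \<in> P \<and> (x1, y1) \<noteq> (x2, y2)")
  case True
  then obtain x1 y1 x2 y2 where p: "(x1, y1) \<in> P" "(x2, y2) \<in> P" "(x1, y1) \<noteq> (x2, y2)" by blast
  have "(y2 - y1) * X + (x1 - x2) * Y = (y2 - y1) * x1 + (x1 - x2) * y1" if "(X, Y) \<in> P" for X Y
    using assms[OF p(1,2) that] by (simp add: algebra_simps)
  moreover have "y2 - y1 \<noteq> 0 \<or> x1 - x2 \<noteq> 0" using p(3) by auto
  ultimately show ?thesis by blast
next
  case False
  then obtain x0 where "\<And>X Y. (X, Y) \<in> P \<Longrightarrow> X = x0" by (metis Pair_inject)
  then have "(1 \<noteq> (0::real) \<or> (0::real) \<noteq> 0) \<and> (\<forall>X Y. (X, Y) \<in> P \<longrightarrow> 1 * X + 0 * Y = x0)" by auto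
  then show ?thesis by blast
qed

text \<open>For \<open>e\<close> true these are vertical lines: the second coordinate imposes no condition when
  its exponent is \<open>0\<close>.\<close>

definition obstacles :: "bool \<Rightarrow> nat \<Rightarrow> (real \<times> real) set" where
  "obstacles e N = {(X, Y). \<exists>q::nat. N \<le> q \<and> q < 2 * N \<and> real q * X \<in> \<int> \<and> (e \<or> real q * Y \<in> \<int>)}"

lemma Ints_abs_less_one:
  fixes x :: real
  assumes "x \<in> \<int>" "\<bar>x\<bar> < 1"
  shows "x = 0"
  using assms by (auto elim!: Ints_cases)

text \<open>An integer of absolute value below 1 vanishes. The factor 16 consists of three
  denominators below 2N and the two products in a determinant; for \<open>e\<close> true only the
  difference of two abscissae counts, with two denominators and hence the factor 4.\<close>

lemma obstacles_lines:
  assumes N: "N \<ge> 1" and w: "w1 \<ge> 0" "w2 \<ge> 0"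
    and e: "e \<Longrightarrow> 4 * (real N)^2 * w1 < 1" and ne: "\<not> e \<Longrightarrow> 16 * w1 * w2 * (real N)^3 < 1"
  shows "\<exists>\<alpha> \<beta> \<gamma>. (\<alpha> \<noteq> 0 \<or> \<beta> \<noteq> 0) \<and> (\<forall>X Y. (X, Y) \<in> obstacles e N \<longrightarrow> v1 \<le> X \<longrightarrow> X \<le> v1 + w1 \<longrightarrow>
       v2 \<le> Y \<longrightarrow> Y \<le> v2 + w2 \<longrightarrow> \<alpha> * X + \<beta> * Y = \<gamma>)"
proof -
  let ?P = "{(X, Y). (X, Y) \<in> obstacles e N \<and> v1 \<le> X \<and> X \<le> v1 + w1 \<and> v2 \<le> Y \<and> Y \<le> v2 + w2}"
  have "\<exists>\<alpha> \<beta> \<gamma>. (\<alpha> \<noteq> 0 \<or> \<beta> \<noteq> 0) \<and> (\<forall>X Y. (X, Y) \<in> ?P \<longrightarrow> \<alpha> * X + \<beta> * Y = \<gamma>)"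
  proof (rule collinear_if_dets_zero)
    fix x1 y1 x2 y2 x3 y3
    assume P: "(x1, y1) \<in> ?P" "(x2, y2) \<in> ?P" "(x3, y3) \<in> ?P"
    show "(x2 - x1) * (y3 - y1) = (x3 - x1) * (y2 - y1)"
    proof (cases e)
      case True
      have eq: "x = x'" if A: "(x, y) \<in> ?P" "(x', y') \<in> ?P" for x y x' y'
      proof -
        obtain q :: nat where q1: "N \<le> q" "q < 2 * N" "real q * x \<in> \<int>"
          using A(1) by (auto simp: obstacles_def)
        obtain q' :: nat where q2: "N \<le> q'" "q' < 2 * N" "real q' * x' \<in> \<int>"
          using A(2) by (auto simp: obstacles_def)
        note q = q1 q2
        have "real q * real q' * (x - x') = real q' * (real q * x) - real q * (real q' * x')"
          by (simp add: algebra_simps)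
        also have "\<dots> \<in> \<int>"
          by (rule Ints_diff[OF Ints_mult[OF Ints_of_nat q1(3)] Ints_mult[OF Ints_of_nat q2(3)]])
        finally have int: "real q * real q' * (x - x') \<in> \<int>" .
        have "\<bar>x - x'\<bar> \<le> w1" using that by auto
        then have "\<bar>real q * real q' * (x - x')\<bar> \<le> (2 * real N) * (2 * real N) * w1"
          unfolding abs_mult using q w by (intro mult_mono) auto
        also have "\<dots> < 1" using e[OF True] by (simp add: power2_eq_square)
        finally have "real q * real q' * (x - x') = 0" using int Ints_abs_less_one by blast
        then show "x = x'" using q N by simp
      qed
      show ?thesis using eq[OF P(1,2)] eq[OF P(1,3)] by simp
    next
      case False
      obtain q1 q2 q3 :: nat where q: "N \<le> q1" "q1 < 2 * N" "N \<le> q2" "q2 < 2 * N" "N \<le> q3" "q3 < 2 * N"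
        and i: "real q1 * x1 \<in> \<int>" "real q1 * y1 \<in> \<int>" "real q2 * x2 \<in> \<int>" "real q2 * y2 \<in> \<int>"
          "real q3 * x3 \<in> \<int>" "real q3 * y3 \<in> \<int>"
        using P False by (auto simp: obstacles_def)
      define D where "D = (x2 - x1) * (y3 - y1) - (x3 - x1) * (y2 - y1)"
      \<comment> \<open>The product \<open>x1 * y1\<close> cancels in D. Every remaining product
        pairs two different points, so multiplying by each denominator once clears all
        fractions.\<close>
      have "real q1 * real q2 * real q3 * D =
          real q1 * (real q2 * x2) * (real q3 * y3) - real q3 * (real q2 * x2) * (real q1 * y1)
        - real q2 * (real q1 * x1) * (real q3 * y3) - real q1 * (real q3 * x3) * (real q2 * y2)
        + real q2 * (real q3 * x3) * (real q1 * y1) + real q3 * (real q1 * x1) * (real q2 * y2)"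
        unfolding D_def by algebra
      also have "\<dots> \<in> \<int>" by (intro Ints_diff Ints_add Ints_mult[OF Ints_mult[OF Ints_of_nat]] i)
      finally have int: "real q1 * real q2 * real q3 * D \<in> \<int>" .
      have "\<bar>D\<bar> \<le> \<bar>x2 - x1\<bar> * \<bar>y3 - y1\<bar> + \<bar>x3 - x1\<bar> * \<bar>y2 - y1\<bar>"
        unfolding D_def by (metis abs_mult abs_triangle_ineq4)
      also have "\<dots> \<le> w1 * w2 + w1 * w2"
        using P w by (intro add_mono mult_mono) auto
      finally have "\<bar>real q1 * real q2 * real q3 * D\<bar> \<le> (2 * real N) * (2 * real N) * (2 * real N) * (2 * w1 * w2)"
        unfolding abs_mult using q w by (intro mult_mono) auto
      also have "\<dots> < 1" using ne[OF False] by (simp add: power3_eq_cube mult.commute mult.left_commute)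
      finally have "real q1 * real q2 * real q3 * D = 0" using int Ints_abs_less_one by blast
      then show ?thesis using q N by (simp add: D_def)
    qed
  qed
  then show ?thesis by (simp add: imp_conjL)
qed

lemma half_le_floor:
  fixes y :: real
  assumes "y \<ge> 1"
  shows "y / 2 \<le> real (nat \<lfloor>y\<rfloor>)"
proof -
  have "1 \<le> \<lfloor>y\<rfloor>" using assms by simp
  then have "real (nat \<lfloor>y\<rfloor>) = of_int \<lfloor>y\<rfloor>" "(1::real) \<le> of_int \<lfloor>y\<rfloor>" by auto
  then show ?thesis using floor_correct[of y] by linarith
qed

text \<open>Pigeonhole for the Q + 1 multiples 0, ..., Q in \<open>k1 * k2 \<le> Q\<close> boxes of
  the torus. The numbers of boxes must be integers; rounding \<open>Q powr s\<close> down at most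
  halves it, which costs the factor 2.\<close>

lemma weighted_dirichlet:
  fixes x1 x2 s1 s2 :: real and Q :: nat
  assumes Q: "Q \<ge> 1" and s: "s1 \<ge> 0" "s2 \<ge> 0" "s1 + s2 = 1"
  shows "\<exists>(q::nat) (p1::int) (p2::int). 1 \<le> q \<and> q \<le> Q \<and> \<bar>q * x1 - p1\<bar> \<le> 2 * Q powr - s1 \<and> \<bar>q * x2 - p2\<bar> \<le> 2 * Q powr - s2"
proof -
  define k1 k2 where "k1 = nat \<lfloor>Q powr s1\<rfloor>" and "k2 = nat \<lfloor>Q powr s2\<rfloor>"
  have ge1: "Q powr s1 \<ge> 1" "Q powr s2 \<ge> 1" using Q s by (auto intro: ge_one_powr_ge_zero)
  have k: "k1 > 0" "k2 > 0" using ge1 by (auto simp: k1_def k2_def)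
  have "real k1 * real k2 \<le> Q powr s1 * Q powr s2"
    using ge1 by (intro mult_mono) (auto simp: k1_def k2_def)
  also have "\<dots> = real Q" using Q s by (simp flip: powr_add)
  finally have kQ: "k1 * k2 \<le> Q" by (simp flip: of_nat_mult)
  define f where "f q = (\<lfloor>real k1 * frac (real q * x1)\<rfloor>, \<lfloor>real k2 * frac (real q * x2)\<rfloor>)" for q :: nat
  have "f ` {0..Q} \<subseteq> {0..<int k1} \<times> {0..<int k2}"
    using k by (auto simp: f_def floor_less_iff frac_lt_1)
  then have "card (f ` {0..Q}) \<le> card ({0..<int k1} \<times> {0..<int k2})" by (intro card_mono) auto
  also have "\<dots> < card {0..Q}" using kQ by simp
  finally have "\<not> inj_on f {0..Q}" by (rule pigeonhole)
  then obtain a b where ab: "a \<le> Q" "b \<le> Q" "f a = f b" "a < b"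
    by (auto simp: inj_on_def) (metis linorder_neqE_nat)
  have *: "\<bar>real (b - a) * x - of_int (\<lfloor>real b * x\<rfloor> - \<lfloor>real a * x\<rfloor>)\<bar> \<le> 2 * Q powr - s"
    if "\<lfloor>real k * frac (real a * x)\<rfloor> = \<lfloor>real k * frac (real b * x)\<rfloor>" "k = nat \<lfloor>Q powr s\<rfloor>" "Q powr s \<ge> 1" for x s and k :: nat
  proof -
    have k: "Q powr s / 2 \<le> real k" using half_le_floor[OF that(3)] that(2) by simp
    have k0: "real k > 0" using k that(3) by linarith
    have "\<bar>real k * frac (real b * x) - real k * frac (real a * x)\<bar> < 1" using that(1) by linarith
    then have "real k * \<bar>frac (real b * x) - frac (real a * x)\<bar> < 1"
      by (simp add: abs_mult flip: right_diff_distrib)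
    then have "\<bar>frac (real b * x) - frac (real a * x)\<bar> \<le> 1 / real k" using k0 by (simp add: field_simps)
    also have "\<dots> \<le> 1 / (Q powr s / 2)" using k k0 that(3) by (intro divide_left_mono mult_pos_pos) (use Q in auto)
    finally show ?thesis using ab by (simp add: frac_def of_nat_diff powr_minus_divide left_diff_distrib algebra_simps)
  qed
  have "1 \<le> b - a" "b - a \<le> Q" using ab by auto
  moreover have "\<bar>real (b - a) * x1 - of_int (\<lfloor>real b * x1\<rfloor> - \<lfloor>real a * x1\<rfloor>)\<bar> \<le> 2 * Q powr - s1"
    using ab(3) ge1 k1_def by (intro *[of k1]) (auto simp: f_def)
  moreover have "\<bar>real (b - a) * x2 - of_int (\<lfloor>real b * x2\<rfloor> - \<lfloor>real a * x2\<rfloor>)\<bar> \<le> 2 * Q powr - s2"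
    using ab(3) ge1 k2_def by (intro *[of k2]) (auto simp: f_def)
  ultimately show ?thesis by blast
qed

text \<open>Points in the same cell of the l1 by l2 lattice differ by less than l1 and less than l2,
  so the map from points to cells is injective. The summands 2 count cells that are only partly
  inside the box.\<close>

lemma separated_card:
  fixes X Y :: "'a \<Rightarrow> real"
  assumes "l1 > 0" "l2 > 0" "r1 \<ge> 0" "r2 \<ge> 0"
    and sep: "\<And>a b. a \<in> S \<Longrightarrow> b \<in> S \<Longrightarrow> a \<noteq> b \<Longrightarrow> l1 \<le> \<bar>X a - X b\<bar> \<or> l2 \<le> \<bar>Y a - Y b\<bar>"
    and box: "\<And>a. a \<in> S \<Longrightarrow> v1 \<le> X a \<and> X a \<le> v1 + r1 \<and> v2 \<le> Y a \<and> Y a \<le> v2 + r2"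
  shows "finite S" "real (card S) \<le> (r1 / l1 + 2) * (r2 / l2 + 2)"
proof -
  define I where "I l v r = {i::int. v / l - 1 \<le> of_int i \<and> of_int i \<le> (v + r) / l}" for l v r :: real
  have I: "finite (I l v r)" "real (card (I l v r)) \<le> r / l + 2" if "l > 0" "r \<ge> 0" for l v r
  proof -
    have "0 \<le> r / l" using that by simp
    then have le: "v / l - 1 \<le> (v + r) / l" unfolding add_divide_distrib by linarith
    show "finite (I l v r)" by (rule card_int_interval(1)[OF _ le]) (auto simp: I_def)
    have "real (card (I l v r)) \<le> (v + r) / l - (v / l - 1) + 1"
      by (rule card_int_interval(2)[OF _ le]) (auto simp: I_def)
    then show "real (card (I l v r)) \<le> r / l + 2" using that by (simp add: add_divide_distrib)
  qed
  have fl: "\<lfloor>x / l\<rfloor> \<in> I l v r" if "v \<le> x" "x \<le> v + r" "l > 0" for x l v r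
  proof -
    have "v / l \<le> x / l" "x / l \<le> (v + r) / l" using that divide_right_mono[of v x l] divide_right_mono[of x "v + r" l] by simp_all
    moreover have "a - 1 \<le> of_int \<lfloor>y\<rfloor> \<and> of_int \<lfloor>y\<rfloor> \<le> b" if "a \<le> y" "y \<le> b" for a b y :: real
      using that by linarith
    ultimately show ?thesis unfolding I_def by blast
  qed
  define f where "f a = (\<lfloor>X a / l1\<rfloor>, \<lfloor>Y a / l2\<rfloor>)" for a
  have same: "\<bar>x - y\<bar> < l" if "\<lfloor>x / l\<rfloor> = \<lfloor>y / l\<rfloor>" "l > 0" for x y l :: real
  proof -
    have "\<bar>x / l - y / l\<bar> < 1" using that(1) by linarith
    then have "\<bar>x - y\<bar> / l < 1" using that(2) by (simp flip: diff_divide_distrib)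
    then show ?thesis using that(2) by simp
  qed
  have inj: "inj_on f S"
  proof (rule inj_onI, rule ccontr)
    fix a b assume ab: "a \<in> S" "b \<in> S" "f a = f b" "a \<noteq> b"
    then have "\<bar>X a - X b\<bar> < l1" "\<bar>Y a - Y b\<bar> < l2" using assms(1,2) by (auto simp: f_def intro: same)
    then show False using sep[OF ab(1,2,4)] by linarith
  qed
  have sub: "f ` S \<subseteq> I l1 v1 r1 \<times> I l2 v2 r2"
    using box assms(1,2) by (auto simp: f_def intro!: fl)
  have fin: "finite (I l1 v1 r1 \<times> I l2 v2 r2)" using I assms by auto
  show "finite S" using finite_subset[OF sub fin] inj finite_imageD by blast
  have "card S = card (f ` S)" using inj by (simp add: card_image)
  also have "\<dots> \<le> card (I l1 v1 r1 \<times> I l2 v2 r2)" using sub fin by (rule card_mono[rotated])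
  finally have "real (card S) \<le> real (card (I l1 v1 r1)) * real (card (I l2 v2 r2))"
    by (simp add: card_cartesian_product flip: of_nat_mult)
  also have "\<dots> \<le> (r1 / l1 + 2) * (r2 / l2 + 2)"
    using I assms by (intro mult_mono) auto
  finally show "real (card S) \<le> (r1 / l1 + 2) * (r2 / l2 + 2)" .
qed

section \<open>Geometric sums over dyadic denominators\<close>

lemma sum_geometric_le:
  fixes a X :: real and J :: "nat set"
  assumes "a > 0" "finite J" "\<And>j. j \<in> J \<Longrightarrow> 2 ^ j \<le> X" "X > 0"
  shows "(\<Sum>j\<in>J. (2 ^ j) powr a) \<le> X powr a / (1 - 2 powr - a)"
proof (cases "J = {}")
  case True
  then show ?thesis using powr_less_one[of 2 "- a"] assms by simp
next
  case False
  define r where "r = 2 powr - a"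
  have r: "0 < r" "r < 1" using assms by (auto simp: r_def powr_less_one)
  define m where "m = Max J"
  have m: "m \<in> J" "\<And>j. j \<in> J \<Longrightarrow> j \<le> m" using False assms by (auto simp: m_def)
  have "(\<Sum>j\<in>J. (2 ^ j) powr a) \<le> (\<Sum>j\<in>{..m}. (2 ^ j) powr a)"
    using m by (intro sum_mono2) auto
  also have "\<dots> = (\<Sum>j\<in>{..m}. (2 ^ m) powr a * r ^ (m - j))"
  proof (rule sum.cong)
    fix j assume "j \<in> {..m}"
    then have "m = j + (m - j)" by simp
    then have "(2::real) ^ m = 2 ^ j * 2 ^ (m - j)" by (metis power_add)
    then have "(2 ^ m) powr a * r ^ (m - j) = (2 ^ j) powr a * ((2 ^ (m - j)) powr a * r ^ (m - j))"
      by (simp add: powr_mult)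
    also have "(2 ^ (m - j)) powr a * r ^ (m - j) = 1"
      by (simp add: r_def powr_power flip: powr_realpow powr_powr powr_add) (simp add: powr_powr flip: powr_add)
    finally show "(2 ^ j) powr a = (2 ^ m) powr a * r ^ (m - j)" by simp
  qed auto
  also have "\<dots> = (2 ^ m) powr a * (\<Sum>j\<in>{..m}. r ^ (m - j))" by (simp add: sum_distrib_left)
  also have "(\<Sum>j\<in>{..m}. r ^ (m - j)) = (\<Sum>j\<le>m. r ^ j)"
    by (rule sum.reindex_bij_witness[of _ "\<lambda>j. m - j" "\<lambda>j. m - j"]) auto
  also have "\<dots> = (1 - r ^ Suc m) / (1 - r)"
    using sum_gp0[of r m] r by simp
  also have "\<dots> \<le> 1 / (1 - r)" using r by (intro divide_right_mono) auto
  also have "(2 ^ m) powr a * (1 / (1 - r)) \<le> X powr a * (1 / (1 - r))"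
    using r assms m by (intro mult_right_mono powr_mono2) auto
  finally show ?thesis using assms by (simp add: r_def)
qed

lemma sum_geometric_ge:
  fixes a Y :: real and J :: "nat set"
  assumes "a > 0" "finite J" "\<And>j. j \<in> J \<Longrightarrow> Y \<le> 2 ^ j" "Y > 0"
  shows "(\<Sum>j\<in>J. (2 ^ j) powr - a) \<le> Y powr - a / (1 - 2 powr - a)"
proof (cases "J = {}")
  case True
  then show ?thesis using powr_less_one[of 2 "- a"] assms by simp
next
  case False
  define r where "r = 2 powr - a"
  have r: "0 < r" "r < 1" using assms by (auto simp: r_def powr_less_one)
  define m where "m = Min J"
  define n where "n = Max J"
  have m: "m \<in> J" "\<And>j. j \<in> J \<Longrightarrow> m \<le> j" "\<And>j. j \<in> J \<Longrightarrow> j \<le> n" using False assms by (auto simp: m_def n_def)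
  have pw: "(2 ^ j) powr - a = r ^ j" for j :: nat
    by (simp add: r_def powr_power powr_powr mult.commute flip: powr_realpow)
  have "(\<Sum>j\<in>J. (2 ^ j) powr - a) = (\<Sum>j\<in>J. r ^ j)" by (simp add: pw)
  also have "\<dots> \<le> (\<Sum>j\<in>{m..n}. r ^ j)" using m r by (intro sum_mono2) auto
  also have "\<dots> = (if n < m then 0 else (r ^ m - r ^ Suc n) / (1 - r))"
    using sum_gp[of r m n] r by simp
  also have "\<dots> \<le> r ^ m / (1 - r)" using r by (auto intro!: divide_right_mono)
  also have "\<dots> = (2 ^ m) powr - a / (1 - r)" by (simp add: pw)
  also have "\<dots> \<le> Y powr - a / (1 - r)"
    using r assms m by (intro divide_right_mono powr_mono2') auto
  finally show ?thesis by (simp add: r_def)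
qed


lemma one_minus_two_powr_pos: "0 < a \<Longrightarrow> 0 < 1 - 2 powr - a" for a :: real
  using powr_less_one[of 2 "- a"] by simp

lemma one_minus_two_powr_ge_half:
  fixes a :: real
  assumes "1 \<le> a"
  shows "1 / 2 \<le> 1 - 2 powr - a"
proof -
  have "2 powr - a \<le> 2 powr - (1::real)" using assms by (intro powr_mono) auto
  then show ?thesis by (simp add: powr_minus)
qed

text \<open>One coordinate of the bound of \<open>grid_count\<close>, summed over N =
  \<open>2 ^ j\<close>. Here \<open>1 / (m j * g)\<close> is at most \<open>4 / a\<close> (the block
  spans the rectangle) plus \<open>26 * N powr (1 + s)\<close> (the block is a cell), and
  \<open>R j + g\<close> is a c-term plus \<open>11 * Q powr - s / N\<close>. Multiplying out gives
  four geometric series, dominated respectively by N near \<open>d * Q0 / 2\<close>, by N = 1 twice,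
  and by N near \<open>d * Q\<close>. The cutoff in \<open>R\<close> serves the first: without it
  the small N would contribute a term of order \<open>Q0 powr (1 + t)\<close>.\<close>

lemma sum_coordinate_le:
  fixes s t c d a g Q Q0 M :: real and J :: "nat set" and m R :: "nat \<Rightarrow> real"
  assumes st: "0 < s" "s < t" and d: "0 < d" and c: "0 < c" and Q: "Q > 0" "Q0 > 0"
    and J: "finite J" "\<And>j. j \<in> J \<Longrightarrow> 2 ^ j \<le> d * Q"
    and a: "a = Q0 powr (- 1 - t)" and g: "g = 8 / d * Q powr (- 1 - s)"
    and M: "M > 0" "a / 4 \<le> M * g"
    and R: "\<And>j. R j = (if d * Q0 \<le> 2 * 2 ^ j then c * (2 ^ j) powr (- 1 - t) else 0) + 3 * Q powr - s / 2 ^ j"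
    and m: "\<And>j. j \<in> J \<Longrightarrow> m j = M \<or> (m j > 0 \<and> (2 ^ j) powr (- 1 - s) / (26 * g) \<le> m j)"
  shows "(\<Sum>j\<in>J. (R j + g) / (m j * g)) \<le> 8 * c * (d / 2) powr (- 1 - t) + 88 * Q0 powr (1 + t) * Q powr - s
    + 26 * c / (1 - 2 powr - (t - s)) + 286 * d powr s / (1 - 2 powr - s)"
proof -
  let ?\<chi> = "\<lambda>j::nat. if d * Q0 \<le> 2 * 2 ^ j then 1 else (0::real)"
  have g0: "g > 0" using g d Q by simp
  have a0: "a > 0" using a Q by simp
  have bnd: "(R j + g) / (m j * g) \<le> 4 * c * Q0 powr (1 + t) * (?\<chi> j * (2 ^ j) powr - (1 + t))
      + 44 * Q0 powr (1 + t) * Q powr - s * (2 ^ j) powr - 1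
      + 26 * c * (2 ^ j) powr - (t - s) + 286 * Q powr - s * (2 ^ j) powr s" (is "_ \<le> ?r") if j: "j \<in> J" for j
  proof -
    define N :: real where "N = 2 ^ j"
    have N: "N > 0" "N \<le> d * Q" using J(2)[OF j] by (auto simp: N_def)
    have "m j * g > 0" using m[OF j] g0 M by auto
    have inv: "1 / (m j * g) \<le> 4 / a + 26 * N powr (1 + s)"
    proof (cases "m j = M")
      case True
      have "1 / (m j * g) \<le> 1 / (a / 4)" using M a0 g0 True by (intro divide_left_mono) auto
      then show ?thesis using N by (simp add: add_increasing2)
    next
      case False
      then have m': "m j > 0" "N powr (- 1 - s) / (26 * g) \<le> m j" using m[OF j] by (auto simp: N_def)
      then have "N powr (- 1 - s) / 26 \<le> m j * g" using g0 by (simp add: field_simps)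
      then have "1 / (m j * g) \<le> 1 / (N powr (- 1 - s) / 26)"
        using N m' g0 by (intro divide_left_mono) auto
      also have "\<dots> = 26 * N powr (1 + s)" using powr_minus_divide[of N "1 + s"] by (simp add: algebra_simps)
      finally show ?thesis using a0 by (simp add: add_increasing)
    qed
    \<comment> \<open>As N is at most \<open>d * Q\<close>, the mesh is absorbed into the second
      part of the radius: 11 = 3 + 8.\<close>
    have "8 / d * Q powr (- 1 - s) = 8 * Q powr - s / (d * Q)"
      using Q by (simp add: powr_diff powr_minus_divide powr_add field_simps)
    also have "\<dots> \<le> 8 * Q powr - s / N" using N d Q by (intro divide_left_mono) auto
    finally have gN: "g \<le> 8 * Q powr - s / N" using g by simp
    have "11 * Q powr - s / N = 3 * Q powr - s / N + 8 * Q powr - s / N" by (simp flip: add_divide_distrib)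
    moreover have e: "- 1 - t = - (1 + t)" by simp
    have "R j = ?\<chi> j * c * N powr - (1 + t) + 3 * Q powr - s / N"
      unfolding R N_def[symmetric] e by simp
    ultimately have Rg: "R j + g \<le> ?\<chi> j * c * N powr - (1 + t) + 11 * Q powr - s / N"
      using gN by linarith
    have "(R j + g) / (m j * g) = (R j + g) * (1 / (m j * g))" by simp
    also have "\<dots> \<le> (?\<chi> j * c * N powr - (1 + t) + 11 * Q powr - s / N) * (4 / a + 26 * N powr (1 + s))"
      using Rg inv g0 \<open>m j * g > 0\<close> N c by (intro mult_mono) auto
    also have "\<dots> = 4 * c * Q0 powr (1 + t) * (?\<chi> j * N powr - (1 + t)) + 44 * Q0 powr (1 + t) * Q powr - s * N powr - 1
      + 26 * c * ?\<chi> j * (N powr - (1 + t) * N powr (1 + s)) + 286 * Q powr - s * (N powr (1 + s) / N)"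
    proof -
      have "1 / a = Q0 powr (1 + t)" using powr_minus_divide[of Q0 "1 + t"] a by (simp add: algebra_simps)
      moreover have "1 / N = N powr - 1" using N by (simp add: powr_minus_divide)
      moreover have "(x * c * y + 11 * q / N) * (4 / a + 26 * w) = 4 * c * (1 / a) * (x * y) + 44 * (1 / a) * q * (1 / N)
         + 26 * c * x * (y * w) + 286 * q * (w / N)" for x y q w :: real
        using N a0 by (simp add: field_simps)
      ultimately show ?thesis by metis
    qed
    also have "N powr - (1 + t) * N powr (1 + s) = N powr - (t - s)" by (simp flip: powr_add)
    also have "N powr (1 + s) / N = N powr s" using N by (simp add: powr_add)
    also have "26 * c * ?\<chi> j * N powr - (t - s) \<le> 26 * c * N powr - (t - s)" using c by simp
    finally show ?thesis by (simp add: N_def)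
  qed
  have "(\<Sum>j\<in>J. (R j + g) / (m j * g)) \<le> 4 * c * Q0 powr (1 + t) * (\<Sum>j\<in>J. ?\<chi> j * (2 ^ j) powr - (1 + t))
      + 44 * Q0 powr (1 + t) * Q powr - s * (\<Sum>j\<in>J. (2 ^ j) powr - 1)
      + 26 * c * (\<Sum>j\<in>J. (2 ^ j) powr - (t - s)) + 286 * Q powr - s * (\<Sum>j\<in>J. (2 ^ j) powr s)"
    using sum_mono[OF bnd] by (simp only: sum.distrib sum_distrib_left)
  also have "\<dots> \<le> 4 * c * Q0 powr (1 + t) * (2 * (d * Q0 / 2) powr - (1 + t))
      + 44 * Q0 powr (1 + t) * Q powr - s * 2
      + 26 * c * (1 / (1 - 2 powr - (t - s))) + 286 * Q powr - s * ((d * Q) powr s / (1 - 2 powr - s))"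
  proof (intro add_mono mult_left_mono)
    have "(\<Sum>j\<in>J. ?\<chi> j * (2 ^ j) powr - (1 + t)) = (\<Sum>j\<in>{j \<in> J. d * Q0 \<le> 2 * 2 ^ j}. (2 ^ j) powr - (1 + t))"
      using J(1) by (subst sum.inter_filter) (auto intro: sum.cong)
    also have "\<dots> \<le> (d * Q0 / 2) powr - (1 + t) / (1 - 2 powr - (1 + t))"
      using J st d Q by (intro sum_geometric_ge) auto
    also have "\<dots> \<le> (d * Q0 / 2) powr - (1 + t) / (1 / 2)"
      using one_minus_two_powr_ge_half[of "1 + t"] st by (intro divide_left_mono) auto
    finally show "(\<Sum>j\<in>J. ?\<chi> j * (2 ^ j) powr - (1 + t)) \<le> 2 * (d * Q0 / 2) powr - (1 + t)" by simp
    show "(\<Sum>j\<in>J. (2 ^ j) powr - 1) \<le> (2::real)"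
      using sum_geometric_ge[of 1 J 1] J by (simp add: powr_minus)
    show "(\<Sum>j\<in>J. (2 ^ j) powr - (t - s)) \<le> 1 / (1 - 2 powr - (t - s))"
      using sum_geometric_ge[of "t - s" J 1] J st by simp
    show "(\<Sum>j\<in>J. (2 ^ j) powr s) \<le> (d * Q) powr s / (1 - 2 powr - s)"
      using J st d Q by (intro sum_geometric_le) auto
  qed (use c in auto)
  finally have main: "(\<Sum>j\<in>J. (R j + g) / (m j * g)) \<le> 4 * c * Q0 powr (1 + t) * (2 * (d * Q0 / 2) powr - (1 + t))
      + 44 * Q0 powr (1 + t) * Q powr - s * 2
      + 26 * c * (1 / (1 - 2 powr - (t - s))) + 286 * Q powr - s * ((d * Q) powr s / (1 - 2 powr - s))" .
  have "Q0 powr (1 + t) * (d * Q0 / 2) powr - (1 + t) = (d / 2) powr (- 1 - t)"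
  proof -
    have "(d * Q0 / 2) powr - (1 + t) = Q0 powr - (1 + t) * (d / 2) powr - (1 + t)"
      using d Q powr_mult[of Q0 "d / 2" "- (1 + t)"] by (simp add: mult.commute)
    moreover have "Q0 powr (1 + t) * Q0 powr - (1 + t) = 1" using Q by (simp flip: powr_add)
    moreover have "- (1 + t) = - 1 - t" by simp
    ultimately show ?thesis by (metis mult.assoc mult_1)
  qed
  then have "4 * c * Q0 powr (1 + t) * (2 * (d * Q0 / 2) powr - (1 + t)) = 8 * c * (d / 2) powr (- 1 - t)"
    by (simp add: algebra_simps)
  moreover have "Q powr - s * (d * Q) powr s = d powr s"
    using d Q by (simp add: powr_mult powr_minus field_simps)
  then have "286 * Q powr - s * ((d * Q) powr s / (1 - 2 powr - s)) = 286 * d powr s / (1 - 2 powr - s)"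
    by (metis mult.assoc times_divide_eq_right)
  moreover have "44 * Q0 powr (1 + t) * Q powr - s * 2 = 88 * Q0 powr (1 + t) * Q powr - s"
    "26 * c * (1 / (1 - 2 powr - (t - s))) = 26 * c / (1 - 2 powr - (t - s))" by simp_all
  ultimately show ?thesis using main by linarith
qed


subsection \<open>Grid points far from all rationals of small denominator\<close>

lemma small_powr:
  fixes s B :: real
  assumes "s > 0" "B > 0"
  shows "\<exists>d0>0. \<forall>d. 0 < d \<and> d \<le> d0 \<longrightarrow> d powr s \<le> B"
proof (intro exI conjI allI impI)
  show "B powr (1 / s) > 0" using assms by simp
  fix d assume "0 < d \<and> d \<le> B powr (1 / s)"
  then have "d powr s \<le> (B powr (1 / s)) powr s" using assms by (intro powr_mono2) auto
  then show "d powr s \<le> B" using assms by (simp add: powr_powr)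
qed

text \<open>Makes three of the four terms in \<open>sum_coordinate_le\<close> small; the remaining one tends to \<open>0\<close>
  as \<open>Q\<close> grows.\<close>

definition admissible :: "real \<Rightarrow> real \<Rightarrow> real \<Rightarrow> real \<Rightarrow> bool" where
  "admissible d c t s \<longleftrightarrow> d powr s \<le> 1 / 104 \<and> 286 * d powr s / (1 - 2 powr - s) \<le> 1 / 128 \<and>
     8 * c * (d / 2) powr (- 1 - t) \<le> 1 / 128 \<and> 26 * c / (1 - 2 powr - (t - s)) \<le> 1 / 128"

lemma ex_admissible_d:
  fixes s :: real
  assumes "s > 0"
  shows "\<exists>d0>0. \<forall>d. 0 < d \<and> d \<le> d0 \<longrightarrow> d powr s \<le> 1 / 104 \<and> 286 * d powr s / (1 - 2 powr - s) \<le> 1 / 128"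
proof -
  define B where "B = (1 - 2 powr - s) / (286 * 128)"
  have B: "B > 0" using one_minus_two_powr_pos[OF assms] by (simp add: B_def)
  obtain d0 where "d0 > 0" "\<And>d. 0 < d \<and> d \<le> d0 \<Longrightarrow> d powr s \<le> min B (1 / 104)"
    using small_powr[OF assms, of "min B (1 / 104)"] B by auto
  moreover have "286 * x / (1 - 2 powr - s) \<le> 1 / 128" if "x \<le> B" for x
    using that one_minus_two_powr_pos[OF assms] by (simp add: B_def field_simps)
  ultimately show ?thesis by (metis min.bounded_iff)
qed

text \<open>The bound on c involves \<open>(d / 2) powr (- 1 - t)\<close>, so c can be chosen only
  after d.\<close>

lemma ex_admissible_c:
  fixes s t d :: real
  assumes "s < t" "d > 0"
  shows "\<exists>c0>0. \<forall>c. 0 < c \<and> c \<le> c0 \<longrightarrow> 8 * c * (d / 2) powr (- 1 - t) \<le> 1 / 128 \<and> 26 * c / (1 - 2 powr - (t - s)) \<le> 1 / 128"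
proof -
  have p: "(d / 2) powr (- 1 - t) > 0" "1 - 2 powr - (t - s) > 0"
    using assms one_minus_two_powr_pos[of "t - s"] by auto
  define c0 where "c0 = min (1 / (128 * 8 * (d / 2) powr (- 1 - t))) ((1 - 2 powr - (t - s)) / (26 * 128))"
  have "c0 > 0" using p by (simp add: c0_def)
  moreover have "8 * c * (d / 2) powr (- 1 - t) \<le> 1 / 128" "26 * c / (1 - 2 powr - (t - s)) \<le> 1 / 128" if "c \<le> c0" for c
  proof -
    have "c \<le> 1 / (128 * 8 * (d / 2) powr (- 1 - t))" using that by (simp add: c0_def)
    then show "8 * c * (d / 2) powr (- 1 - t) \<le> 1 / 128"
      using p(1) by (simp add: pos_le_divide_eq mult.assoc mult.left_commute)
    have "c \<le> (1 - 2 powr - (t - s)) / (26 * 128)" using that by (simp add: c0_def)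
    then show "26 * c / (1 - 2 powr - (t - s)) \<le> 1 / 128"
      using p(2) by (simp add: field_simps)
  qed
  ultimately show ?thesis by blast
qed

text \<open>The condition \<open>d powr s \<le> 1 / 104\<close> with 104 = 8 * 13 says that a cell
  is at least one mesh wide even for the largest N = \<open>d * Q\<close>; rounding down then loses
  at most a factor 2.\<close>

lemma cell_side:
  fixes s d Q N g :: real
  assumes "d > 0" "Q > 0" "0 < N" "N \<le> d * Q" "d powr s \<le> 1 / 104" "s \<ge> 0" "g = 8 / d * Q powr (- 1 - s)"
  defines "m \<equiv> nat \<lfloor>N powr (- 1 - s) / (13 * g)\<rfloor>"
  shows "m > 0" "N powr (- 1 - s) / (26 * g) \<le> real m" "real m * g \<le> N powr (- 1 - s) / 13"
proof -
  have g: "g > 0" using assms by simp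
  have "104 * d powr s \<le> 1" using assms by simp
  then have "104 * d powr s / (d powr s * d) \<le> 1 / (d powr s * d)"
    using assms by (intro divide_right_mono) auto
  then have "104 / d \<le> 1 / (d powr s * d)" using assms by simp
  also have "\<dots> = d powr - (s + 1)" unfolding powr_minus_divide powr_add using assms by simp
  also have "- (s + 1) = - 1 - s" by simp
  finally have "13 * g \<le> d powr (- 1 - s) * Q powr (- 1 - s)"
    unfolding assms(7) using mult_right_mono[of "104 / d" "d powr (- 1 - s)" "Q powr (- 1 - s)"] by simp
  also have "\<dots> = (d * Q) powr (- 1 - s)" using assms by (simp add: powr_mult)
  also have "\<dots> \<le> N powr (- 1 - s)" using assms by (intro powr_mono2') auto
  finally have ge: "1 \<le> N powr (- 1 - s) / (13 * g)" using g by simp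
  then have h: "N powr (- 1 - s) / (13 * g) / 2 \<le> real m" unfolding m_def by (rule half_le_floor)
  then show "N powr (- 1 - s) / (26 * g) \<le> real m" by simp
  show "m > 0" unfolding m_def using ge by simp
  have "real m \<le> N powr (- 1 - s) / (13 * g)" unfolding m_def using ge by simp
  then show "real m * g \<le> N powr (- 1 - s) / 13" using g by (simp add: field_simps)
qed

text \<open>In the case \<open>t2 = 0\<close> the second coordinate is ignored, which forces \<open>s1 = 1\<close>: only then are the
  lines \<open>x\<^sub>1 = p / q\<close> separated on the scale of the blocks.\<close>

locale weights =
  fixes t1 t2 s1 s2 :: real
  assumes s_sum: "s1 + s2 = 1" and s2_le: "s2 \<le> s1" and s2_ge: "0 \<le> s2" and s1_less: "s1 < t1"
    and t2_le: "t2 \<le> t1" and s2_cases: "t2 = 0 \<and> s2 = 0 \<or> 0 < s2 \<and> s2 < t2"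
begin

lemma s1_ge: "1 / 2 \<le> s1"
  using s_sum s2_le by linarith

lemma t2_ge: "0 \<le> t2" "s2 \<le> t2"
  using s2_cases by auto

lemma ex_admissible:
  "\<exists>d c. 0 < d \<and> d < 1 \<and> 0 < c \<and> c < 1 \<and> admissible d c t1 s1 \<and> (t2 \<noteq> 0 \<longrightarrow> admissible d c t2 s2)"
proof -
  obtain d1 where d1: "d1 > 0" "\<And>d. 0 < d \<and> d \<le> d1 \<Longrightarrow> d powr s1 \<le> 1 / 104 \<and> 286 * d powr s1 / (1 - 2 powr - s1) \<le> 1 / 128"
    using ex_admissible_d[of s1] s1_ge by auto
  obtain d2 where d2: "d2 > 0" "\<And>d. t2 \<noteq> 0 \<Longrightarrow> 0 < d \<and> d \<le> d2 \<Longrightarrow> d powr s2 \<le> 1 / 104 \<and> 286 * d powr s2 / (1 - 2 powr - s2) \<le> 1 / 128"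
  proof (cases "t2 = 0")
    case True
    then show ?thesis using that[of 1] by auto
  next
    case False
    then show ?thesis using ex_admissible_d[of s2] s2_cases that by auto
  qed
  define d where "d = min (1 / 2) (min d1 d2)"
  have d: "0 < d" "d < 1" "d \<le> d1" "d \<le> d2" using d1 d2 by (auto simp: d_def)
  obtain c1 where c1: "c1 > 0" "\<And>c. 0 < c \<and> c \<le> c1 \<Longrightarrow> 8 * c * (d / 2) powr (- 1 - t1) \<le> 1 / 128 \<and> 26 * c / (1 - 2 powr - (t1 - s1)) \<le> 1 / 128"
    using ex_admissible_c[OF s1_less d(1)] by auto
  obtain c2 where c2: "c2 > 0" "\<And>c. t2 \<noteq> 0 \<Longrightarrow> 0 < c \<and> c \<le> c2 \<Longrightarrow> 8 * c * (d / 2) powr (- 1 - t2) \<le> 1 / 128 \<and> 26 * c / (1 - 2 powr - (t2 - s2)) \<le> 1 / 128"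
  proof (cases "t2 = 0")
    case True
    then show ?thesis using that[of 1] by auto
  next
    case False
    then show ?thesis using ex_admissible_c[of s2 t2 d] s2_cases d that by auto
  qed
  define c where "c = min (1 / 2) (min c1 c2)"
  have c: "0 < c" "c < 1" "c \<le> c1" "c \<le> c2" using c1 c2 by (auto simp: c_def)
  show ?thesis using d c d1(2)[of d] d2(2)[of d] c1(2)[of c] c2(2)[of c]
    unfolding admissible_def by blast
qed

text \<open>The value 13 is the least integer that suits both cases after tripling the sides: 4 * 3
  / 13 < 1 and 16 * 9 / 169 < 1. The exponents match because the weights add up to 1.\<close>

lemma obstacle_lines_cell:
  fixes N :: nat and w1 w2 :: real
  assumes N: "N \<ge> 1" and w: "0 \<le> w1" "0 \<le> w2" "w1 \<le> real N powr (- 1 - s1) / 13"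
    "t2 \<noteq> 0 \<Longrightarrow> w2 \<le> real N powr (- 1 - s2) / 13"
  shows "\<exists>\<alpha> \<beta> \<gamma>. (\<alpha> \<noteq> 0 \<or> \<beta> \<noteq> 0) \<and> (\<forall>X Y. (X, Y) \<in> obstacles (t2 = 0) N \<longrightarrow> v1 \<le> X \<longrightarrow> X \<le> v1 + 3 * w1 \<longrightarrow>
       v2 \<le> Y \<longrightarrow> Y \<le> v2 + 3 * w2 \<longrightarrow> \<alpha> * X + \<beta> * Y = \<gamma>)"
proof (rule obstacles_lines[OF N])
  assume "t2 = 0"
  then have "s1 = 1" using s_sum s2_cases by auto
  then have "w1 \<le> real N powr (- 2) / 13" using w by simp
  also have "real N powr (- 2) = 1 / (real N)^2" using N powr_minus_divide[of "real N" 2] by simp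
  finally have "(real N)^2 * w1 \<le> 1 / 13" using N by (simp add: field_simps)
  then show "4 * (real N)^2 * (3 * w1) < 1" by simp
next
  assume "t2 \<noteq> 0"
  then have "w1 * w2 \<le> (real N powr (- 1 - s1) / 13) * (real N powr (- 1 - s2) / 13)"
    using w by (intro mult_mono) auto
  also have "\<dots> = real N powr ((- 1 - s1) + (- 1 - s2)) / 169" unfolding powr_add by simp
  also have "(- 1 - s1) + (- 1 - s2) = - 3" using s_sum by simp
  also have "real N powr (- 3) = 1 / (real N)^3" using N powr_minus_divide[of "real N" 3] by simp
  finally have "w1 * w2 * (real N)^3 \<le> 1 / 169" using N by (simp add: field_simps)
  then show "16 * (3 * w1) * (3 * w2) * (real N)^3 < 1" by simp
qed (use w in auto)

text \<open>Each coordinate contributes at most 1/32, as four terms of size 1/128 or by the separate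
  estimate for t2 = 0. With the factor 8 of \<open>grid_count\<close> the discarded proportion is at
  most 8 * (1/32 + 1/32) = 1/2.\<close>

lemma good_grid:
  fixes d c u1 u2 a1 a2 g1 g2 :: real and Q0 Q M1 M2 :: nat and R1 R2 :: "nat \<Rightarrow> real"
  assumes dc: "0 < d" "d < 1" "0 < c" "admissible d c t1 s1" "t2 \<noteq> 0 \<Longrightarrow> admissible d c t2 s2"
    and Q: "0 < Q0" "0 < Q"
    and a: "a1 = real Q0 powr (- 1 - t1)" "a2 = real Q0 powr (- 1 - t2)"
    and g: "g1 = 8 / d * real Q powr (- 1 - s1)" "g2 = 8 / d * real Q powr (- 1 - s2)"
    and M: "M1 = nat \<lfloor>a1 / (2 * g1)\<rfloor>" "M2 = nat \<lfloor>a2 / (2 * g2)\<rfloor>"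
    and ge1: "1 \<le> a1 / (2 * g1)" "1 \<le> a2 / (2 * g2)"
    and large: "88 * real Q0 powr (1 + t1) * real Q powr - s1 \<le> 1 / 128"
      "t2 \<noteq> 0 \<Longrightarrow> 88 * real Q0 powr (1 + t2) * real Q powr - s2 \<le> 1 / 128"
      "t2 = 0 \<Longrightarrow> 128 / d * real Q0 * real Q powr - (1 / 2) \<le> 1 / 32"
    and R1: "\<And>j. R1 j = (if d * real Q0 \<le> 2 * 2 ^ j then c * (2 ^ j) powr (- 1 - t1) else 0) + 3 * real Q powr - s1 / 2 ^ j"
    and R2: "\<And>j. R2 j = (if t2 = 0 then 0 else (if d * real Q0 \<le> 2 * 2 ^ j then c * (2 ^ j) powr (- 1 - t2) else 0) + 3 * real Q powr - s2 / 2 ^ j)"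
  shows "\<exists>G \<subseteq> {..<M1} \<times> {..<M2}. real M1 * real M2 / 2 \<le> real (card G) \<and>
    (\<forall>(k1, k2)\<in>G. \<forall>j. 2 ^ j \<le> d * real Q \<longrightarrow>
       \<not> (\<exists>(X, Y)\<in>obstacles (t2 = 0) (2 ^ j). \<bar>u1 + real k1 * g1 - X\<bar> \<le> R1 j \<and> \<bar>u2 + real k2 * g2 - Y\<bar> \<le> R2 j))"
proof -
  define J where "J = {j::nat. 2 ^ j \<le> d * real Q}"
  have J: "finite J" "\<And>j. j \<in> J \<Longrightarrow> 2 ^ j \<le> d * real Q"
  proof -
    have "J \<subseteq> {..Q}"
    proof
      fix j assume "j \<in> J"
      then have "real (2 ^ j) \<le> d * real Q" by (simp add: J_def)
      also have "\<dots> \<le> real Q" using dc by (simp add: mult_left_le_one_le)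
      finally have "2 ^ j \<le> Q" by (simp only: of_nat_le_iff)
      from less_le_trans[OF less_exp this] show "j \<in> {..Q}" by simp
    qed
    then show "finite J" by (rule finite_subset) simp
  qed (simp add: J_def)
  have g0: "g1 > 0" "g2 > 0" using g dc Q by auto
  have a0: "a1 > 0" "a2 > 0" using a Q by auto
  have Mg: "M1 > 0" "M2 > 0" "a1 / 4 \<le> real M1 * g1" "a2 / 4 \<le> real M2 * g2"
  proof -
    show "M1 > 0" "M2 > 0" using M ge1 by auto
    have "a1 / (2 * g1) / 2 \<le> real M1" "a2 / (2 * g2) / 2 \<le> real M2"
      unfolding M by (rule half_le_floor, rule ge1)+
    then show "a1 / 4 \<le> real M1 * g1" "a2 / 4 \<le> real M2 * g2" using g0 by (auto simp: field_simps)
  qed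
  define f1 f2 where "f1 j = nat \<lfloor>(2 ^ j) powr (- 1 - s1) / (13 * g1)\<rfloor>"
    and "f2 j = nat \<lfloor>(2 ^ j) powr (- 1 - s2) / (13 * g2)\<rfloor>" for j :: nat
  \<comment> \<open>The minimum keeps a block inside the grid. For t2 = 0 the obstacles are vertical
    lines, so a block may have the full height of the grid.\<close>
  define m1 m2 where "m1 j = min M1 (f1 j)" and "m2 j = (if t2 = 0 then M2 else min M2 (f2 j))" for j
  have f1: "f1 j > 0" "(2 ^ j) powr (- 1 - s1) / (26 * g1) \<le> real (f1 j)" "real (f1 j) * g1 \<le> (2 ^ j) powr (- 1 - s1) / 13"
    if "j \<in> J" for j
    using cell_side[of d "real Q" "2 ^ j" s1 g1] J(2)[OF that] dc g Q s1_ge by (auto simp: admissible_def f1_def)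
  have f2: "f2 j > 0" "(2 ^ j) powr (- 1 - s2) / (26 * g2) \<le> real (f2 j)" "real (f2 j) * g2 \<le> (2 ^ j) powr (- 1 - s2) / 13"
    if "j \<in> J" "t2 \<noteq> 0" for j
    using cell_side[of d "real Q" "2 ^ j" s2 g2] J(2)[OF that(1)] that(2) dc g Q s2_ge by (auto simp: admissible_def f2_def)
  have m: "m1 j > 0" "m2 j > 0" "m1 j \<le> M1" "m2 j \<le> M2" if "j \<in> J" for j
    using f1[OF that] f2[OF that] Mg by (auto simp: m1_def m2_def)
  have Rnn: "R1 j \<ge> 0" "R2 j \<ge> 0" for j using dc by (auto simp: R1 R2)
  define bad where "bad j = {(i, k). i < M1 \<and> k < M2 \<and> (\<exists>(X, Y)\<in>obstacles (t2 = 0) (2 ^ j).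
      \<bar>u1 + real i * g1 - X\<bar> \<le> R1 j \<and> \<bar>u2 + real k * g2 - Y\<bar> \<le> R2 j)}" for j
  have badsub: "bad j \<subseteq> {..<M1} \<times> {..<M2}" for j by (auto simp: bad_def)
  have cb: "real (card (bad j)) \<le> real M1 * real M2 * (8 * ((R1 j + g1) / (m1 j * g1) + (R2 j + g2) / (m2 j * g2)))"
    if j: "j \<in> J" for j
    unfolding bad_def
  proof (rule grid_count)
    fix v1 v2
    have "real (m1 j) * g1 \<le> real (f1 j) * g1" "t2 \<noteq> 0 \<Longrightarrow> real (m2 j) * g2 \<le> real (f2 j) * g2"
      using g0 by (auto simp: m1_def m2_def)
    then have "real (m1 j) * g1 \<le> real (2 ^ j) powr (- 1 - s1) / 13" "t2 \<noteq> 0 \<Longrightarrow> real (m2 j) * g2 \<le> real (2 ^ j) powr (- 1 - s2) / 13"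
      using f1(3)[OF j] f2(3)[OF j] by fastforce+
    then show "\<exists>\<alpha> \<beta> \<gamma>. (\<alpha> \<noteq> 0 \<or> \<beta> \<noteq> 0) \<and> (\<forall>X Y. (X, Y) \<in> obstacles (t2 = 0) (2 ^ j) \<longrightarrow> v1 \<le> X \<longrightarrow> X \<le> v1 + 3 * (real (m1 j) * g1) \<longrightarrow>
       v2 \<le> Y \<longrightarrow> Y \<le> v2 + 3 * (real (m2 j) * g2) \<longrightarrow> \<alpha> * X + \<beta> * Y = \<gamma>)"
      using g0 by (intro obstacle_lines_cell) auto
  qed (use m[OF j] g0 Rnn in auto)
  have sum1: "(\<Sum>j\<in>J. (R1 j + g1) / (m1 j * g1)) \<le> 1 / 32"
  proof -
    have "(\<Sum>j\<in>J. (R1 j + g1) / (m1 j * g1)) \<le> 8 * c * (d / 2) powr (- 1 - t1) + 88 * real Q0 powr (1 + t1) * real Q powr - s1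
      + 26 * c / (1 - 2 powr - (t1 - s1)) + 286 * d powr s1 / (1 - 2 powr - s1)"
      using s1_ge s1_less dc Q J a g Mg R1 f1 by (intro sum_coordinate_le) (auto simp: m1_def min_def)
    then show ?thesis using dc(4) large(1) unfolding admissible_def by linarith
  qed
  have sum2: "(\<Sum>j\<in>J. (R2 j + g2) / (m2 j * g2)) \<le> 1 / 32"
  proof (cases "t2 = 0")
    case False
    have "(\<Sum>j\<in>J. (R2 j + g2) / (m2 j * g2)) \<le> 8 * c * (d / 2) powr (- 1 - t2) + 88 * real Q0 powr (1 + t2) * real Q powr - s2
      + 26 * c / (1 - 2 powr - (t2 - s2)) + 286 * d powr s2 / (1 - 2 powr - s2)"
      using s2_cases False dc Q J a g Mg R2 f2 by (intro sum_coordinate_le) (auto simp: m2_def min_def)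
    then show ?thesis using dc(5)[OF False] large(2)[OF False] unfolding admissible_def by linarith
  next
    case True
    then have "s2 = 0" using s2_cases by auto
    \<comment> \<open>For t2 = 0 the summand is \<open>1 / M2\<close>, the same for all scales, and
      there are about log Q scales. The factor \<open>(2 ^ j) powr (1 / 2) \<ge> 1\<close> is
      inserted to sum them as a geometric series; the resulting \<open>Q powr (1 / 2)\<close> is
      still beaten by \<open>Q powr - 1\<close>.\<close>
    have "(R2 j + g2) / (m2 j * g2) \<le> 32 / d * real Q0 * real Q powr - 1 * (2 ^ j) powr (1 / 2)" for j
    proof -
      have "(R2 j + g2) / (m2 j * g2) = g2 / (M2 * g2)" using True by (simp add: R2 m2_def)
      also have "\<dots> \<le> g2 / (a2 / 4)" using g0 a0 Mg by (intro divide_left_mono) auto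
      also have "\<dots> = 32 / d * real Q0 * real Q powr - 1"
        using True \<open>s2 = 0\<close> Q dc by (simp add: g a powr_minus field_simps)
      also have "\<dots> \<le> 32 / d * real Q0 * real Q powr - 1 * (2 ^ j) powr (1 / 2)"
        using ge_one_powr_ge_zero[of "2 ^ j" "1 / 2"] dc mult_left_mono[of 1 "(2 ^ j) powr (1 / 2)" "32 / d * real Q0 * real Q powr - 1"] by simp
      finally show ?thesis .
    qed
    then have le: "(\<Sum>j\<in>J. (R2 j + g2) / (m2 j * g2)) \<le> 32 / d * real Q0 * real Q powr - 1 * (\<Sum>j\<in>J. (2 ^ j) powr (1 / 2))"
      unfolding sum_distrib_left by (rule sum_mono)
    have "(\<Sum>j\<in>J. (2 ^ j) powr (1 / 2)) \<le> (d * real Q) powr (1 / 2) / (1 - 2 powr - (1 / 2))"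
      using J dc Q by (intro sum_geometric_le) auto
    also have "\<dots> \<le> real Q powr (1 / 2) / (1 / 4)"
    proof (rule frac_le)
      have "2 powr - (1 / 2) = 1 / sqrt (2::real)" by (simp add: powr_minus powr_half_sqrt inverse_eq_divide)
      also have "\<dots> \<le> 3 / 4"
      proof -
        have "4 / 3 \<le> sqrt (2::real)" by (rule real_le_rsqrt) (simp add: power2_eq_square)
        then show ?thesis by (simp add: field_simps)
      qed
      finally show "1 / 4 \<le> 1 - 2 powr - (1 / 2 :: real)" by simp
      show "(d * real Q) powr (1 / 2) \<le> real Q powr (1 / 2)"
        using dc Q by (intro powr_mono2) (auto simp: mult_left_le_one_le)
    qed auto
    finally have "32 / d * real Q0 * real Q powr - 1 * (\<Sum>j\<in>J. (2 ^ j) powr (1 / 2))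
        \<le> 32 / d * real Q0 * real Q powr - 1 * (real Q powr (1 / 2) / (1 / 4))"
      using dc by (intro mult_left_mono) auto
    note order.trans[OF le this]
    also have "\<dots> = 128 / d * real Q0 * (real Q powr - 1 * real Q powr (1 / 2))" by simp
    also have "real Q powr - 1 * real Q powr (1 / 2) = real Q powr (- 1 + 1 / 2)" by (rule powr_add[symmetric])
    also have "- 1 + 1 / 2 = - (1 / 2 :: real)" by simp
    finally show ?thesis using large(3)[OF True] by linarith
  qed
  define G where "G = {..<M1} \<times> {..<M2} - (\<Union>j\<in>J. bad j)"
  have finb: "finite (bad j)" for j using badsub finite_subset by blast
  have "real (card (\<Union>j\<in>J. bad j)) \<le> real (\<Sum>j\<in>J. card (bad j))"
    using card_UN_le[OF J(1), of bad] by (simp only: of_nat_le_iff)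
  also have "\<dots> \<le> (\<Sum>j\<in>J. real M1 * real M2 * (8 * ((R1 j + g1) / (m1 j * g1) + (R2 j + g2) / (m2 j * g2))))"
    unfolding of_nat_sum by (rule sum_mono[OF cb])
  also have "\<dots> = real M1 * real M2 * (8 * ((\<Sum>j\<in>J. (R1 j + g1) / (m1 j * g1)) + (\<Sum>j\<in>J. (R2 j + g2) / (m2 j * g2))))"
    by (subst sum.distrib[symmetric]) (simp only: sum_distrib_left)
  also have "\<dots> \<le> real M1 * real M2 * (8 * (1 / 32 + 1 / 32))"
    by (intro mult_left_mono add_mono sum1 sum2) auto
  finally have cU: "real (card (\<Union>j\<in>J. bad j)) \<le> real M1 * real M2 / 2" by simp
  have "card G = M1 * M2 - card (\<Union>j\<in>J. bad j)"
    unfolding G_def using badsub by (subst card_Diff_subset) (auto intro: finite_subset[of _ "{..<M1} \<times> {..<M2}"])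
  then have "M1 * M2 \<le> card G + card (\<Union>j\<in>J. bad j)" by simp
  then have "real (M1 * M2) \<le> real (card G + card (\<Union>j\<in>J. bad j))" by (simp only: of_nat_le_iff)
  then have "real M1 * real M2 / 2 \<le> real (card G)" using cU by simp
  moreover have "\<forall>(k1, k2)\<in>G. \<forall>j. 2 ^ j \<le> d * real Q \<longrightarrow>
       \<not> (\<exists>(X, Y)\<in>obstacles (t2 = 0) (2 ^ j). \<bar>u1 + real k1 * g1 - X\<bar> \<le> R1 j \<and> \<bar>u2 + real k2 * g2 - Y\<bar> \<le> R2 j)"
    unfolding G_def bad_def J_def by blast
  moreover have "G \<subseteq> {..<M1} \<times> {..<M2}" by (auto simp: G_def)
  ultimately show ?thesis by blast
qed

end


section \<open>Rectangles of the next level\<close>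

lemma ex_dyadic:
  assumes "(q::nat) > 0"
  shows "\<exists>j. 2 ^ j \<le> q \<and> q < 2 * 2 ^ j"
  using ex_power_ivl1[of 2 q] assms by auto

lemma eventually_powr_small:
  fixes s A \<epsilon> :: real
  assumes "s > 0" "\<epsilon> > 0"
  shows "eventually (\<lambda>Q::nat. A * real Q powr - s \<le> \<epsilon>) sequentially"
proof -
  have "(\<lambda>Q::nat. A * real Q powr - s) \<longlonglongrightarrow> A * 0"
    using assms by (intro tendsto_intros tendsto_neg_powr filterlim_real_sequentially) auto
  then have "eventually (\<lambda>Q::nat. A * real Q powr - s < \<epsilon>) sequentially"
    using assms by (intro order_tendstoD(2)) auto
  then show ?thesis by (rule eventually_mono) simp
qed

context weights
begin

text \<open>The centre \<open>y\<close> of a rectangle of the next level: a rational point of large denominator, around which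
  no rational of denominator in \<open>[d Q0, d Q)\<close> is a good approximation.\<close>

definition child :: "real \<Rightarrow> real \<Rightarrow> nat \<Rightarrow> nat \<Rightarrow> real \<times> real \<Rightarrow> bool" where
  "child d c Q0 Q y \<longleftrightarrow>
    (\<exists>(q::nat) (p1::int) (p2::int). 0 < q \<and> d * real Q \<le> real q \<and> q \<le> Q \<and> fst y = p1 / q \<and> snd y = p2 / q) \<and>
    (\<forall>x1 x2 :: real. \<bar>x1 - fst y\<bar> \<le> real Q powr (- 1 - t1) / 2 \<longrightarrow> \<bar>x2 - snd y\<bar> \<le> real Q powr (- 1 - t2) / 2 \<longrightarrow>
      (\<forall>(q::nat) (p1::int) (p2::int). 0 < q \<longrightarrow> d * real Q0 \<le> real q \<longrightarrow> real q < d * real Q \<longrightarrow>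
         \<not> (\<bar>real q * x1 - real_of_int p1\<bar> < c * real q powr - t1 \<and> \<bar>real q * x2 - real_of_int p2\<bar> < c * real q powr - t2)))"

text \<open>The Dirichlet approximation p / q of the grid point lies within
  \<open>2 * Q powr - s / q\<close> of it. If q were below \<open>d * Q\<close>, p / q would be an
  obstacle inside the second part of \<open>R\<close>. If a point of the rectangle around p / q had
  a good approximation of denominator r in \<open>[d Q0, d Q)\<close>, that rational would be within
  the first part of \<open>R\<close> of the point, and the point within the second part of the grid
  point, again contradicting \<open>good\<close>.\<close>

lemma good_point:
  fixes d c x1 x2 g1 g2 :: real and Q0 Q :: nat and R1 R2 :: "nat \<Rightarrow> real"
  assumes dc: "0 < d" "d < 1" "0 < c"
    and Q: "0 < Q0" "0 < Q"
    and g: "g1 = 8 / d * real Q powr (- 1 - s1)" "g2 = 8 / d * real Q powr (- 1 - s2)"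
    and R1: "\<And>j. R1 j = (if d * real Q0 \<le> 2 * 2 ^ j then c * (2 ^ j) powr (- 1 - t1) else 0) + 3 * real Q powr - s1 / 2 ^ j"
    and R2: "\<And>j. R2 j = (if t2 = 0 then 0 else (if d * real Q0 \<le> 2 * 2 ^ j then c * (2 ^ j) powr (- 1 - t2) else 0) + 3 * real Q powr - s2 / 2 ^ j)"
    and good: "\<And>j X Y. 2 ^ j \<le> d * real Q \<Longrightarrow> (X, Y) \<in> obstacles (t2 = 0) (2 ^ j) \<Longrightarrow> \<bar>x1 - X\<bar> \<le> R1 j \<Longrightarrow> \<bar>x2 - Y\<bar> \<le> R2 j \<Longrightarrow> False"
  shows "\<exists>y. child d c Q0 Q y \<and> \<bar>x1 - fst y\<bar> \<le> g1 / 4 \<and> \<bar>x2 - snd y\<bar> \<le> g2 / 4"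
proof -
  obtain q p1 p2 where q: "1 \<le> q" "q \<le> Q" and p: "\<bar>real q * x1 - of_int p1\<bar> \<le> 2 * real Q powr - s1" "\<bar>real q * x2 - of_int p2\<bar> \<le> 2 * real Q powr - s2"
    using weighted_dirichlet[of Q s1 s2 x1 x2] Q s_sum s2_ge s1_ge by auto
  have p': "\<bar>x1 - p1 / q\<bar> \<le> 2 * real Q powr - s1 / q" "\<bar>x2 - p2 / q\<bar> \<le> 2 * real Q powr - s2 / q"
  proof -
    have *: "\<bar>x - p / q\<bar> = \<bar>q * x - p\<bar> / q" for x p :: real
    proof -
      have "x - p / q = (q * x - p) / q" using q by (simp add: field_simps)
      then show ?thesis by (simp add: abs_divide)
    qed
    show "\<bar>x1 - p1 / q\<bar> \<le> 2 * real Q powr - s1 / q" "\<bar>x2 - p2 / q\<bar> \<le> 2 * real Q powr - s2 / q"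
      unfolding * using p by (auto intro: divide_right_mono)
  qed
  have qd: "d * real Q \<le> real q"
  proof (rule ccontr)
    assume "\<not> d * real Q \<le> real q"
    obtain j where j: "2 ^ j \<le> q" "q < 2 * 2 ^ j" using ex_dyadic[of q] q by auto
    then have j': "(2::real) ^ j \<le> real q" using of_nat_mono[OF j(1), where 'a=real] by simp
    \<comment> \<open>For t2 = 0 an obstacle has a free ordinate; taking x2 itself makes the
      distance 0, which is the value of \<open>R2\<close>.\<close>
    have "(p1 / q, if t2 = 0 then x2 else p2 / q) \<in> obstacles (t2 = 0) (2 ^ j)"
      unfolding obstacles_def using j q by auto
    moreover have "\<bar>x1 - p1 / q\<bar> \<le> R1 j" 
    proof -
      have "2 * real Q powr - s1 / q \<le> 3 * real Q powr - s1 / 2 ^ j" using j' by (intro frac_le) auto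
      moreover have "0 \<le> (if d * real Q0 \<le> 2 * 2 ^ j then c * (2 ^ j) powr (- 1 - t1) else 0)" using dc by simp
      ultimately show ?thesis unfolding R1 using p'(1) by linarith
    qed
    moreover have "\<bar>x2 - (if t2 = 0 then x2 else p2 / q)\<bar> \<le> R2 j"
    proof (cases "t2 = 0")
      case False
      have "2 * real Q powr - s2 / q \<le> 3 * real Q powr - s2 / 2 ^ j" using j' by (intro frac_le) auto
      moreover have "0 \<le> (if d * real Q0 \<le> 2 * 2 ^ j then c * (2 ^ j) powr (- 1 - t2) else 0)" using dc by simp
      ultimately show ?thesis unfolding R2 using p'(2) False by simp
    qed (simp add: R2)
    moreover have "2 ^ j \<le> d * real Q" using j' \<open>\<not> d * real Q \<le> real q\<close> by linarith
    ultimately show False using good by blast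
  qed
  define y where "y = (p1 / q, p2 / q)"
  have quarter: "2 * real Q powr - s / q \<le> 8 / d * real Q powr (- 1 - s) / 4" for s
  proof -
    have "2 * real Q powr - s / q \<le> 2 * real Q powr - s / (d * Q)"
      using qd dc Q q by (intro divide_left_mono) auto
    also have "\<dots> = 8 / d * real Q powr (- 1 - s) / 4"
      using dc Q by (simp add: powr_diff powr_minus_divide powr_add)
    finally show ?thesis .
  qed
  have close: "\<bar>x1 - fst y\<bar> \<le> g1 / 4" "\<bar>x2 - snd y\<bar> \<le> g2 / 4"
    using p' quarter[of s1] quarter[of s2] by (auto simp: y_def g)
  have disp: "8 / d * real Q powr (- 1 - s) / 4 + real Q powr (- 1 - t) / 2 \<le> 3 * real Q powr - s / 2 ^ j"
    if "2 ^ j \<le> d * real Q" "s \<le> t" for s t and j :: nat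
  proof -
    have e: "real Q powr (- 1 - s) = real Q powr - s / Q" using Q by (simp add: powr_diff powr_minus_divide powr_add)
    have "real Q powr (- 1 - t) / 2 \<le> real Q powr (- 1 - s)"
    proof -
      have "real Q powr (- 1 - t) \<le> real Q powr (- 1 - s)" using that Q by (intro powr_mono) auto
      moreover have "0 \<le> real Q powr (- 1 - s)" by simp
      ultimately show ?thesis by linarith
    qed
    also have "\<dots> \<le> real Q powr (- 1 - s) / d" using dc by (simp add: pos_le_divide_eq mult_left_le)
    finally have "8 / d * real Q powr (- 1 - s) / 4 + real Q powr (- 1 - t) / 2 \<le> 3 * (real Q powr (- 1 - s) / d)"
      by simp
    also have "\<dots> = 3 * real Q powr - s / (d * Q)" unfolding e by simp
    also have "\<dots> \<le> 3 * real Q powr - s / 2 ^ j" using that dc Q by (intro divide_left_mono) auto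
    finally show ?thesis .
  qed
  have "child d c Q0 Q y"
    unfolding child_def
  proof (intro conjI allI impI notI)
    show "\<exists>(q::nat) (p1::int) (p2::int). 0 < q \<and> d * real Q \<le> real q \<and> q \<le> Q \<and> fst y = p1 / q \<and> snd y = p2 / q"
      by (rule exI[of _ q], rule exI[of _ p1], rule exI[of _ p2]) (use q qd in \<open>simp add: y_def\<close>)
    fix w1 w2 :: real and r :: nat and o1 o2 :: int
    assume w: "\<bar>w1 - fst y\<bar> \<le> real Q powr (- 1 - t1) / 2" "\<bar>w2 - snd y\<bar> \<le> real Q powr (- 1 - t2) / 2"
      and r: "0 < r" "d * real Q0 \<le> real r" "real r < d * real Q"
      and h: "\<bar>real r * w1 - of_int o1\<bar> < c * real r powr - t1 \<and> \<bar>real r * w2 - of_int o2\<bar> < c * real r powr - t2"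
    obtain j where j: "2 ^ j \<le> r" "r < 2 * 2 ^ j" using ex_dyadic[of r] r by auto
    have j': "(2::real) ^ j \<le> real r" "real r < 2 * 2 ^ j"
      using of_nat_mono[OF j(1), where 'a=real] j(2) by (simp, metis of_nat_less_iff of_nat_mult of_nat_numeral of_nat_power)
    have jd: "2 ^ j \<le> d * real Q" using j' r by linarith
    have near: "\<bar>w - p / r\<bar> \<le> c * (2 ^ j) powr (- 1 - t)" if a: "\<bar>real r * w - p\<bar> < c * real r powr - t" "t \<ge> 0" for w p t
    proof -
      have "w - p / r = (r * w - p) / r" using r by (simp add: field_simps)
      then have "\<bar>w - p / r\<bar> = \<bar>r * w - p\<bar> / r" by (simp add: abs_divide)
      also have "\<dots> \<le> c * real r powr - t / r" using a by (intro divide_right_mono) auto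
      also have "\<dots> = c * real r powr (- 1 - t)" using r by (simp add: powr_diff powr_minus_divide powr_add)
      also have "\<dots> \<le> c * (2 ^ j) powr (- 1 - t)"
        using a j' dc by (intro mult_left_mono powr_mono2') auto
      finally show ?thesis .
    qed
    have "(o1 / r, if t2 = 0 then x2 else o2 / r) \<in> obstacles (t2 = 0) (2 ^ j)"
      unfolding obstacles_def using j r by auto
    \<comment> \<open>The cutoff in \<open>R\<close> is stated with \<open>2 * 2 ^ j\<close> because
      r is known only up to the factor 2.\<close>
    moreover have \<chi>: "d * real Q0 \<le> 2 * 2 ^ j" using j' r by linarith
    have tri: "\<bar>x - z\<bar> \<le> A + B" if "\<bar>w - z\<bar> \<le> A" "\<bar>x - y\<bar> \<le> C" "\<bar>w - y\<bar> \<le> D" "C + D \<le> B"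
      for x y z w A B C D :: real using that by linarith
    have "\<bar>x1 - o1 / r\<bar> \<le> c * (2 ^ j) powr (- 1 - t1) + 3 * real Q powr - s1 / 2 ^ j"
      using near[of w1 o1 t1] h disp[OF jd, of s1 t1] close(1) w(1) s1_less s1_ge unfolding g by (intro tri) auto
    then have "\<bar>x1 - o1 / r\<bar> \<le> R1 j" using \<chi> by (simp add: R1)
    moreover have "\<bar>x2 - o2 / r\<bar> \<le> c * (2 ^ j) powr (- 1 - t2) + 3 * real Q powr - s2 / 2 ^ j"
      using near[of w2 o2 t2] h disp[OF jd, of s2 t2] close(2) w(2) t2_ge unfolding g by (intro tri) auto
    then have "\<bar>x2 - (if t2 = 0 then x2 else o2 / r)\<bar> \<le> R2 j" using \<chi> by (simp add: R2)
    ultimately show False using good jd by blast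
  qed
  then show ?thesis using close by blast
qed

lemma eventually_large:
  assumes "0 < d" "0 < Q0"
  shows "\<forall>\<^sub>F Q in sequentially. 0 < Q \<and>
    88 * real Q0 powr (1 + t1) * real Q powr - s1 \<le> 1 / 128 \<and>
    (t2 \<noteq> 0 \<longrightarrow> 88 * real Q0 powr (1 + t2) * real Q powr - s2 \<le> 1 / 128) \<and>
    (t2 = 0 \<longrightarrow> 128 / d * real Q0 * real Q powr - (1 / 2) \<le> 1 / 32) \<and>
    8 / d * real Q powr (- 1 - s1) \<le> real Q0 powr (- 1 - t1) / 2 \<and>
    8 / d * real Q powr (- 1 - s2) \<le> real Q0 powr (- 1 - t2) / 2 \<and>
    1 \<le> d ^ 2 / 2048 * real Q0 powr (- 2 - t1 - t2) * real Q ^ 3"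
proof -
  have e1: "- 1 - s1 = - (1 + s1)" "- 1 - s2 = - (1 + s2)" by auto
  have pos: "d ^ 2 / 2048 * real Q0 powr (- 2 - t1 - t2) > 0" using assms by simp
  have "\<forall>\<^sub>F Q in sequentially. 1 / (d ^ 2 / 2048 * real Q0 powr (- 2 - t1 - t2)) * real Q powr - 3 \<le> 1"
    by (rule eventually_powr_small) auto
  then have "\<forall>\<^sub>F Q in sequentially. 1 \<le> d ^ 2 / 2048 * real Q0 powr (- 2 - t1 - t2) * real Q ^ 3"
    using eventually_gt_at_top[of "0::nat"]
  proof eventually_elim
    case (elim Q)
    have "real Q powr - 3 = 1 / real Q ^ 3" using elim by (simp add: powr_minus_divide)
    then show ?case using elim pos by (simp add: pos_divide_le_eq)
  qed
  moreover have "\<forall>\<^sub>F Q in sequentially. t2 \<noteq> 0 \<longrightarrow> 88 * real Q0 powr (1 + t2) * real Q powr - s2 \<le> 1 / 128"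
    using eventually_powr_small[of s2 "1 / 128" "88 * real Q0 powr (1 + t2)"] s2_cases by (cases "t2 = 0") auto
  moreover have "\<forall>\<^sub>F Q in sequentially. 88 * real Q0 powr (1 + t1) * real Q powr - s1 \<le> 1 / 128"
    using s1_ge by (intro eventually_powr_small) auto
  moreover have "\<forall>\<^sub>F Q in sequentially. 128 / d * real Q0 * real Q powr - (1 / 2) \<le> 1 / 32"
    by (intro eventually_powr_small) auto
  moreover have "\<forall>\<^sub>F Q in sequentially. 8 / d * real Q powr (- 1 - s1) \<le> real Q0 powr (- 1 - t1) / 2"
    unfolding e1 using s1_ge assms by (intro eventually_powr_small) auto
  moreover have "\<forall>\<^sub>F Q in sequentially. 8 / d * real Q powr (- 1 - s2) \<le> real Q0 powr (- 1 - t2) / 2"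
    unfolding e1 using s2_ge assms by (intro eventually_powr_small) auto
  ultimately show ?thesis
    using eventually_gt_at_top[of "0::nat"] by eventually_elim auto
qed

text \<open>The gap \<open>4 * Q powr (- 1 - s)\<close> is at least four times the corresponding
  side \<open>Q powr (- 1 - t)\<close>, so it survives the passage from centres to rectangles.
  Unlike the mesh it is free of d.\<close>

definition children :: "real \<Rightarrow> real \<Rightarrow> nat \<Rightarrow> nat \<Rightarrow> real \<times> real \<Rightarrow> (real \<times> real) set \<Rightarrow> bool" where
  "children d c Q0 Q z S \<longleftrightarrow> finite S \<and>
    (\<forall>y\<in>S. child d c Q0 Q y \<and>
       \<bar>fst y - fst z\<bar> + real Q powr (- 1 - t1) / 2 \<le> real Q0 powr (- 1 - t1) / 2 \<and>
       \<bar>snd y - snd z\<bar> + real Q powr (- 1 - t2) / 2 \<le> real Q0 powr (- 1 - t2) / 2) \<and>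
    (\<forall>y\<in>S. \<forall>y'\<in>S. y \<noteq> y' \<longrightarrow>
       4 * real Q powr (- 1 - s1) \<le> \<bar>fst y - fst y'\<bar> \<or> 4 * real Q powr (- 1 - s2) \<le> \<bar>snd y - snd y'\<bar>)"

text \<open>The number n is the same for all z, which makes the mass uniform on each level; surplus
  surviving grid points are dropped. Every centre is within a quarter of the mesh of its grid point,
  so distinct centres stay half a mesh apart in some coordinate.\<close>

lemma ex_children:
  assumes dc: "0 < d" "d < 1" "0 < c" "admissible d c t1 s1" "t2 \<noteq> 0 \<Longrightarrow> admissible d c t2 s2"
    and Q0: "0 < Q0"
  shows "\<forall>\<^sub>F Q in sequentially. \<exists>n\<ge>1. d ^ 2 / 4096 * real Q0 powr (- 2 - t1 - t2) * real Q ^ 3 \<le> real n \<and>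
    (\<forall>z. \<exists>S. children d c Q0 Q z S \<and> card S = n)"
  using eventually_large[OF dc(1) Q0]
proof eventually_elim
  case (elim Q)
  then have Q: "0 < Q" by simp
  define a1 a2 g1 g2 where "a1 = real Q0 powr (- 1 - t1)" and "a2 = real Q0 powr (- 1 - t2)"
    and "g1 = 8 / d * real Q powr (- 1 - s1)" and "g2 = 8 / d * real Q powr (- 1 - s2)"
  note defs = this
  define M1 M2 where "M1 = nat \<lfloor>a1 / (2 * g1)\<rfloor>" and "M2 = nat \<lfloor>a2 / (2 * g2)\<rfloor>"
  define R1 R2 where "R1 j = (if d * real Q0 \<le> 2 * 2 ^ j then c * (2 ^ j) powr (- 1 - t1) else 0) + 3 * real Q powr - s1 / 2 ^ j"
    and "R2 j = (if t2 = 0 then 0 else (if d * real Q0 \<le> 2 * 2 ^ j then c * (2 ^ j) powr (- 1 - t2) else 0) + 3 * real Q powr - s2 / 2 ^ j)"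
    for j :: nat
  have g0: "g1 > 0" "g2 > 0" and a0: "a1 > 0" "a2 > 0" using dc Q Q0 by (auto simp: defs)
  have ga: "g1 \<le> a1 / 2" "g2 \<le> a2 / 2" using elim by (auto simp: defs)
  then have ge1: "1 \<le> a1 / (2 * g1)" "1 \<le> a2 / (2 * g2)" using g0 by (auto simp: field_simps)
  have Mg: "a1 / (4 * g1) \<le> real M1" "a2 / (4 * g2) \<le> real M2"
    using half_le_floor[OF ge1(1)] half_le_floor[OF ge1(2)] by (auto simp: M1_def M2_def)
  have Mle: "real M1 * g1 \<le> a1 / 2" "real M2 * g2 \<le> a2 / 2"
  proof -
    have "real M1 \<le> a1 / (2 * g1)" "real M2 \<le> a2 / (2 * g2)" using ge1 by (auto simp: M1_def M2_def)
    then show "real M1 * g1 \<le> a1 / 2" "real M2 * g2 \<le> a2 / 2" using g0 by (auto simp: field_simps)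
  qed
  \<comment> \<open>V equals \<open>a1 * a2 / (32 * (g1 * g2))\<close>, a lower bound for half the
    size of the grid; as \<open>g1 * g2 = 64 / (d ^ 2 * Q ^ 3)\<close>, the constant is 2048 = 32 *
    64. Rounding V down to n turns it into 4096.\<close>
  define V where "V = d ^ 2 / 2048 * real Q0 powr (- 2 - t1 - t2) * real Q ^ 3"
  have V1: "1 \<le> V" using elim by (simp add: V_def)
  define n where "n = nat \<lfloor>V\<rfloor>"
  have n: "n \<ge> 1" "real n \<le> V" "V / 2 \<le> real n"
    using V1 half_le_floor[OF V1] by (auto simp: n_def le_nat_floor)
  have VM: "V \<le> real M1 * real M2 / 2"
  proof -
    have "g1 * g2 = 64 / d ^ 2 * (real Q powr (- 1 - s1) * real Q powr (- 1 - s2))"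
      by (simp add: defs power2_eq_square)
    also have "real Q powr (- 1 - s1) * real Q powr (- 1 - s2) = real Q powr ((- 1 - s1) + (- 1 - s2))"
      by (rule powr_add[symmetric])
    also have "(- 1 - s1) + (- 1 - s2) = - 3" using s_sum by simp
    also have "real Q powr - 3 = 1 / real Q ^ 3" using Q by (simp add: powr_minus_divide)
    finally have gg: "g1 * g2 = 64 / (d ^ 2 * real Q ^ 3)" by simp
    have "a1 * a2 = real Q0 powr ((- 1 - t1) + (- 1 - t2))" unfolding defs by (rule powr_add[symmetric])
    also have "(- 1 - t1) + (- 1 - t2) = - 2 - t1 - t2" by simp
    finally have "V = a1 * a2 / (32 * (g1 * g2))"
      unfolding V_def gg using Q dc by (simp add: field_simps)
    also have "\<dots> = a1 / (4 * g1) * (a2 / (4 * g2)) / 2" by simp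
    also have "\<dots> \<le> real M1 * real M2 / 2"
      using Mg a0 g0 by (intro divide_right_mono mult_mono) auto
    finally show ?thesis .
  qed
  have "\<exists>S. children d c Q0 Q z S \<and> card S = n" for z
  proof -
    \<comment> \<open>The grid spans at most \<open>a / 2\<close> and starts at
      \<open>- a / 4\<close> relative to z. The remaining margin \<open>a / 4\<close> takes up the
      displacement \<open>g / 4 \<le> a / 8\<close> and half the side of the new rectangle.\<close>
    define u1 u2 where "u1 = fst z - a1 / 4" and "u2 = snd z - a2 / 4"
    have "\<exists>G\<subseteq>{..<M1} \<times> {..<M2}. real M1 * real M2 / 2 \<le> real (card G) \<and>
      (\<forall>(k1, k2)\<in>G. \<forall>j. 2 ^ j \<le> d * real Q \<longrightarrow>
       \<not> (\<exists>(X, Y)\<in>obstacles (t2 = 0) (2 ^ j). \<bar>u1 + real k1 * g1 - X\<bar> \<le> R1 j \<and> \<bar>u2 + real k2 * g2 - Y\<bar> \<le> R2 j))"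
      by (rule good_grid[OF dc Q0 Q a1_def a2_def g1_def g2_def M1_def M2_def ge1]) (use elim R1_def R2_def in auto)
    then obtain G where G: "G \<subseteq> {..<M1} \<times> {..<M2}" "real M1 * real M2 / 2 \<le> real (card G)"
      and good: "\<And>k1 k2 j X Y. (k1, k2) \<in> G \<Longrightarrow> 2 ^ j \<le> d * real Q \<Longrightarrow> (X, Y) \<in> obstacles (t2 = 0) (2 ^ j) \<Longrightarrow>
        \<bar>u1 + real k1 * g1 - X\<bar> \<le> R1 j \<Longrightarrow> \<bar>u2 + real k2 * g2 - Y\<bar> \<le> R2 j \<Longrightarrow> False"
      by blast
    have "\<exists>y. child d c Q0 Q y \<and> \<bar>(u1 + real (fst k) * g1) - fst y\<bar> \<le> g1 / 4 \<and> \<bar>(u2 + real (snd k) * g2) - snd y\<bar> \<le> g2 / 4"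
      if k: "k \<in> G" for k
      by (rule good_point[OF dc(1-3) Q0 Q g1_def g2_def R1_def R2_def]) (rule good[of "fst k" "snd k"], use k in auto)
    then obtain f where f: "\<And>k. k \<in> G \<Longrightarrow> child d c Q0 Q (f k) \<and> \<bar>(u1 + real (fst k) * g1) - fst (f k)\<bar> \<le> g1 / 4 \<and>
        \<bar>(u2 + real (snd k) * g2) - snd (f k)\<bar> \<le> g2 / 4" by metis
    have "real n \<le> real (card G)" using n VM G by linarith
    then obtain G' where G': "G' \<subseteq> G" "card G' = n" "finite G'"
      using obtain_subset_with_card_n[of n G] by auto
    have half: "4 * real Q powr (- 1 - s) \<le> 8 / d * real Q powr (- 1 - s) / 2" for s
      using dc mult_right_mono[of 1 "1 / d" "4 * real Q powr (- 1 - s)"] by simp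
    have sep1: "g / 2 \<le> \<bar>x - y\<bar>" if "(i::nat) \<noteq> k" "g > 0" "\<bar>(u + real i * g) - x\<bar> \<le> g / 4" "\<bar>(u + real k * g) - y\<bar> \<le> g / 4"
      for i k g u x y
    proof -
      have "1 \<le> \<bar>real i - real k\<bar>" using that(1) by linarith
      then have "1 * g \<le> \<bar>real i - real k\<bar> * g" using that(2) by (intro mult_right_mono) auto
      also have "\<bar>real i - real k\<bar> * g = \<bar>(u + real i * g) - (u + real k * g)\<bar>"
        using that(2) by (simp add: abs_mult flip: left_diff_distrib)
      finally show ?thesis using that(3,4) by linarith
    qed
    have sep: "4 * real Q powr (- 1 - s1) \<le> \<bar>fst (f k) - fst (f k')\<bar> \<or> 4 * real Q powr (- 1 - s2) \<le> \<bar>snd (f k) - snd (f k')\<bar>"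
      if "k \<in> G" "k' \<in> G" "k \<noteq> k'" for k k'
    proof -
      have "fst k \<noteq> fst k' \<or> snd k \<noteq> snd k'" using that(3) by (simp add: prod_eq_iff)
      then have "g1 / 2 \<le> \<bar>fst (f k) - fst (f k')\<bar> \<or> g2 / 2 \<le> \<bar>snd (f k) - snd (f k')\<bar>"
        using f[OF that(1)] f[OF that(2)] g0 sep1 by blast
      then show ?thesis using half[of s1] half[of s2] unfolding defs by linarith
    qed
    have Qp: "0 < real Q powr x" for x using Q by simp
    have inj: "inj_on f G'"
    proof (rule inj_onI, rule ccontr)
      fix k k' assume k: "k \<in> G'" "k' \<in> G'" "f k = f k'" "k \<noteq> k'"
      then have "4 * real Q powr (- 1 - s1) \<le> 0 \<or> 4 * real Q powr (- 1 - s2) \<le> 0"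
        using sep[of k k'] G'(1) by auto
      then show False using Qp[of "- 1 - s1"] Qp[of "- 1 - s2"] by linarith
    qed
    have inside1: "\<bar>y - z\<bar> + real Q powr (- 1 - t) / 2 \<le> a / 2"
      if "\<bar>(z - a / 4 + real i * g) - y\<bar> \<le> g / 4" "i < M" "real M * g \<le> a / 2" "g \<le> a / 2" "g > 0"
        "s \<le> t" "g = 8 / d * real Q powr (- 1 - s)" for y z a t s g and i M :: nat
    proof -
      have "real Q powr (- 1 - t) \<le> real Q powr (- 1 - s)" using that Q by (intro powr_mono) auto
      moreover have "4 * real Q powr (- 1 - s) \<le> g / 2" unfolding that(7) by (rule half)
      ultimately have "real Q powr (- 1 - t) \<le> g / 8" by linarith
      moreover have "0 \<le> real i * g" "real i * g \<le> real M * g" using that(2,5) by (auto intro: mult_right_mono)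
      ultimately show ?thesis using that(1,3,4) by linarith
    qed
    have ins: "\<bar>fst (f k) - fst z\<bar> + real Q powr (- 1 - t1) / 2 \<le> a1 / 2 \<and> \<bar>snd (f k) - snd z\<bar> + real Q powr (- 1 - t2) / 2 \<le> a2 / 2"
      if k: "k \<in> G" for k
    proof
      have "fst k < M1" "snd k < M2" using G(1) k by auto
      then show "\<bar>fst (f k) - fst z\<bar> + real Q powr (- 1 - t1) / 2 \<le> a1 / 2"
        "\<bar>snd (f k) - snd z\<bar> + real Q powr (- 1 - t2) / 2 \<le> a2 / 2"
        using f[OF k] inside1[OF _ _ Mle(1) ga(1) g0(1) less_imp_le[OF s1_less] g1_def, of "fst z" "fst k"]
          inside1[OF _ _ Mle(2) ga(2) g0(2) t2_ge(2) g2_def, of "snd z" "snd k"]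
        unfolding u1_def u2_def by blast+
    qed
    have "children d c Q0 Q z (f ` G')"
      unfolding children_def a1_def[symmetric] a2_def[symmetric]
    proof (intro conjI ballI impI)
      fix y assume "y \<in> f ` G'"
      then obtain k where k: "k \<in> G" "y = f k" using G'(1) by blast
      show "child d c Q0 Q y" "\<bar>fst y - fst z\<bar> + real Q powr (- 1 - t1) / 2 \<le> a1 / 2"
        "\<bar>snd y - snd z\<bar> + real Q powr (- 1 - t2) / 2 \<le> a2 / 2"
        using f[OF k(1)] ins[OF k(1)] k(2) by auto
      fix y' assume "y' \<in> f ` G'" "y \<noteq> y'"
      then obtain k' where "k' \<in> G" "y' = f k'" "k \<noteq> k'" using G'(1) k(2) by blast
      then show "4 * real Q powr (- 1 - s1) \<le> \<bar>fst y - fst y'\<bar> \<or> 4 * real Q powr (- 1 - s2) \<le> \<bar>snd y - snd y'\<bar>"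
        using sep[of k k'] k by blast
    qed (use G'(3) in auto)
    moreover have "card (f ` G') = n" using inj G' by (simp add: card_image)
    ultimately show ?thesis by blast
  qed
  then show ?case using n unfolding V_def by (intro exI[of _ n]) auto
qed

end


subsection \<open>A mass distribution principle for nested finite families of compact sets\<close>

text \<open>Continuity of the power at D. As the exponent is positive this includes D = 0, so
  covering sets reduced to a point can be enlarged as well.\<close>

lemma ex_enlargement:
  fixes D \<sigma> \<eta> e0 :: real
  assumes "0 \<le> D" "0 < \<sigma>" "0 < \<eta>" "0 < e0"
  shows "\<exists>e>0. e \<le> e0 \<and> (D + 2 * e) powr \<sigma> \<le> D powr \<sigma> + \<eta>"
proof -
  have "((\<lambda>e. (D + 2 * e) powr \<sigma>) \<longlongrightarrow> (D + 2 * 0) powr \<sigma>) (at_right 0)"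
    using assms by (intro tendsto_powr' tendsto_intros) (auto intro!: eventually_at_rightI[of 0 1])
  then have "\<forall>\<^sub>F e in at_right 0. (D + 2 * e) powr \<sigma> < D powr \<sigma> + \<eta>"
    using assms by (intro order_tendstoD(2)) auto
  moreover have "\<forall>\<^sub>F e in at_right 0. 0 < e \<and> e \<le> e0"
    using assms by (auto intro!: eventually_at_rightI[of 0 e0])
  ultimately have "\<forall>\<^sub>F e in at_right 0. 0 < e \<and> e \<le> e0 \<and> (D + 2 * e) powr \<sigma> \<le> D powr \<sigma> + \<eta>"
    by eventually_elim auto
  from eventually_happens'[OF _ this] show ?thesis by auto
qed

text \<open>The mass is uniform on each level, so only cardinalities occur. Open enlargements of the covering sets
  and compactness reduce the claim to a single level.\<close>

lemma mass_distribution: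
  fixes L :: "nat \<Rightarrow> 'i set" and C :: "nat \<Rightarrow> 'i \<Rightarrow> 'a::heine_borel set"
  assumes L: "\<And>k. finite (L k)" "\<And>k. L k \<noteq> {}"
    and C: "\<And>k z. z \<in> L k \<Longrightarrow> compact (C k z)" "\<And>k z. z \<in> L k \<Longrightarrow> C k z \<noteq> {}"
    and nest: "\<And>k. (\<Union>z\<in>L (Suc k). C (Suc k) z) \<subseteq> (\<Union>z\<in>L k. C k z)"
    and thin: "\<And>k V. card {z \<in> L (Suc k). C (Suc k) z \<inter> V \<noteq> {}} * card (L k)
      \<le> card {z \<in> L k. C k z \<inter> V \<noteq> {}} * card (L (Suc k))"
    and pos: "0 < K" "0 < r0" "0 < \<sigma>"
    and mass: "\<And>V r. 0 < r \<Longrightarrow> r < r0 \<Longrightarrow> (\<And>x y. x \<in> V \<Longrightarrow> y \<in> V \<Longrightarrow> dist x y \<le> r) \<Longrightarrow>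
      \<exists>j. real (card {z \<in> L j. C j z \<inter> V \<noteq> {}}) \<le> K * r powr \<sigma> * real (card (L j))"
    and s: "0 \<le> s" "s \<le> \<sigma>"
  shows "hausdorff_measure s (\<Inter>k. \<Union>z\<in>L k. C k z) \<noteq> 0"
proof -
  define E where "E k = (\<Union>z\<in>L k. C k z)" for k
  \<comment> \<open>Diameters at most 1 allow passing from the exponent \<open>\<sigma>\<close> to
    the smaller s; \<open>r0 / 2\<close> leaves room for the enlargement by at most
    \<open>2 * (r0 / 8)\<close>.\<close>
  define \<delta> where "\<delta> = min 1 (r0 / 2)"
  define hit where "hit k V = real (card {z \<in> L k. C k z \<inter> V \<noteq> {}}) / real (card (L k))" for k V
  have cL: "real (card (L k)) > 0" for k using L by (simp add: card_gt_0_iff)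
  have "hit (Suc k) V \<le> hit k V" for k V
  proof -
    have "real (card {z \<in> L (Suc k). C (Suc k) z \<inter> V \<noteq> {}}) * real (card (L k))
      \<le> real (card {z \<in> L k. C k z \<inter> V \<noteq> {}}) * real (card (L (Suc k)))"
      using of_nat_mono[OF thin[of k V], where 'a=real] by simp
    then show ?thesis using cL by (simp add: hit_def field_simps)
  qed
  then have hit_mono: "hit n V \<le> hit m V" if "m \<le> n" for m n V
    using lift_Suc_antimono_le[of "\<lambda>k. hit k V"] that by blast
  have E: "compact (E k)" "E k \<noteq> {}" for k
    using L C unfolding E_def by (auto intro!: compact_UN)
  have E_mono: "E n \<subseteq> E m" if "m \<le> n" for m n
    using lift_Suc_antimono_le[of E] nest that unfolding E_def by blast
  have cover: "ennreal (1 / (2 * K)) \<le> (\<Sum>i. diam_pow s (U i))"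
    if U: "(\<Inter>k. E k) \<subseteq> (\<Union>i. U i)" "\<And>i. bounded (U i)" "\<And>i. diameter (U i) \<le> \<delta>" for U :: "nat \<Rightarrow> 'a set"
  proof -
    \<comment> \<open>The enlargements cost at most \<open>K * \<eta> * 2 = 1 / 2\<close> in total,
      half of the mass.\<close>
    define \<eta> where "\<eta> = 1 / (4 * K)"
    have \<eta>: "\<eta> > 0" using pos by (simp add: \<eta>_def)
    have "\<forall>i. \<exists>e>0. e \<le> r0 / 8 \<and> (diameter (U i) + 2 * e) powr \<sigma> \<le> diameter (U i) powr \<sigma> + \<eta> * (1 / 2) ^ i"
      using pos \<eta> U(2) by (intro allI ex_enlargement diameter_ge_0) auto
    then obtain e where e: "\<And>i. e i > 0" "\<And>i. e i \<le> r0 / 8"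
      "\<And>i. (diameter (U i) + 2 * e i) powr \<sigma> \<le> diameter (U i) powr \<sigma> + \<eta> * (1 / 2) ^ i" by metis
    define V where "V i = (\<Union>u\<in>U i. ball u (e i))" for i
    define r where "r i = diameter (U i) + 2 * e i" for i
    have r: "0 < r i" "r i < r0" for i
    proof -
      show "0 < r i" using e(1)[of i] diameter_ge_0[OF U(2)[of i]] by (simp add: r_def)
      have "diameter (U i) \<le> r0 / 2" using U(3)[of i] by (simp add: \<delta>_def)
      then show "r i < r0" using e(2)[of i] pos by (simp add: r_def)
    qed
    have UV: "U i \<subseteq> V i" for i using e(1) by (force simp: V_def)
    have V: "open (V i)" for i by (auto simp: V_def)
    have dV: "dist x y \<le> r i" if xy: "x \<in> V i" "y \<in> V i" for x y i
    proof -
      obtain u v where uv: "u \<in> U i" "dist u x < e i" "v \<in> U i" "dist v y < e i"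
        using xy by (auto simp: V_def)
      have "dist u v \<le> diameter (U i)" by (rule diameter_bounded_bound[OF U(2) uv(1,3)])
      moreover have "dist x y \<le> dist u x + dist u v + dist v y"
        using dist_triangle[of x y u] dist_triangle[of u y v] by (simp add: dist_commute)
      ultimately show ?thesis using uv by (simp add: r_def)
    qed
    have "\<exists>j. E j \<subseteq> (\<Union>i. V i)"
    proof (rule ccontr)
      assume "\<nexists>j. E j \<subseteq> (\<Union>i. V i)"
      then have "E j - (\<Union>i. V i) \<noteq> {}" for j by auto
      moreover have "compact (E j - (\<Union>i. V i))" for j using E(1) V by (intro compact_diff open_UN) auto
      moreover have "E n - (\<Union>i. V i) \<subseteq> E m - (\<Union>i. V i)" if "m \<le> n" for m n using E_mono[OF that] by blast
      ultimately have "(\<Inter>j. E j - (\<Union>i. V i)) \<noteq> {}" by (intro compact_nest)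
      then obtain x where "x \<in> (\<Inter>j. E j - (\<Union>i. V i))" by (meson all_not_in_conv)
      then have x: "\<And>j. x \<in> E j" "\<And>i. x \<notin> V i" by auto
      have "x \<in> (\<Inter>k. E k)" using x(1) by simp
      then have "x \<in> (\<Union>i. U i)" by (rule subsetD[OF U(1)])
      then obtain i where "x \<in> U i" by blast
      then show False using x(2)[of i] UV[of i] by auto
    qed
    then obtain j where j: "E j \<subseteq> (\<Union>i. V i)" by (elim exE)
    obtain I where I: "finite I" "E j \<subseteq> (\<Union>i\<in>I. V i)"
      by (rule compactE_image[OF E(1)[of j] _ j]) (use V in auto)
    have "\<forall>i. \<exists>j. real (card {z \<in> L j. C j z \<inter> V i \<noteq> {}}) \<le> K * r i powr \<sigma> * real (card (L j))"
    proof
      fix i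
      show "\<exists>j. real (card {z \<in> L j. C j z \<inter> V i \<noteq> {}}) \<le> K * r i powr \<sigma> * real (card (L j))"
        by (rule mass[OF r]) (rule dV)
    qed
    then obtain l where l: "\<And>i. real (card {z \<in> L (l i). C (l i) z \<inter> V i \<noteq> {}}) \<le> K * r i powr \<sigma> * real (card (L (l i)))"
      by metis
    \<comment> \<open>The level at which the mass of \<open>V i\<close> is bounded varies with i.
      The proportion of cells met does not increase with the level, so all bounds hold at a common
      later one.\<close>
    define n where "n = Max (insert j (l ` I))"
    have n: "j \<le> n" "\<And>i. i \<in> I \<Longrightarrow> l i \<le> n" using I by (auto simp: n_def)
    have hit: "hit n (V i) \<le> K * r i powr \<sigma>" if "i \<in> I" for i
    proof -
      have "hit n (V i) \<le> hit (l i) (V i)" by (rule hit_mono[OF n(2)[OF that]])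
      also have "\<dots> \<le> K * r i powr \<sigma>" using l[of i] cL by (simp add: hit_def pos_divide_le_eq)
      finally show ?thesis .
    qed
    have "L n \<subseteq> (\<Union>i\<in>I. {z \<in> L n. C n z \<inter> V i \<noteq> {}})"
    proof
      fix z assume z: "z \<in> L n"
      then obtain x where x: "x \<in> C n z" using C(2) by blast
      then have "x \<in> E j" using z E_mono[OF n(1)] by (auto simp: E_def)
      then show "z \<in> (\<Union>i\<in>I. {z \<in> L n. C n z \<inter> V i \<noteq> {}})" using I(2) x z by blast
    qed
    then have "card (L n) \<le> card (\<Union>i\<in>I. {z \<in> L n. C n z \<inter> V i \<noteq> {}})"
      using I L by (intro card_mono) auto
    also have "\<dots> \<le> (\<Sum>i\<in>I. card {z \<in> L n. C n z \<inter> V i \<noteq> {}})" by (rule card_UN_le[OF I(1)])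
    finally have "real (card (L n)) \<le> (\<Sum>i\<in>I. real (card {z \<in> L n. C n z \<inter> V i \<noteq> {}}))"
      by (simp flip: of_nat_sum)
    also have "\<dots> = (\<Sum>i\<in>I. hit n (V i)) * real (card (L n))"
      using cL[of n] by (simp add: hit_def sum_distrib_right)
    finally have "1 \<le> (\<Sum>i\<in>I. hit n (V i))" using cL[of n] by simp
    also have "\<dots> \<le> (\<Sum>i\<in>I. K * (diameter (U i) powr \<sigma> + \<eta> * (1 / 2) ^ i))"
      using hit e(3) pos by (intro sum_mono order.trans[OF hit] mult_left_mono) (auto simp: r_def)
    also have "\<dots> = K * ((\<Sum>i\<in>I. diameter (U i) powr \<sigma>) + \<eta> * (\<Sum>i\<in>I. (1 / 2) ^ i))"
      by (simp add: sum_distrib_left sum.distrib distrib_left)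
    also have "\<dots> \<le> K * ((\<Sum>i\<in>I. diameter (U i) powr \<sigma>) + \<eta> * 2)"
    proof (intro mult_left_mono add_left_mono)
      have "(\<Sum>i\<in>I. (1 / 2) ^ i) \<le> (\<Sum>i. (1 / 2 :: real) ^ i)"
        using I by (intro sum_le_suminf summable_geometric) auto
      then show "(\<Sum>i\<in>I. (1 / 2) ^ i) \<le> (2::real)" by (simp add: suminf_geometric)
    qed (use pos \<eta> in auto)
    finally have "1 \<le> K * (\<Sum>i\<in>I. diameter (U i) powr \<sigma>) + 1 / 2"
      using pos by (simp add: \<eta>_def distrib_left)
    then have "1 / (2 * K) \<le> (\<Sum>i\<in>I. diameter (U i) powr \<sigma>)" using pos by (simp add: field_simps)
    then have "ennreal (1 / (2 * K)) \<le> ennreal (\<Sum>i\<in>I. diameter (U i) powr \<sigma>)" by (rule ennreal_leI)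
    also have "\<dots> = (\<Sum>i\<in>I. ennreal (diameter (U i) powr \<sigma>))" by (simp add: sum_ennreal)
    also have "\<dots> \<le> (\<Sum>i\<in>I. diam_pow s (U i))"
    proof (rule sum_mono)
      fix i
      have D: "0 \<le> diameter (U i)" "diameter (U i) \<le> 1"
        using diameter_ge_0[OF U(2)[of i]] U(3)[of i] by (auto simp: \<delta>_def)
      have "diameter (U i) powr \<sigma> \<le> diameter (U i) powr s" if "s \<noteq> 0"
        using D s by (cases "diameter (U i) = 0") (auto intro!: powr_mono')
      \<comment> \<open>For s = 0, where \<open>diam_pow\<close> of a nonempty set is 1.\<close>
      moreover have "diameter (U i) powr \<sigma> \<le> 1" using D pos by (simp add: powr_le1)
      ultimately show "ennreal (diameter (U i) powr \<sigma>) \<le> diam_pow s (U i)"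
        unfolding diam_pow_def by (auto intro: ennreal_leI)
    qed
    also have "\<dots> \<le> (\<Sum>i. diam_pow s (U i))" using I by (intro sum_le_suminf) auto
    finally show ?thesis .
  qed
  have "ennreal (1 / (2 * K)) \<le> hausdorff_premeasure s \<delta> (\<Inter>k. E k)"
    unfolding hausdorff_premeasure_def by (rule INF_greatest) (use cover in auto)
  also have "\<dots> \<le> hausdorff_measure s (\<Inter>k. E k)"
    unfolding hausdorff_measure_def using pos by (intro SUP_upper) (auto simp: \<delta>_def)
  finally have "ennreal (1 / (2 * K)) \<le> hausdorff_measure s (\<Inter>k. E k)" .
  moreover have "ennreal (1 / (2 * K)) > 0" using pos by simp
  ultimately show ?thesis unfolding E_def by (metis not_less)
qed


section \<open>The Frostman inequality and the choice of scales\<close>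

context weights
begin

text \<open>The first factors bound the number of rectangles of denominator about \<open>Q\<close> that a set of
  diameter \<open>r\<close> meets, the minimum bounds the fraction of each of them that it meets.\<close>

lemma mass_numeric:
  fixes \<sigma> \<epsilon> Q0 Q r A \<kappa> D :: real
  assumes \<sigma>: "0 < \<sigma>" "\<sigma> < 2" and \<epsilon>: "0 < \<epsilon>" "\<epsilon> \<le> 1"
    and c1: "(1 + t2) * \<sigma> \<le> 3 - \<epsilon>" and c2: "(1 + t2) * \<sigma> \<le> 2 + t2 + s2 - \<epsilon>"
    and c3: "(1 + t1) * \<sigma> \<le> 3 + t1 - t2 - \<epsilon>"
    and Q: "1 \<le> Q0" "1 \<le> Q" and r: "Q powr (- 1 - t1) \<le> r" "r \<le> Q0 powr (- 1 - t1)"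
    and A: "1 \<le> A" and \<kappa>: "0 < \<kappa>"
    and D: "Q powr (3 - \<epsilon>) \<le> D" "\<kappa> * Q0 powr (1 - t1 - t2 - \<epsilon>) * Q ^ 3 \<le> D"
  shows "(3 + r * Q powr (1 + s1)) * (3 + r * Q powr (1 + s2)) * min 1 (A * r * Q powr (1 + t2)) \<le> (15 * A + 1 / \<kappa>) * r powr \<sigma> * D"
proof -
  have t: "0 \<le> t1" "0 \<le> t2" using t2_ge t2_le by auto
  have Qp: "0 < Q" "0 < Q0" using Q by auto
  have r0: "0 < r" using r(1) Qp powr_gt_zero[of Q "- 1 - t1"] by linarith
  have r1: "r \<le> 1"
  proof -
    have "Q0 powr (- 1 - t1) \<le> Q0 powr 0" using Q t by (intro powr_mono) auto
    then show ?thesis using r Qp by simp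
  qed
  define m where "m = min 1 (r * Q powr (1 + t2))"
  have x0: "0 < r * Q powr (1 + t2)" using r0 Qp by simp
  have m0: "0 \<le> m" "m \<le> 1" using x0 by (auto simp: m_def)
  \<comment> \<open>Interpolation: min 1 x is at most \<open>x powr \<theta>\<close>. It is applied
    with \<open>\<theta> = \<sigma>\<close> in T1 and \<open>\<theta> = \<sigma> - 1\<close> in
    T2.\<close>
  have m\<theta>: "m \<le> r powr \<theta> * Q powr ((1 + t2) * \<theta>)" if "0 \<le> \<theta>" "\<theta> \<le> 1" for \<theta>
  proof -
    have "m \<le> (r * Q powr (1 + t2)) powr \<theta>"
    proof (cases "r * Q powr (1 + t2) \<le> 1")
      case True
      have "(r * Q powr (1 + t2)) powr 1 \<le> (r * Q powr (1 + t2)) powr \<theta>"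
        using True x0 that by (intro powr_mono') auto
      then show ?thesis using x0 by (simp add: m_def)
    next
      case False
      have "1 \<le> (r * Q powr (1 + t2)) powr \<theta>" using False that by (intro ge_one_powr_ge_zero) auto
      then show ?thesis by (simp add: m_def)
    qed
    also have "\<dots> = r powr \<theta> * Q powr ((1 + t2) * \<theta>)"
      using r0 Qp by (simp add: powr_mult powr_powr)
    finally show ?thesis .
  qed
  have rinv: "r powr (1 - \<sigma>) \<le> Q powr ((1 + t1) * (\<sigma> - 1))" if "1 \<le> \<sigma>"
  proof -
    have "r powr (1 - \<sigma>) \<le> (Q powr (- 1 - t1)) powr (1 - \<sigma>)"
      using r that Qp by (intro powr_mono2') auto
    also have "\<dots> = Q powr ((1 + t1) * (\<sigma> - 1))" by (simp add: powr_powr algebra_simps)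
    finally show ?thesis .
  qed
  have split: "r = r powr \<sigma> * r powr (1 - \<sigma>)" using r0 by (simp flip: powr_add)
  \<comment> \<open>T1, T2 and T3 treat the three terms of the expanded product, bounded by
    \<open>9 + 6 * (r * Q powr (1 + s1)) + r ^ 2 * Q ^ 3\<close>. The constraint c1 or c3 enters in
    T1 according as \<open>\<sigma> \<le> 1\<close> or not, c2 in T2 for
    \<open>\<sigma> > 1\<close>, and c3 in T3.\<close>
  have T1: "m \<le> r powr \<sigma> * Q powr (3 - \<epsilon>)"
  proof (cases "\<sigma> \<le> 1")
    case True
    have "m \<le> r powr \<sigma> * Q powr ((1 + t2) * \<sigma>)" using True \<sigma> by (intro m\<theta>) auto
    also have "\<dots> \<le> r powr \<sigma> * Q powr (3 - \<epsilon>)" using c1 Q by (intro mult_left_mono powr_mono) auto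
    finally show ?thesis .
  next
    case False
    have "m \<le> r * Q powr (1 + t2)" by (simp add: m_def)
    also have "\<dots> = r powr \<sigma> * (r powr (1 - \<sigma>) * Q powr (1 + t2))"
      by (subst split) (simp add: mult.assoc)
    also have "\<dots> \<le> r powr \<sigma> * (Q powr ((1 + t1) * (\<sigma> - 1)) * Q powr (1 + t2))"
      using rinv False by (intro mult_left_mono mult_right_mono) auto
    also have "\<dots> = r powr \<sigma> * Q powr ((1 + t1) * (\<sigma> - 1) + (1 + t2))" by (simp add: powr_add)
    also have "\<dots> \<le> r powr \<sigma> * Q powr (3 - \<epsilon>)"
    proof (intro mult_left_mono powr_mono)
      show "(1 + t1) * (\<sigma> - 1) + (1 + t2) \<le> 3 - \<epsilon>" using c3 by (simp add: algebra_simps)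
    qed (use Q in auto)
    finally show ?thesis .
  qed
  have T2: "r * Q powr (1 + s1) * m \<le> r powr \<sigma> * Q powr (3 - \<epsilon>)"
  proof (cases "\<sigma> \<le> 1")
    case True
    have "r powr (1 - \<sigma>) \<le> 1" using r0 r1 True by (intro powr_le1) auto
    then have "r powr \<sigma> * (r powr (1 - \<sigma>) * (Q powr (1 + s1) * m)) \<le> r powr \<sigma> * (1 * (Q powr (3 - \<epsilon>) * 1))"
      using m0 Q \<epsilon> s_sum s2_ge by (intro mult_left_mono mult_mono powr_mono) auto
    then show ?thesis by (subst split) (simp add: mult.assoc)
  next
    case False
    have "r * Q powr (1 + s1) * m \<le> r * Q powr (1 + s1) * (r powr (\<sigma> - 1) * Q powr ((1 + t2) * (\<sigma> - 1)))"
      using False \<sigma> r0 by (intro mult_left_mono m\<theta>) auto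
    also have "\<dots> = (r powr 1 * r powr (\<sigma> - 1)) * (Q powr (1 + s1) * Q powr ((1 + t2) * (\<sigma> - 1)))"
      using r0 by simp
    also have "\<dots> = r powr \<sigma> * Q powr (1 + s1 + (1 + t2) * (\<sigma> - 1))"
      unfolding powr_add[symmetric] by simp
    also have "\<dots> \<le> r powr \<sigma> * Q powr (3 - \<epsilon>)"
    proof (intro mult_left_mono powr_mono)
      show "1 + s1 + (1 + t2) * (\<sigma> - 1) \<le> 3 - \<epsilon>" using c2 s_sum by (simp add: algebra_simps)
    qed (use Q in auto)
    finally show ?thesis .
  qed
  have T3: "r ^ 2 * Q ^ 3 \<le> r powr \<sigma> * (D / \<kappa>)"
  proof -
    have "r ^ 2 = r powr \<sigma> * r powr (2 - \<sigma>)" using r0 by (simp flip: powr_add)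
    also have "\<dots> \<le> r powr \<sigma> * (Q0 powr (- 1 - t1)) powr (2 - \<sigma>)"
      using r r0 \<sigma> by (intro mult_left_mono powr_mono2) auto
    also have "(Q0 powr (- 1 - t1)) powr (2 - \<sigma>) = Q0 powr ((- 1 - t1) * (2 - \<sigma>))" by (simp add: powr_powr)
    also have "r powr \<sigma> * Q0 powr ((- 1 - t1) * (2 - \<sigma>)) \<le> r powr \<sigma> * Q0 powr (1 - t1 - t2 - \<epsilon>)"
    proof (intro mult_left_mono powr_mono)
      show "(- 1 - t1) * (2 - \<sigma>) \<le> 1 - t1 - t2 - \<epsilon>" using c3 by (simp add: algebra_simps)
    qed (use Q in auto)
    finally have "r ^ 2 * Q ^ 3 \<le> r powr \<sigma> * Q0 powr (1 - t1 - t2 - \<epsilon>) * Q ^ 3"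
      using Qp by (intro mult_right_mono) auto
    also have "\<dots> = r powr \<sigma> * (\<kappa> * Q0 powr (1 - t1 - t2 - \<epsilon>) * Q ^ 3 / \<kappa>)" using \<kappa> by simp
    also have "\<dots> \<le> r powr \<sigma> * (D / \<kappa>)" using D(2) \<kappa> by (intro mult_left_mono divide_right_mono) auto
    finally show ?thesis .
  qed
  define P where "P = (3 + r * Q powr (1 + s1)) * (3 + r * Q powr (1 + s2))"
  have P: "P \<le> 9 + 6 * (r * Q powr (1 + s1)) + r ^ 2 * Q ^ 3"
  proof -
    have "Q powr (1 + s2) \<le> Q powr (1 + s1)" using Q s2_le by (intro powr_mono) auto
    then have "r * Q powr (1 + s2) \<le> r * Q powr (1 + s1)" using r0 by simp
    moreover have "Q powr (1 + s1) * Q powr (1 + s2) = Q ^ 3"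
    proof -
      have "Q powr (1 + s1) * Q powr (1 + s2) = Q powr ((1 + s1) + (1 + s2))" by (rule powr_add[symmetric])
      also have "(1 + s1) + (1 + s2) = 3" using s_sum by simp
      finally show ?thesis using Qp by simp
    qed
    then have "(r * Q powr (1 + s1)) * (r * Q powr (1 + s2)) = r ^ 2 * Q ^ 3"
      by (simp add: power2_eq_square)
    moreover have "P = 9 + 3 * (r * Q powr (1 + s1)) + 3 * (r * Q powr (1 + s2)) + (r * Q powr (1 + s1)) * (r * Q powr (1 + s2))"
      by (simp add: P_def algebra_simps)
    ultimately show ?thesis by linarith
  qed
  define \<mu> where "\<mu> = min 1 (A * r * Q powr (1 + t2))"
  have \<mu>: "0 \<le> \<mu>" "\<mu> \<le> 1" "\<mu> \<le> A * m"
  proof -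
    show "0 \<le> \<mu>" "\<mu> \<le> 1" using A r0 by (auto simp: \<mu>_def)
    show "\<mu> \<le> A * m"
    proof (cases "r * Q powr (1 + t2) \<le> 1")
      case True
      then show ?thesis by (simp add: \<mu>_def m_def mult.assoc)
    next
      case False
      then show ?thesis using A by (simp add: \<mu>_def m_def)
    qed
  qed
  have rq0: "0 \<le> r * Q powr (1 + s1)" using r0 by simp
  have "P * \<mu> \<le> (9 + 6 * (r * Q powr (1 + s1)) + r ^ 2 * Q ^ 3) * \<mu>"
    using P \<mu> by (intro mult_right_mono) auto
  also have "\<dots> = 9 * \<mu> + 6 * (r * Q powr (1 + s1)) * \<mu> + r ^ 2 * Q ^ 3 * \<mu>" by (simp add: algebra_simps)
  also have "\<dots> \<le> 9 * (A * m) + 6 * (r * Q powr (1 + s1)) * (A * m) + r ^ 2 * Q ^ 3 * 1"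
    using \<mu> rq0 Qp by (intro add_mono mult_left_mono) auto
  also have "\<dots> = 9 * A * m + 6 * A * (r * Q powr (1 + s1) * m) + r ^ 2 * Q ^ 3" by simp
  also have "\<dots> \<le> 9 * A * (r powr \<sigma> * D) + 6 * A * (r powr \<sigma> * D) + r powr \<sigma> * (D / \<kappa>)"
  proof (intro add_mono mult_left_mono T3)
    have "r powr \<sigma> * Q powr (3 - \<epsilon>) \<le> r powr \<sigma> * D" using D(1) by (intro mult_left_mono) auto
    then show "m \<le> r powr \<sigma> * D" "r * Q powr (1 + s1) * m \<le> r powr \<sigma> * D" using T1 T2 by linarith+
  qed (use A in auto)
  also have "\<dots> = (15 * A + 1 / \<kappa>) * r powr \<sigma> * D" by (simp add: algebra_simps)
  finally show ?thesis unfolding P_def \<mu>_def .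
qed

text \<open>Besides supplying the children, this makes Q large in terms of Q0: denominators grow
  even after the factor d, n is at least \<open>Q powr (3 - \<epsilon>)\<close>, and the two
  inequalities with 3 absorb the boundary terms in \<open>card_hits_second\<close>.\<close>

definition next_scale :: "real \<Rightarrow> real \<Rightarrow> real \<Rightarrow> nat \<Rightarrow> nat \<Rightarrow> nat \<Rightarrow> bool" where
  "next_scale d c \<epsilon> Q0 Q n \<longleftrightarrow> real Q0 < d * real Q \<and>
    1 \<le> d ^ 2 / 4096 * real Q0 powr (- 2 - t1 - t2) * real Q powr \<epsilon> \<and>
    3 \<le> real Q0 powr (- 1 - t1) * real Q powr (1 + s1) \<and> 3 \<le> real Q0 powr (- 1 - t1) * real Q powr (1 + s2) \<and>
    1 \<le> n \<and> d ^ 2 / 4096 * real Q0 powr (- 2 - t1 - t2) * real Q ^ 3 \<le> real n \<and>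
    (\<forall>z. \<exists>S. children d c Q0 Q z S \<and> card S = n)"

lemma eventually_powr_large:
  fixes s A B :: real
  assumes "s > 0" "B > 0"
  shows "eventually (\<lambda>Q::nat. A \<le> B * real Q powr s) sequentially"
proof -
  have "\<forall>\<^sub>F Q::nat in sequentially. A / B * real Q powr - s \<le> 1"
    using assms by (intro eventually_powr_small) auto
  then show ?thesis
    using eventually_gt_at_top[of "0::nat"]
  proof eventually_elim
    case (elim Q)
    then have "0 < B * real Q powr s" using assms by simp
    then show ?case using elim(1) by (simp add: powr_minus_divide pos_divide_le_eq)
  qed
qed

lemma ex_next_scale:
  assumes dc: "0 < d" "d < 1" "0 < c" "admissible d c t1 s1" "t2 \<noteq> 0 \<Longrightarrow> admissible d c t2 s2"
    and Q0: "0 < Q0" and \<epsilon>: "0 < \<epsilon>"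
  shows "\<exists>Q n. next_scale d c \<epsilon> Q0 Q n"
proof -
  have "\<forall>\<^sub>F Q in sequentially. real Q0 + 1 \<le> d * real Q powr 1"
    using dc by (intro eventually_powr_large) auto
  moreover have "\<forall>\<^sub>F Q in sequentially. 1 \<le> d ^ 2 / 4096 * real Q0 powr (- 2 - t1 - t2) * real Q powr \<epsilon>"
    using dc Q0 \<epsilon> by (intro eventually_powr_large) auto
  moreover have "\<forall>\<^sub>F Q in sequentially. 3 \<le> real Q0 powr (- 1 - t1) * real Q powr (1 + s1)"
    using Q0 s1_ge by (intro eventually_powr_large) auto
  moreover have "\<forall>\<^sub>F Q in sequentially. 3 \<le> real Q0 powr (- 1 - t1) * real Q powr (1 + s2)"
    using Q0 s2_ge by (intro eventually_powr_large) auto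
  moreover have "\<forall>\<^sub>F Q in sequentially. \<exists>n\<ge>1. d ^ 2 / 4096 * real Q0 powr (- 2 - t1 - t2) * real Q ^ 3 \<le> real n \<and>
    (\<forall>z. \<exists>S. children d c Q0 Q z S \<and> card S = n)"
    by (rule ex_children[OF dc Q0])
  ultimately have "\<forall>\<^sub>F Q in sequentially. \<exists>n. next_scale d c \<epsilon> Q0 Q n"
  proof eventually_elim
    case (elim Q)
    then show ?case unfolding next_scale_def by auto
  qed
  from eventually_happens'[OF _ this] show ?thesis by auto
qed

end


subsection \<open>The Cantor set\<close>

text \<open>The root z0 may be any point: only denominators from \<open>d * Q 0\<close> on are
  controlled, and finitely many smaller ones do no harm to bad approximability.\<close>

locale cantor_tree = weights +
  fixes d c \<epsilon> :: real and Q n :: "nat \<Rightarrow> nat" and z0 :: "real \<times> real"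
  assumes dc: "0 < d" "d < 1" "0 < c" and Q_0: "0 < Q 0"
    and scales: "\<And>k. next_scale d c \<epsilon> (Q k) (Q (Suc k)) (n k)"
begin

definition ch :: "nat \<Rightarrow> real \<times> real \<Rightarrow> (real \<times> real) set" where
  "ch k z = (SOME S. children d c (Q k) (Q (Suc k)) z S \<and> card S = n k)"

primrec L :: "nat \<Rightarrow> (real \<times> real) set" where
  "L 0 = {z0}"
| "L (Suc k) = (\<Union>z\<in>L k. ch k z)"

definition cell :: "nat \<Rightarrow> real \<times> real \<Rightarrow> (real^2) set" where
  "cell k z = {x. \<bar>x $ 1 - fst z\<bar> \<le> real (Q k) powr (- 1 - t1) / 2 \<and> \<bar>x $ 2 - snd z\<bar> \<le> real (Q k) powr (- 1 - t2) / 2}"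

definition hits :: "nat \<Rightarrow> (real \<times> real) set \<Rightarrow> (real^2) set \<Rightarrow> (real \<times> real) set" where
  "hits k S V = {z \<in> S. cell k z \<inter> V \<noteq> {}}"

lemma ch: "children d c (Q k) (Q (Suc k)) z (ch k z)" "card (ch k z) = n k"
proof -
  have "\<exists>S. children d c (Q k) (Q (Suc k)) z S \<and> card S = n k"
    using scales[of k] unfolding next_scale_def by blast
  from someI_ex[OF this] show "children d c (Q k) (Q (Suc k)) z (ch k z)" "card (ch k z) = n k"
    unfolding ch_def by auto
qed

lemma n_pos: "1 \<le> n k"
  using scales[of k] by (simp add: next_scale_def)

lemma finite_ch: "finite (ch k z)"
  using ch(1)[of k z] by (simp add: children_def)

lemma Q_less: "Q k < Q (Suc k)"
proof -
  have "real (Q k) < d * real (Q (Suc k))" using scales[of k] by (simp add: next_scale_def)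
  also have "\<dots> \<le> real (Q (Suc k))" using dc by (simp add: mult_left_le_one_le)
  finally show ?thesis by simp
qed

lemma Q_strict_mono: "strict_mono Q"
  using Q_less by (simp add: strict_mono_Suc_iff)

lemma Q_mono: "j \<le> k \<Longrightarrow> Q j \<le> Q k"
  using Q_strict_mono by (simp add: strict_mono_less_eq)

lemma Q_pos: "0 < Q k"
  using Q_mono[of 0 k] Q_0 by simp

lemma Q_ge: "k \<le> Q k"
  using Q_strict_mono by (rule strict_mono_imp_increasing)

lemma Q_powr_mono: "j \<le> k \<Longrightarrow> real (Q k) powr (- 1 - t1) \<le> real (Q j) powr (- 1 - t1)"
  using Q_mono[of j k] Q_pos[of j] t2_ge t2_le by (intro powr_mono2') auto

lemma powr_le_weights:
  "real (Q k) powr (- 1 - t1) \<le> real (Q k) powr (- 1 - s1)"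
  "real (Q k) powr (- 1 - t2) \<le> real (Q k) powr (- 1 - s2)"
  "real (Q k) powr (- 1 - t1) \<le> real (Q k) powr (- 1 - s2)"
  "real (Q k) powr (- 1 - t1) \<le> real (Q k) powr (- 1 - t2)"
  using Q_pos[of k] s1_less t2_ge t2_le s2_le by (auto intro!: powr_mono)

lemma Qp: "0 < real (Q k) powr x"
  using Q_pos[of k] by simp

lemma cell_ne: "cell k z \<noteq> {}"
proof -
  have "vector [fst z, snd z] \<in> cell k z" by (simp add: cell_def)
  then show ?thesis by blast
qed

lemma compact_cell: "compact (cell k z)"
proof -
  define h1 h2 where "h1 = real (Q k) powr (- 1 - t1) / 2" and "h2 = real (Q k) powr (- 1 - t2) / 2"
  have "\<bar>a - b\<bar> \<le> h \<longleftrightarrow> b - h \<le> a \<and> a \<le> b + h" for a b h :: real by linarith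
  then have "cell k z = cbox (vector [fst z - h1, snd z - h2]) (vector [fst z + h1, snd z + h2])"
    unfolding cell_def h1_def[symmetric] h2_def[symmetric] by (auto simp: mem_box_cart forall_2)
  then show ?thesis by simp
qed

lemma cell_sub:
  assumes "y \<in> ch k z"
  shows "cell (Suc k) y \<subseteq> cell k z"
proof
  fix x assume x: "x \<in> cell (Suc k) y"
  have "\<bar>fst y - fst z\<bar> + real (Q (Suc k)) powr (- 1 - t1) / 2 \<le> real (Q k) powr (- 1 - t1) / 2"
    "\<bar>snd y - snd z\<bar> + real (Q (Suc k)) powr (- 1 - t2) / 2 \<le> real (Q k) powr (- 1 - t2) / 2"
    using ch(1)[of k z] assms by (auto simp: children_def)
  then show "x \<in> cell k z" using x unfolding cell_def mem_Collect_eq by linarith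
qed

lemma coord_le_dist: "\<bar>x $ i - y $ i\<bar> \<le> dist x y" for x y :: "real^2"
  using dist_vec_nth_le[of x i y] by (simp add: dist_real_def)

text \<open>Siblings differ by four sides or more in some coordinate, from which the two half-sides
  are subtracted; cells with different parents inherit the gap of the parents, which is at least as
  large. Hence a set no wider than the short side of a cell meets only one cell.\<close>

lemma cell_sep:
  assumes "y \<in> L k" "y' \<in> L k" "y \<noteq> y'" "x \<in> cell k y" "x' \<in> cell k y'"
  shows "real (Q k) powr (- 1 - t1) < dist x x'"
  using assms
proof (induction k arbitrary: y y')
  case 0
  then show ?case by simp
next
  case (Suc k)
  obtain z z' where z: "z \<in> L k" "y \<in> ch k z" "z' \<in> L k" "y' \<in> ch k z'" using Suc.prems by auto
  show ?case
  proof (cases "z = z'")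
    case False
    have "x \<in> cell k z" "x' \<in> cell k z'" using Suc.prems z cell_sub by blast+
    then have "real (Q k) powr (- 1 - t1) < dist x x'" using Suc.IH z False by blast
    then show ?thesis using Q_powr_mono[of k "Suc k"] by simp
  next
    case True
    let ?p = "\<lambda>t. real (Q (Suc k)) powr (- 1 - t)"
    have "4 * ?p s1 \<le> \<bar>fst y - fst y'\<bar> \<or> 4 * ?p s2 \<le> \<bar>snd y - snd y'\<bar>"
      using ch(1)[of k z] z True Suc.prems(3) unfolding children_def by blast
    moreover have "\<bar>x $ 1 - fst y\<bar> \<le> ?p t1 / 2" "\<bar>x $ 2 - snd y\<bar> \<le> ?p t2 / 2"
      "\<bar>x' $ 1 - fst y'\<bar> \<le> ?p t1 / 2" "\<bar>x' $ 2 - snd y'\<bar> \<le> ?p t2 / 2"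
      using Suc.prems by (auto simp: cell_def)
    moreover note powr_le_weights[of "Suc k"] coord_le_dist[of x 1 x'] coord_le_dist[of x 2 x'] Qp[of "Suc k" "- 1 - t1"]
    ultimately show ?thesis by linarith
  qed
qed

lemma cell_disjoint:
  assumes "y \<in> L k" "y' \<in> L k" "x \<in> cell k y" "x \<in> cell k y'"
  shows "y = y'"
proof (rule ccontr)
  assume "y \<noteq> y'"
  from cell_sep[OF assms(1,2) this assms(3,4)] show False using Qp[of k "- 1 - t1"] by simp
qed

lemma finite_L: "finite (L k)"
  by (induction k) (auto simp: finite_ch)

lemma card_L_Suc: "card (L (Suc k)) = n k * card (L k)"
proof -
  have "card (\<Union>z\<in>L k. ch k z) = (\<Sum>z\<in>L k. card (ch k z))"
  proof (rule card_UN_disjoint)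
    show "\<forall>z\<in>L k. \<forall>z'\<in>L k. z \<noteq> z' \<longrightarrow> ch k z \<inter> ch k z' = {}"
    proof (intro ballI impI, rule ccontr)
      fix z z' assume z: "z \<in> L k" "z' \<in> L k" "z \<noteq> z'" "ch k z \<inter> ch k z' \<noteq> {}"
      then obtain y where y: "y \<in> ch k z" "y \<in> ch k z'" by blast
      obtain x where "x \<in> cell (Suc k) y" using cell_ne by blast
      then have "x \<in> cell k z" "x \<in> cell k z'" using cell_sub y by blast+
      then show False using cell_disjoint z by blast
    qed
  qed (auto simp: finite_L finite_ch)
  then show ?thesis by (simp add: ch(2))
qed

lemma card_L_pos: "1 \<le> card (L k)"
proof (induction k)
  case (Suc k)
  then show ?case using n_pos[of k] unfolding card_L_Suc by (simp add: Suc_le_eq)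
qed simp

lemma L_ne: "L k \<noteq> {}"
  using card_L_pos[of k] by auto

lemma hits_Suc: "hits (Suc k) (L (Suc k)) V \<subseteq> (\<Union>z\<in>hits k (L k) V. hits (Suc k) (ch k z) V)"
proof
  fix y assume "y \<in> hits (Suc k) (L (Suc k)) V"
  then obtain z x where "z \<in> L k" "y \<in> ch k z" "x \<in> cell (Suc k) y" "x \<in> V" by (auto simp: hits_def)
  then show "y \<in> (\<Union>z\<in>hits k (L k) V. hits (Suc k) (ch k z) V)"
    using cell_sub[of y k z] by (intro UN_I[of z]) (auto simp: hits_def)
qed

lemma finite_hits: "finite S \<Longrightarrow> finite (hits k S V)"
  by (simp add: hits_def)

lemma card_hits_Suc:
  assumes "\<And>z. z \<in> hits k (L k) V \<Longrightarrow> real (card (hits (Suc k) (ch k z) V)) \<le> b"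
  shows "real (card (hits (Suc k) (L (Suc k)) V)) \<le> real (card (hits k (L k) V)) * b"
proof -
  have "card (hits (Suc k) (L (Suc k)) V) \<le> card (\<Union>z\<in>hits k (L k) V. hits (Suc k) (ch k z) V)"
    using finite_L finite_ch by (intro card_mono hits_Suc) (auto intro!: finite_hits)
  also have "\<dots> \<le> (\<Sum>z\<in>hits k (L k) V. card (hits (Suc k) (ch k z) V))"
    using finite_L by (intro card_UN_le finite_hits)
  finally have "real (card (hits (Suc k) (L (Suc k)) V)) \<le> (\<Sum>z\<in>hits k (L k) V. real (card (hits (Suc k) (ch k z) V)))"
    by (simp flip: of_nat_sum)
  also have "\<dots> \<le> real (card (hits k (L k) V)) * b"
    using sum_mono[of "hits k (L k) V" "\<lambda>z. real (card (hits (Suc k) (ch k z) V))" "\<lambda>_. b"] assms by simp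
  finally show ?thesis .
qed

lemma card_hits_ch_le: "card (hits (Suc k) (ch k z) V) \<le> n k"
  using card_mono[OF finite_ch, of "hits (Suc k) (ch k z) V" k z] by (auto simp: hits_def ch(2))

text \<open>A cell that meets V lies in a parent that meets V, and all parents have equally many
  children.\<close>

lemma thin: "card (hits (Suc k) (L (Suc k)) V) * card (L k) \<le> card (hits k (L k) V) * card (L (Suc k))"
proof -
  have "real (card (hits (Suc k) (L (Suc k)) V)) \<le> real (card (hits k (L k) V)) * real (n k)"
    by (rule card_hits_Suc) (simp add: card_hits_ch_le)
  then have "card (hits (Suc k) (L (Suc k)) V) \<le> card (hits k (L k) V) * n k"
    by (simp only: of_nat_le_iff flip: of_nat_mult)
  then show ?thesis unfolding card_L_Suc by (metis mult.assoc mult_le_mono1)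
qed

lemma hits_close:
  assumes V: "\<And>x y. x \<in> V \<Longrightarrow> y \<in> V \<Longrightarrow> dist x y \<le> r" and y: "y \<in> hits k S V" "y' \<in> hits k S V"
  shows "\<bar>fst y - fst y'\<bar> \<le> r + real (Q k) powr (- 1 - t1)" "\<bar>snd y - snd y'\<bar> \<le> r + real (Q k) powr (- 1 - t2)"
proof -
  obtain x x' where x: "x \<in> cell k y" "x \<in> V" "x' \<in> cell k y'" "x' \<in> V" using y by (auto simp: hits_def)
  then have "dist x x' \<le> r" using V by blast
  then have "\<bar>x $ 1 - x' $ 1\<bar> \<le> r" "\<bar>x $ 2 - x' $ 2\<bar> \<le> r"
    using coord_le_dist[of x 1 x'] coord_le_dist[of x 2 x'] by linarith+
  moreover have "\<bar>x $ 1 - fst y\<bar> \<le> real (Q k) powr (- 1 - t1) / 2" "\<bar>x $ 2 - snd y\<bar> \<le> real (Q k) powr (- 1 - t2) / 2"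
    "\<bar>x' $ 1 - fst y'\<bar> \<le> real (Q k) powr (- 1 - t1) / 2" "\<bar>x' $ 2 - snd y'\<bar> \<le> real (Q k) powr (- 1 - t2) / 2"
    using x by (auto simp: cell_def)
  ultimately show "\<bar>fst y - fst y'\<bar> \<le> r + real (Q k) powr (- 1 - t1)" "\<bar>snd y - snd y'\<bar> \<le> r + real (Q k) powr (- 1 - t2)"
    by linarith+
qed

lemma ch_sep:
  assumes "y \<in> ch k z" "y' \<in> ch k z" "y \<noteq> y'"
  shows "4 * real (Q (Suc k)) powr (- 1 - s1) \<le> \<bar>fst y - fst y'\<bar> \<or> 4 * real (Q (Suc k)) powr (- 1 - s2) \<le> \<bar>snd y - snd y'\<bar>"
  using ch(1)[of k z] assms unfolding children_def by blast

text \<open>The left side is one factor of \<open>separated_card\<close> for centres within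
  \<open>r + p'\<close> of a fixed one, with the gap of \<open>children\<close>.\<close>

lemma window:
  assumes "0 \<le> r" "p' \<le> real (Q k) powr (- 1 - s)" "0 \<le> p'"
  shows "2 * (r + p') / (4 * real (Q k) powr (- 1 - s)) + 2 \<le> 3 + r * real (Q k) powr (1 + s)"
proof -
  let ?p = "real (Q k) powr (- 1 - s)"
  have p: "0 < ?p" by (rule Qp)
  have "1 / ?p = real (Q k) powr (1 + s)" using powr_minus_divide[of "real (Q k)" "1 + s"] by (simp add: algebra_simps)
  then have rp: "r / ?p = r * real (Q k) powr (1 + s)" by (metis times_divide_eq_right mult.right_neutral)
  define a b where "a = r / ?p" and "b = p' / ?p"
  have eq: "2 * (r + p') / (4 * ?p) = (a + b) / 2" using p by (simp add: a_def b_def field_simps)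
  have "b \<le> 1" using assms p by (simp add: b_def)
  moreover have "0 \<le> a" using assms p by (simp add: a_def)
  ultimately have "(a + b) / 2 + 2 \<le> 3 + a" by (simp add: field_simps)
  then show ?thesis unfolding rp[symmetric] a_def[symmetric] eq .
qed

lemma card_hits_first:
  assumes V: "\<And>x y. x \<in> V \<Longrightarrow> y \<in> V \<Longrightarrow> dist x y \<le> r" and r: "0 < r"
  shows "real (card (hits (Suc k) (ch k z) V))
    \<le> (3 + r * real (Q (Suc k)) powr (1 + s1)) * (3 + r * real (Q (Suc k)) powr (1 + s2))" (is "?l \<le> ?r")
proof (cases "hits (Suc k) (ch k z) V = {}")
  case True
  then show ?thesis using r by (simp add: add_nonneg_nonneg)
next
  case False
  then obtain y0 where y0: "y0 \<in> hits (Suc k) (ch k z) V" by blast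
  let ?p = "\<lambda>t. real (Q (Suc k)) powr (- 1 - t)"
  have "?l \<le> (2 * (r + ?p t1) / (4 * ?p s1) + 2) * (2 * (r + ?p t2) / (4 * ?p s2) + 2)"
  proof (rule separated_card(2)[where X = fst and Y = snd and ?v1.0 = "fst y0 - (r + ?p t1)" and ?v2.0 = "snd y0 - (r + ?p t2)"])
    fix y assume "y \<in> hits (Suc k) (ch k z) V"
    from hits_close[OF V this y0]
    show "fst y0 - (r + ?p t1) \<le> fst y \<and> fst y \<le> fst y0 - (r + ?p t1) + 2 * (r + ?p t1) \<and>
      snd y0 - (r + ?p t2) \<le> snd y \<and> snd y \<le> snd y0 - (r + ?p t2) + 2 * (r + ?p t2)" by (simp add: abs_le_iff)
  next
    fix y y' assume "y \<in> hits (Suc k) (ch k z) V" "y' \<in> hits (Suc k) (ch k z) V" "y \<noteq> y'"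
    then show "4 * ?p s1 \<le> \<bar>fst y - fst y'\<bar> \<or> 4 * ?p s2 \<le> \<bar>snd y - snd y'\<bar>" by (intro ch_sep) (auto simp: hits_def)
  qed (use r Qp in \<open>auto simp: add_nonneg_nonneg\<close>)
  also have "\<dots> \<le> ?r"
    using r Qp[of "Suc k"] by (intro mult_mono window powr_le_weights) (auto intro!: add_nonneg_nonneg divide_nonneg_nonneg)
  finally show ?thesis .
qed

text \<open>V is at least as wide as the short side of the parent cell, so only the second
  coordinate restricts the children: they lie in a box of width \<open>Q k powr (- 1 - t1)\<close>
  and height about r. Counting them by separation and comparing with the lower bound for
  \<open>n k\<close> gives the proportion, with 8192 = 2 * 4096.\<close>

lemma card_hits_second:
  assumes V: "\<And>x y. x \<in> V \<Longrightarrow> y \<in> V \<Longrightarrow> dist x y \<le> r" and r: "real (Q k) powr (- 1 - t1) \<le> r"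
  shows "real (card (hits (Suc k) (ch k z) V)) \<le> real (n k) * min 1 (8192 / d ^ 2 * r * real (Q k) powr (1 + t2))"
proof (cases "hits (Suc k) (ch k z) V = {}")
  case True
  have "0 \<le> r" using r Qp[of k "- 1 - t1"] by linarith
  then show ?thesis using True by simp
next
  case False
  then obtain y0 where y0: "y0 \<in> hits (Suc k) (ch k z) V" by blast
  let ?p = "\<lambda>t. real (Q (Suc k)) powr (- 1 - t)"
  let ?P = "\<lambda>t. real (Q k) powr (- 1 - t)"
  have r0: "0 < r" using r Qp[of k "- 1 - t1"] by linarith
  have "real (card (hits (Suc k) (ch k z) V)) \<le> (?P t1 / (4 * ?p s1) + 2) * (2 * (r + ?p t2) / (4 * ?p s2) + 2)"
  proof (rule separated_card(2)[where X = fst and Y = snd and ?v1.0 = "fst z - ?P t1 / 2" and ?v2.0 = "snd y0 - (r + ?p t2)"])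
    fix y assume y: "y \<in> hits (Suc k) (ch k z) V"
    have "\<bar>fst y - fst z\<bar> + ?p t1 / 2 \<le> ?P t1 / 2"
      using ch(1)[of k z] y by (auto simp: hits_def children_def)
    then have "\<bar>fst y - fst z\<bar> \<le> ?P t1 / 2" using Qp[of "Suc k" "- 1 - t1"] by linarith
    moreover have "\<bar>snd y - snd y0\<bar> \<le> r + ?p t2" by (rule hits_close(2)[OF _ y y0]) (rule V)
    ultimately show "fst z - ?P t1 / 2 \<le> fst y \<and> fst y \<le> fst z - ?P t1 / 2 + ?P t1 \<and>
      snd y0 - (r + ?p t2) \<le> snd y \<and> snd y \<le> snd y0 - (r + ?p t2) + 2 * (r + ?p t2)"
      unfolding abs_le_iff distrib_left by (intro conjI) linarith+
  next
    fix y y' assume "y \<in> hits (Suc k) (ch k z) V" "y' \<in> hits (Suc k) (ch k z) V" "y \<noteq> y'"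
    then show "4 * ?p s1 \<le> \<bar>fst y - fst y'\<bar> \<or> 4 * ?p s2 \<le> \<bar>snd y - snd y'\<bar>" by (intro ch_sep) (auto simp: hits_def)
  qed (use r0 Qp in \<open>auto simp: add_nonneg_nonneg\<close>)
  also have "\<dots> \<le> (?P t1 * real (Q (Suc k)) powr (1 + s1)) * (2 * (r * real (Q (Suc k)) powr (1 + s2)))"
  proof (intro mult_mono)
    have X: "3 \<le> ?P t1 * real (Q (Suc k)) powr (1 + s1)" "3 \<le> ?P t1 * real (Q (Suc k)) powr (1 + s2)"
      using scales[of k] by (auto simp: next_scale_def)
    have "1 / ?p s1 = real (Q (Suc k)) powr (1 + s1)" using powr_minus_divide[of "real (Q (Suc k))" "1 + s1"] by (simp add: algebra_simps)
    then have "?P t1 / (4 * ?p s1) = ?P t1 * real (Q (Suc k)) powr (1 + s1) / 4"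
      by (metis divide_divide_eq_left mult.commute times_divide_eq_right mult.right_neutral)
    then show "?P t1 / (4 * ?p s1) + 2 \<le> ?P t1 * real (Q (Suc k)) powr (1 + s1)" using X(1) by linarith
    have "?P t1 * real (Q (Suc k)) powr (1 + s2) \<le> r * real (Q (Suc k)) powr (1 + s2)"
      using r by (intro mult_right_mono) auto
    then have "3 \<le> r * real (Q (Suc k)) powr (1 + s2)" using X(2) by linarith
    moreover have "2 * (r + ?p t2) / (4 * ?p s2) + 2 \<le> 3 + r * real (Q (Suc k)) powr (1 + s2)"
      using r0 by (intro window powr_le_weights) auto
    ultimately show "2 * (r + ?p t2) / (4 * ?p s2) + 2 \<le> 2 * (r * real (Q (Suc k)) powr (1 + s2))" by linarith
  qed (use r0 Qp in \<open>auto simp: add_nonneg_nonneg\<close>)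
  also have "\<dots> = 2 * r * ?P t1 * (real (Q (Suc k)) powr (1 + s1) * real (Q (Suc k)) powr (1 + s2))" by simp
  also have "real (Q (Suc k)) powr (1 + s1) * real (Q (Suc k)) powr (1 + s2) = real (Q (Suc k)) powr ((1 + s1) + (1 + s2))"
    by (rule powr_add[symmetric])
  also have "(1 + s1) + (1 + s2) = 3" using s_sum by simp
  also have "real (Q (Suc k)) powr 3 = real (Q (Suc k)) ^ 3" using Q_pos[of "Suc k"] by simp
  also have "?P t1 = real (Q k) powr (- 2 - t1 - t2) * real (Q k) powr (1 + t2)" by (simp flip: powr_add)
  also have "2 * r * (real (Q k) powr (- 2 - t1 - t2) * real (Q k) powr (1 + t2)) * real (Q (Suc k)) ^ 3
    = 8192 / d ^ 2 * r * real (Q k) powr (1 + t2) * (d ^ 2 / 4096 * real (Q k) powr (- 2 - t1 - t2) * real (Q (Suc k)) ^ 3)"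
    using dc by simp
  also have "\<dots> \<le> 8192 / d ^ 2 * r * real (Q k) powr (1 + t2) * real (n k)"
    using scales[of k] r0 by (intro mult_left_mono) (auto simp: next_scale_def)
  finally have "real (card (hits (Suc k) (ch k z) V)) \<le> real (n k) * (8192 / d ^ 2 * r * real (Q k) powr (1 + t2))"
    by (simp add: mult.commute)
  then show ?thesis using card_hits_ch_le[of k z V] by (simp add: min_def)
qed

end


context cantor_tree
begin

definition limit_set :: "(real^2) set" where
  "limit_set = (\<Inter>k. \<Union>z\<in>L k. cell k z)"

lemma card_hits_le_one:
  assumes V: "\<And>x y. x \<in> V \<Longrightarrow> y \<in> V \<Longrightarrow> dist x y \<le> r" and r: "r \<le> real (Q k) powr (- 1 - t1)"
  shows "card (hits k (L k) V) \<le> 1"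
proof -
  have "y = y'" if yy: "y \<in> hits k (L k) V" "y' \<in> hits k (L k) V" for y y'
  proof (rule ccontr)
    assume "y \<noteq> y'"
    obtain x x' where x: "x \<in> cell k y" "x \<in> V" "x' \<in> cell k y'" "x' \<in> V" using yy by (auto simp: hits_def)
    then have "real (Q k) powr (- 1 - t1) < dist x x'"
      using yy \<open>y \<noteq> y'\<close> by (intro cell_sep) (auto simp: hits_def)
    then show False using V[OF x(2,4)] r by linarith
  qed
  then have "hits k (L k) V = {} \<or> (\<exists>y. hits k (L k) V = {y})" by blast
  then show ?thesis by auto
qed

text \<open>For \<open>Q\<^sub>k\<^sub>+\<^sub>1 powr (- 1 - t1) \<le> r < Q\<^sub>k powr (- 1 - t1)\<close> a set of diameter \<open>r\<close> meets one cell of level \<open>k\<close>;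
  its mass is estimated on level \<open>k + 2\<close>.\<close>

lemma tree_mass:
  fixes \<sigma> :: real
  assumes \<sigma>: "0 < \<sigma>" "\<sigma> < 2" and \<epsilon>: "0 < \<epsilon>" "\<epsilon> \<le> 1"
    and c1: "(1 + t2) * \<sigma> \<le> 3 - \<epsilon>" and c2: "(1 + t2) * \<sigma> \<le> 2 + t2 + s2 - \<epsilon>"
    and c3: "(1 + t1) * \<sigma> \<le> 3 + t1 - t2 - \<epsilon>"
    and r: "0 < r" "r < real (Q 1) powr (- 1 - t1)"
    and V: "\<And>x y. x \<in> V \<Longrightarrow> y \<in> V \<Longrightarrow> dist x y \<le> r"
  shows "\<exists>j. real (card (hits j (L j) V)) \<le> (15 * (8192 / d ^ 2) + 1 / (d ^ 2 / 4096)) * r powr \<sigma> * real (card (L j))"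
proof -
  define K where "K = 15 * (8192 / d ^ 2) + 1 / (d ^ 2 / 4096)"
  define P where "P m \<longleftrightarrow> real (Q m) powr (- 1 - t1) \<le> r" for m
  have "\<exists>m. P m"
  proof -
    have "- 1 - t1 = - (1 + t1)" by simp
    then have "\<forall>\<^sub>F m::nat in sequentially. 1 * real m powr (- 1 - t1) \<le> r"
      using t2_ge t2_le r by (simp only:) (intro eventually_powr_small, auto)
    then obtain m where m: "\<And>k. m \<le> k \<Longrightarrow> real k powr (- 1 - t1) \<le> r"
      unfolding eventually_sequentially by auto
    have "m \<le> Q m" by (rule Q_ge)
    then have "P m" unfolding P_def using m by blast
    then show ?thesis ..
  qed
  define m where "m = (LEAST m. P m)"
  have Pm: "P m" unfolding m_def using \<open>\<exists>m. P m\<close> by (rule LeastI_ex)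
  \<comment> \<open>This leaves a level k below \<open>?k\<close>, and \<open>n k\<close> bounds
    \<open>card (L ?k)\<close> from below in D2.\<close>
  have m2: "2 \<le> m"
  proof (rule ccontr)
    assume "\<not> 2 \<le> m"
    then have "real (Q 1) powr (- 1 - t1) \<le> real (Q m) powr (- 1 - t1)" by (intro Q_powr_mono) auto
    then show False using Pm r by (simp add: P_def)
  qed
  then obtain k where k: "m = Suc (Suc k)" by (metis add_2_eq_Suc le_Suc_ex)
  let ?k = "Suc k"
  have rk: "r \<le> real (Q ?k) powr (- 1 - t1)"
  proof -
    have "\<not> P ?k" using not_less_Least[of ?k P] k unfolding m_def by auto
    then show ?thesis by (simp add: P_def)
  qed
  have rk1: "real (Q (Suc ?k)) powr (- 1 - t1) \<le> r" using Pm k by (simp add: P_def)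
  define b1 b2 where "b1 = (3 + r * real (Q (Suc ?k)) powr (1 + s1)) * (3 + r * real (Q (Suc ?k)) powr (1 + s2))"
    and "b2 = min 1 (8192 / d ^ 2 * r * real (Q (Suc ?k)) powr (1 + t2))"
  have b0: "0 \<le> b1" "0 \<le> b2" using r by (auto simp: b1_def b2_def intro!: mult_nonneg_nonneg add_nonneg_nonneg)
  have h1: "real (card (hits (Suc ?k) (L (Suc ?k)) V)) \<le> b1"
  proof -
    have "real (card (hits (Suc ?k) (L (Suc ?k)) V)) \<le> real (card (hits ?k (L ?k) V)) * b1"
      unfolding b1_def by (intro card_hits_Suc card_hits_first V r)
    also have "\<dots> \<le> 1 * b1" using card_hits_le_one[OF V rk] b0 by (intro mult_right_mono) auto
    finally show ?thesis by simp
  qed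
  have h2: "real (card (hits (Suc (Suc ?k)) (L (Suc (Suc ?k))) V)) \<le> b1 * (real (n (Suc ?k)) * b2)"
  proof -
    have "real (card (hits (Suc (Suc ?k)) (L (Suc (Suc ?k))) V)) \<le> real (card (hits (Suc ?k) (L (Suc ?k)) V)) * (real (n (Suc ?k)) * b2)"
      unfolding b2_def by (intro card_hits_Suc card_hits_second V rk1)
    also have "\<dots> \<le> b1 * (real (n (Suc ?k)) * b2)" using h1 b0 by (intro mult_right_mono) auto
    finally show ?thesis .
  qed
  have npow: "real (Q (Suc j)) powr (3 - \<epsilon>) \<le> real (n j)" for j
  proof -
    let ?q = "real (Q (Suc j))" and ?w = "d ^ 2 / 4096 * real (Q j) powr (- 2 - t1 - t2)"
    have "?q powr (3 - \<epsilon>) * 1 \<le> ?q powr (3 - \<epsilon>) * (?w * ?q powr \<epsilon>)"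
      using scales[of j] by (intro mult_left_mono) (auto simp: next_scale_def)
    also have "\<dots> = ?w * (?q powr (3 - \<epsilon>) * ?q powr \<epsilon>)" by simp
    also have "?q powr (3 - \<epsilon>) * ?q powr \<epsilon> = ?q powr ((3 - \<epsilon>) + \<epsilon>)" by (rule powr_add[symmetric])
    also have "\<dots> = ?q ^ 3" using Q_pos[of "Suc j"] by simp
    also have "?w * ?q ^ 3 \<le> real (n j)" using scales[of j] by (simp add: next_scale_def)
    finally show ?thesis by simp
  qed
  define D where "D = real (n ?k) * real (card (L ?k))"
  have D1: "real (Q (Suc ?k)) powr (3 - \<epsilon>) \<le> D"
  proof -
    have "real (Q (Suc ?k)) powr (3 - \<epsilon>) * 1 \<le> real (n ?k) * real (card (L ?k))"
      using card_L_pos[of ?k] npow[of ?k] by (intro mult_mono) auto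
    then show ?thesis by (simp add: D_def)
  qed
  have D2: "d ^ 2 / 4096 * real (Q ?k) powr (1 - t1 - t2 - \<epsilon>) * real (Q (Suc ?k)) ^ 3 \<le> D"
  proof -
    have "real (Q ?k) powr (3 - \<epsilon>) \<le> real (card (L ?k))"
    proof -
      have "real (n k) * 1 \<le> real (n k) * real (card (L k))" using card_L_pos[of k] by (intro mult_left_mono) auto
      then have "real (n k) \<le> real (card (L ?k))" unfolding card_L_Suc by simp
      then show ?thesis using npow[of k] by linarith
    qed
    moreover have "d ^ 2 / 4096 * real (Q ?k) powr (- 2 - t1 - t2) * real (Q (Suc ?k)) ^ 3 \<le> real (n ?k)"
      using scales[of ?k] by (simp add: next_scale_def)
    ultimately have "d ^ 2 / 4096 * real (Q ?k) powr (- 2 - t1 - t2) * real (Q (Suc ?k)) ^ 3 * real (Q ?k) powr (3 - \<epsilon>) \<le> D"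
      unfolding D_def by (intro mult_mono) auto
    moreover have "real (Q ?k) powr (- 2 - t1 - t2) * real (Q ?k) powr (3 - \<epsilon>) = real (Q ?k) powr ((- 2 - t1 - t2) + (3 - \<epsilon>))"
      by (rule powr_add[symmetric])
    moreover have "(- 2 - t1 - t2) + (3 - \<epsilon>) = 1 - t1 - t2 - \<epsilon>" by simp
    ultimately show ?thesis by (simp add: mult.commute mult.left_commute)
  qed
  have "d ^ 2 \<le> 1" using dc by (intro power_le_one) auto
  then have "1 \<le> 8192 / d ^ 2" using dc by (simp add: pos_le_divide_eq)
  then have "b1 * b2 \<le> K * r powr \<sigma> * D"
    unfolding b1_def b2_def K_def
    using Q_pos[of ?k] Q_pos[of "Suc ?k"] dc rk rk1
    by (intro mass_numeric[OF \<sigma> \<epsilon> c1 c2 c3 _ _ _ _ _ _ D1 D2]) auto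
  then have "b1 * b2 * real (n (Suc ?k)) \<le> K * r powr \<sigma> * D * real (n (Suc ?k))" by (rule mult_right_mono) simp
  then have "real (card (hits (Suc (Suc ?k)) (L (Suc (Suc ?k))) V)) \<le> K * r powr \<sigma> * (real (n (Suc ?k)) * D)"
    using h2 by (simp add: mult.commute mult.left_commute)
  also have "real (n (Suc ?k)) * D = real (card (L (Suc (Suc ?k))))" unfolding D_def card_L_Suc by simp
  finally show ?thesis unfolding K_def by blast
qed

lemma hausdorff_measure_limit_set:
  fixes \<sigma> s :: real
  assumes "0 < \<sigma>" "\<sigma> < 2" "0 < \<epsilon>" "\<epsilon> \<le> 1"
    and "(1 + t2) * \<sigma> \<le> 3 - \<epsilon>" "(1 + t2) * \<sigma> \<le> 2 + t2 + s2 - \<epsilon>" "(1 + t1) * \<sigma> \<le> 3 + t1 - t2 - \<epsilon>"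
    and s: "0 \<le> s" "s \<le> \<sigma>"
  shows "hausdorff_measure s limit_set \<noteq> 0"
  unfolding limit_set_def
proof (rule mass_distribution[OF finite_L L_ne compact_cell cell_ne])
  show "(\<Union>z\<in>L (Suc k). cell (Suc k) z) \<subseteq> (\<Union>z\<in>L k. cell k z)" for k
    using cell_sub by fastforce
  show "card {z \<in> L (Suc k). cell (Suc k) z \<inter> V \<noteq> {}} * card (L k) \<le> card {z \<in> L k. cell k z \<inter> V \<noteq> {}} * card (L (Suc k))" for k V
    using thin[of k V] unfolding hits_def .
  show "0 < 15 * (8192 / d ^ 2) + 1 / (d ^ 2 / 4096)" using dc by (simp add: add_pos_pos)
  show "0 < real (Q 1) powr (- 1 - t1)" by (rule Qp)
  fix V :: "(real^2) set" and r
  assume "0 < r" "r < real (Q 1) powr (- 1 - t1)" "\<And>x y. x \<in> V \<Longrightarrow> y \<in> V \<Longrightarrow> dist x y \<le> r"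
  then show "\<exists>j. real (card {z \<in> L j. cell j z \<inter> V \<noteq> {}}) \<le> (15 * (8192 / d ^ 2) + 1 / (d ^ 2 / 4096)) * r powr \<sigma> * real (card (L j))"
    unfolding hits_def[symmetric] using assms by (intro tree_mass) auto
qed (use assms in auto)

lemma limit_set_sub: "limit_set \<subseteq> cell 0 z0"
  unfolding limit_set_def by (rule INF_lower2[of 0]) auto

lemma limit_setE:
  assumes "x \<in> limit_set"
  obtains z y where "y \<in> ch k z" "x \<in> cell (Suc k) y"
proof -
  have "x \<in> (\<Union>z\<in>L (Suc k). cell (Suc k) z)" using assms unfolding limit_set_def by blast
  then show ?thesis using that by auto
qed

text \<open>The centre of the cell containing x is a rational point whose denominator q is at most
  \<open>Q (Suc k)\<close>, so the half-sides of the cell are below \<open>q powr (- 1 - t)\<close>;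
  and q exceeds \<open>Q k\<close>, hence k.\<close>

lemma limit_set_approx:
  assumes "x \<in> limit_set"
  shows "\<exists>(q::nat) (p1::int) (p2::int). k < q \<and> \<bar>real q * x $ 1 - real_of_int p1\<bar> < real q powr - t1 \<and> \<bar>real q * x $ 2 - real_of_int p2\<bar> < real q powr - t2"
proof -
  obtain z y where y: "y \<in> ch k z" "x \<in> cell (Suc k) y" using limit_setE[OF assms] by metis
  have "child d c (Q k) (Q (Suc k)) y" using ch(1)[of k z] y by (auto simp: children_def)
  then obtain q :: nat and p1 p2 :: int where q: "0 < q" "d * real (Q (Suc k)) \<le> real q" "q \<le> Q (Suc k)"
    and p: "fst y = p1 / q" "snd y = p2 / q" by (auto simp: child_def)
  have "real (Q k) < real q" using scales[of k] q by (simp add: next_scale_def)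
  then have "k < q" using Q_ge[of k] by simp
  moreover have "\<bar>real q * a - p\<bar> < real q powr - t"
    if a: "\<bar>a - p / q\<bar> \<le> real (Q (Suc k)) powr (- 1 - t) / 2" "0 \<le> t" for a p t
  proof -
    have "real q * a - p = real q * (a - p / q)" using q by (simp add: field_simps)
    then have "\<bar>real q * a - p\<bar> = real q * \<bar>a - p / q\<bar>" by (simp add: abs_mult)
    also have "\<dots> \<le> real q * (real q powr (- 1 - t) / 2)"
    proof (intro mult_left_mono)
      have "real (Q (Suc k)) powr (- 1 - t) \<le> real q powr (- 1 - t)" using q a by (intro powr_mono2') auto
      then show "\<bar>a - p / q\<bar> \<le> real q powr (- 1 - t) / 2" using a by linarith
    qed simp
    also have "\<dots> = real q powr - t / 2" using q by (simp add: powr_diff powr_minus_divide powr_add)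
    also have "\<dots> < real q powr - t" using q by simp
    finally show ?thesis .
  qed
  then have "\<bar>real q * x $ 1 - real_of_int p1\<bar> < real q powr - t1" "\<bar>real q * x $ 2 - real_of_int p2\<bar> < real q powr - t2"
    using y(2) p t2_ge t2_le by (auto simp: cell_def)
  ultimately show ?thesis by blast
qed

text \<open>The ranges from \<open>d * Q k\<close> to \<open>d * Q (Suc k)\<close> exhaust all
  denominators from \<open>d * Q 0\<close> on, and \<open>child\<close> excludes each range for the
  cells of level \<open>Suc k\<close>.\<close>

lemma limit_set_avoids:
  fixes q :: nat and p1 p2 :: int
  assumes "x \<in> limit_set" "\<bar>real q * x $ 1 - real_of_int p1\<bar> < c * real q powr - t1" "\<bar>real q * x $ 2 - real_of_int p2\<bar> < c * real q powr - t2" "0 < q"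
  shows "real q < d * real (Q 0)"
proof (rule ccontr)
  assume q0: "\<not> real q < d * real (Q 0)"
  have "\<exists>k. real q < d * real (Q k)"
  proof -
    have "real q \<le> real (Q q)" using Q_ge[of q] by simp
    also have "\<dots> < d * real (Q (Suc q))" using scales[of q] by (simp add: next_scale_def)
    finally show ?thesis by blast
  qed
  then obtain m where m: "real q < d * real (Q m)" "\<And>j. j < m \<Longrightarrow> \<not> real q < d * real (Q j)"
    using exists_least_iff[of "\<lambda>k. real q < d * real (Q k)"] by blast
  then obtain k where k: "m = Suc k" using q0 by (cases m) auto
  obtain z y where y: "y \<in> ch k z" "x \<in> cell (Suc k) y" using limit_setE[OF assms(1)] by metis
  have "child d c (Q k) (Q (Suc k)) y" using ch(1)[of k z] y by (auto simp: children_def)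
  moreover have "d * real (Q k) \<le> real q" "real q < d * real (Q (Suc k))" using m(1) m(2)[of k] k by auto
  ultimately show False using assms(2-4) y(2) unfolding child_def cell_def by blast
qed

end


section \<open>From the limit set to the lower bound\<close>

lemma hausdorff_measure_mono:
  assumes "E \<subseteq> F"
  shows "hausdorff_measure s E \<le> hausdorff_measure s F"
  unfolding hausdorff_measure_def hausdorff_premeasure_def
  using assms by (intro SUP_mono' INF_superset_mono) auto

lemma vec2_eq_vector: "p = vector [p $ 1, p $ 2]" for p :: "'a::zero^2"
  by (simp add: vec_eq_iff forall_2)

text \<open>\<open>approximable\<close> counts pairs (q, p). As each q admits only finitely many p,
  finiteness can be decided by bounding q alone.\<close>

lemma finite_near_integers:
  fixes y :: "real^2"
  shows "finite {p :: int^2. \<forall>i. \<bar>y $ i - real_of_int (p $ i)\<bar> < b}"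
proof -
  have "{p :: int^2. \<forall>i. \<bar>y $ i - real_of_int (p $ i)\<bar> < b} \<subseteq>
    (\<lambda>(k, l). vector [k, l]) ` ({\<lceil>y $ 1 - b\<rceil>..\<lfloor>y $ 1 + b\<rfloor>} \<times> {\<lceil>y $ 2 - b\<rceil>..\<lfloor>y $ 2 + b\<rfloor>})"
  proof
    fix p assume "p \<in> {p :: int^2. \<forall>i. \<bar>y $ i - real_of_int (p $ i)\<bar> < b}"
    then have "\<bar>y $ 1 - real_of_int (p $ 1)\<bar> < b" "\<bar>y $ 2 - real_of_int (p $ 2)\<bar> < b" by auto
    then have "(p $ 1, p $ 2) \<in> {\<lceil>y $ 1 - b\<rceil>..\<lfloor>y $ 1 + b\<rfloor>} \<times> {\<lceil>y $ 2 - b\<rceil>..\<lfloor>y $ 2 + b\<rfloor>}"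
      by (auto simp: ceiling_le_iff le_floor_iff)
    then show "p \<in> (\<lambda>(k, l). vector [k, l]) ` ({\<lceil>y $ 1 - b\<rceil>..\<lfloor>y $ 1 + b\<rfloor>} \<times> {\<lceil>y $ 2 - b\<rceil>..\<lfloor>y $ 2 + b\<rfloor>})"
      by (rule rev_image_eqI) (simp add: vec2_eq_vector[symmetric])
  qed
  then show ?thesis by (rule finite_subset) auto
qed

lemma (in cantor_tree) limit_set_badly_approximable:
  fixes \<tau> :: "real^2"
  assumes \<tau>: "\<tau> $ 1 = t1" "\<tau> $ 2 = t2" and c1: "c < 1" and sq: "limit_set \<subseteq> unit_square"
  shows "limit_set \<subseteq> badly_approximable (Psi_pow \<tau>)"
proof
  fix x assume x: "x \<in> limit_set"
  let ?A = "{(q :: nat, p :: int^2). 0 < q \<and> (\<forall>i. \<bar>real q * x $ i - real_of_int (p $ i)\<bar> < Psi_pow \<tau> q $ i)}"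
  let ?C = "{(q :: nat, p :: int^2). 0 < q \<and> (\<forall>i. \<bar>real q * x $ i - real_of_int (p $ i)\<bar> < (c *\<^sub>R Psi_pow \<tau> q) $ i)}"
  have "\<exists>q>k. q \<in> fst ` ?A" for k
  proof -
    obtain q :: nat and p1 p2 :: int where "k < q" "\<bar>real q * x $ 1 - real_of_int p1\<bar> < real q powr - t1"
      "\<bar>real q * x $ 2 - real_of_int p2\<bar> < real q powr - t2"
      using limit_set_approx[OF x, of k] by blast
    then have "(q, vector [p1, p2]) \<in> ?A" by (auto simp: forall_2 Psi_pow_def \<tau>)
    then show ?thesis using \<open>k < q\<close> by force
  qed
  then have "infinite (fst ` ?A)" unfolding infinite_nat_iff_unbounded by blast
  then have "infinite ?A" by blast
  moreover have "finite ?C"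
  proof (rule finite_subset)
    show "?C \<subseteq> (SIGMA q : {..Q 0}. {p :: int^2. \<forall>i. \<bar>(real q *\<^sub>R x) $ i - real_of_int (p $ i)\<bar> < 1})"
    proof clarify
      fix q :: nat and p :: "int^2"
      assume q: "0 < q" and p: "\<forall>i. \<bar>real q * x $ i - real_of_int (p $ i)\<bar> < (c *\<^sub>R Psi_pow \<tau> q) $ i"
      then have p': "\<bar>real q * x $ 1 - real_of_int (p $ 1)\<bar> < c * real q powr - t1"
        "\<bar>real q * x $ 2 - real_of_int (p $ 2)\<bar> < c * real q powr - t2"
        by (auto simp: forall_2 Psi_pow_def \<tau>)
      have "real q < d * real (Q 0)" by (rule limit_set_avoids[OF x p' q])
      also have "\<dots> \<le> real (Q 0)" using dc by (simp add: mult_left_le_one_le)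
      finally have "q \<le> Q 0" by simp
      moreover have "c * real q powr - t < 1" if "0 \<le> t" for t
      proof -
        have "real q powr - t \<le> real q powr 0" using q that by (intro powr_mono) auto
        then have "c * real q powr - t \<le> c * 1" using dc q by (intro mult_left_mono) auto
        then show ?thesis using c1 by simp
      qed
      then have "c * real q powr - t1 < 1" "c * real q powr - t2 < 1" using t2_ge t2_le by auto
      then have "\<forall>i. \<bar>(real q *\<^sub>R x) $ i - real_of_int (p $ i)\<bar> < 1"
        unfolding forall_2 using p' by simp
      ultimately show "q \<in> {..Q 0} \<and> p \<in> {p. \<forall>i. \<bar>(real q *\<^sub>R x) $ i - real_of_int (p $ i)\<bar> < 1}"
        by blast
    qed
    show "finite (SIGMA q : {..Q 0}. {p :: int^2. \<forall>i. \<bar>(real q *\<^sub>R x) $ i - real_of_int (p $ i)\<bar> < 1})"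
      by (intro finite_SigmaI finite_near_integers) simp
  qed
  ultimately show "x \<in> badly_approximable (Psi_pow \<tau>)"
    using x sq c1 dc unfolding badly_approximable_def approximable_def by fastforce
qed

text \<open>The point is to find s2 > \<open>(1 + t2) * \<sigma> - 2 - t2\<close> below both t2 and
  1/2 when t2 > 0. For t2 >= 1/2 this follows from \<open>\<sigma> < 3 / (1 + t2)\<close>, for
  smaller t2 from \<open>\<sigma> < 2\<close>, which in turn comes from the first bound and t1 + t2
  > 1. The latter also leaves room for s1 < t1.\<close>

lemma ex_weights:
  fixes t1 t2 \<sigma> :: real
  assumes t: "0 \<le> t2" "t2 \<le> t1" "1 < t1 + t2" and \<sigma>: "0 < \<sigma>"
    "\<sigma> < (3 + t1 - t2) / (1 + t1)" "\<sigma> < 3 / (1 + t2)"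
  shows "\<exists>s1 s2 \<epsilon>. weights t1 t2 s1 s2 \<and> 0 < \<epsilon> \<and> \<epsilon> \<le> 1 \<and> \<sigma> < 2 \<and> (1 + t2) * \<sigma> \<le> 3 - \<epsilon> \<and>
    (1 + t2) * \<sigma> \<le> 2 + t2 + s2 - \<epsilon> \<and> (1 + t1) * \<sigma> \<le> 3 + t1 - t2 - \<epsilon>"
proof -
  have a: "(1 + t1) * \<sigma> < 3 + t1 - t2" "(1 + t2) * \<sigma> < 3"
    using \<sigma> t by (auto simp: field_simps)
  have "3 + t1 - t2 < (1 + t1) * 2" using t by simp
  from less_trans[OF a(1) this] have \<sigma>2: "\<sigma> < 2"
    by (subst (asm) mult_less_cancel_left_pos) (use t in auto)
  have "(1 + t2) * \<sigma> < (1 + t2) * 2" using \<sigma>2 t by (intro mult_strict_left_mono) auto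
  then have b: "(1 + t2) * \<sigma> < 2 + 2 * t2" by simp
  obtain s2 where s2: "0 \<le> s2" "s2 \<le> 1 / 2" "1 - t1 < s2" "t2 = 0 \<and> s2 = 0 \<or> 0 < s2 \<and> s2 < t2"
    "(1 + t2) * \<sigma> < 2 + t2 + s2"
  proof (cases "t2 = 0")
    case True
    then show ?thesis using that[of 0] t b by auto
  next
    case False
    have "max 0 (max (1 - t1) ((1 + t2) * \<sigma> - 2 - t2)) < min t2 (1 / 2)"
      using False t a b by (auto simp: max_def min_def)
    then obtain s2 where "max 0 (max (1 - t1) ((1 + t2) * \<sigma> - 2 - t2)) < s2" "s2 < min t2 (1 / 2)"
      using dense by blast
    then show ?thesis using that[of s2] by auto
  qed
  define \<epsilon> where "\<epsilon> = min 1 (min (3 - (1 + t2) * \<sigma>) (min (2 + t2 + s2 - (1 + t2) * \<sigma>) (3 + t1 - t2 - (1 + t1) * \<sigma>)))"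
  have "weights t1 t2 (1 - s2) s2" by unfold_locales (use s2 t in auto)
  moreover have "0 < \<epsilon>" "\<epsilon> \<le> 1" "\<epsilon> \<le> 3 - (1 + t2) * \<sigma>" "\<epsilon> \<le> 2 + t2 + s2 - (1 + t2) * \<sigma>" "\<epsilon> \<le> 3 + t1 - t2 - (1 + t1) * \<sigma>"
    using a s2 by (auto simp: \<epsilon>_def)
  ultimately show ?thesis using \<sigma>2 by (intro exI[of _ "1 - s2"] exI[of _ s2] exI[of _ \<epsilon>]) auto
qed

lemma hausdorff_measure_badly_approximable_nonzero:
  fixes \<tau> :: "real^2" and B :: "(real^2) set"
  assumes \<tau>: "0 \<le> \<tau> $ 2" "\<tau> $ 2 \<le> \<tau> $ 1" "1 < \<tau> $ 1 + \<tau> $ 2"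
    and B: "is_sup_ball B" "B \<subseteq> unit_square"
    and s: "0 \<le> s" "s < (3 + \<tau> $ 1 - \<tau> $ 2) / (1 + \<tau> $ 1)" "s < 3 / (1 + \<tau> $ 2)"
  shows "hausdorff_measure s (B \<inter> badly_approximable (Psi_pow \<tau>)) \<noteq> 0"
proof -
  define t1 t2 where "t1 = \<tau> $ 1" and "t2 = \<tau> $ 2"
  note t_def = t1_def t2_def
  obtain \<sigma> where \<sigma>: "s < \<sigma>" "\<sigma> < min ((3 + t1 - t2) / (1 + t1)) (3 / (1 + t2))"
    using dense[of s "min ((3 + t1 - t2) / (1 + t1)) (3 / (1 + t2))"] s by (auto simp: t_def)
  obtain s1 s2 \<epsilon> where w: "weights t1 t2 s1 s2" and \<epsilon>: "0 < \<epsilon>" "\<epsilon> \<le> 1" "\<sigma> < 2" "(1 + t2) * \<sigma> \<le> 3 - \<epsilon>"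
    "(1 + t2) * \<sigma> \<le> 2 + t2 + s2 - \<epsilon>" "(1 + t1) * \<sigma> \<le> 3 + t1 - t2 - \<epsilon>"
    using ex_weights[of t2 t1 \<sigma>] \<tau> s \<sigma> by (auto simp: t_def)
  interpret weights t1 t2 s1 s2 by (rule w)
  obtain d c where par: "0 < d" "d < 1" "0 < c" "c < 1" "admissible d c t1 s1" "t2 \<noteq> 0 \<Longrightarrow> admissible d c t2 s2"
    using ex_admissible by blast
  obtain x0 \<rho> where \<rho>: "0 < \<rho>" "B = {y. infnorm (y - x0) < \<rho>} \<or> B = {y. infnorm (y - x0) \<le> \<rho>}"
    using B(1) unfolding is_sup_ball_def by blast
  \<comment> \<open>The sides of the root rectangle are at most \<open>1 / q0\<close>, so it fits
    into the ball around its centre.\<close>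
  obtain q0 :: nat where q0: "0 < q0" "1 / real q0 < \<rho>"
    using ex_inverse_of_nat_less[OF \<rho>(1)] by (auto simp: inverse_eq_divide)
  have "\<exists>Q. \<forall>k. (0 < Q k \<and> (k = 0 \<longrightarrow> Q k = q0)) \<and> (\<exists>n. next_scale d c \<epsilon> (Q k) (Q (Suc k)) n)"
  proof (rule dependent_nat_choice)
    show "\<exists>x. 0 < x \<and> (0 = (0::nat) \<longrightarrow> x = q0)" using q0 by auto
    fix q k :: nat assume "0 < q \<and> (k = 0 \<longrightarrow> q = q0)"
    then obtain Q n where Q: "next_scale d c \<epsilon> q Q n"
      using ex_next_scale[OF par(1-3,5,6), of q \<epsilon>] \<epsilon> by blast
    then have "real q < d * real Q" by (simp add: next_scale_def)
    then have "0 < Q" using par by (cases "Q = 0") auto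
    then show "\<exists>y. (0 < y \<and> (Suc k = 0 \<longrightarrow> y = q0)) \<and> (\<exists>n. next_scale d c \<epsilon> q y n)" using Q by auto
  qed
  then obtain Q n where Q: "Q 0 = q0" "\<And>k. next_scale d c \<epsilon> (Q k) (Q (Suc k)) (n k)" by metis
  interpret cantor_tree t1 t2 s1 s2 d c \<epsilon> Q n "(x0 $ 1, x0 $ 2)"
    by unfold_locales (use par Q q0 in auto)
  have "limit_set \<subseteq> B"
  proof
    fix x assume "x \<in> limit_set"
    then have x: "\<bar>x $ 1 - x0 $ 1\<bar> \<le> real q0 powr (- 1 - t1) / 2" "\<bar>x $ 2 - x0 $ 2\<bar> \<le> real q0 powr (- 1 - t2) / 2"
      using limit_set_sub Q(1) by (auto simp: cell_def)
    have p: "real q0 powr (- 1 - t) \<le> 1 / real q0" if "0 \<le> t" for t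
    proof -
      have "real q0 powr (- 1 - t) \<le> real q0 powr - 1" using q0 that by (intro powr_mono) auto
      then show ?thesis using q0 by (simp add: powr_minus_divide)
    qed
    have "infnorm (x - x0) \<le> norm (x - x0)" by (rule infnorm_le_norm)
    also have "\<dots> \<le> \<bar>(x - x0) $ 1\<bar> + \<bar>(x - x0) $ 2\<bar>" using norm_le_l1_cart[of "x - x0"] by (simp add: sum_2)
    also have "\<dots> \<le> 1 / real q0" using x p[of t1] p[of t2] t2_ge t2_le by simp
    also have "\<dots> < \<rho>" by (rule q0)
    finally show "x \<in> B" using \<rho>(2) by auto
  qed
  moreover have "limit_set \<subseteq> badly_approximable (Psi_pow \<tau>)"
    using calculation B(2) par by (intro limit_set_badly_approximable) (auto simp: t_def)
  ultimately have "hausdorff_measure s limit_set \<le> hausdorff_measure s (B \<inter> badly_approximable (Psi_pow \<tau>))"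
    by (intro hausdorff_measure_mono) auto
  moreover have "hausdorff_measure s limit_set \<noteq> 0"
    using s \<sigma> \<epsilon> by (intro hausdorff_measure_limit_set[of \<sigma>]) auto
  ultimately show ?thesis by auto
qed


subsection \<open>The upper bound\<close>

text \<open>The finite families are arranged in one sequence by padding each with empty sets, which
  cost 0 in \<open>diam_pow\<close>.\<close>

lemma hausdorff_premeasure_le_suminf:
  fixes F :: "nat \<Rightarrow> 'a::metric_space set set"
  assumes fin: "\<And>q. finite (F q)" and cov: "E \<subseteq> (\<Union>q. \<Union>(F q))" and \<delta>: "0 \<le> \<delta>"
    and small: "\<And>q U. U \<in> F q \<Longrightarrow> bounded U \<and> diameter U \<le> \<delta>"
  shows "hausdorff_premeasure s \<delta> E \<le> (\<Sum>q. \<Sum>U\<in>F q. diam_pow s U)"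
proof -
  have "\<forall>q. \<exists>e. bij_betw e {0..<card (F q)} (F q)" using ex_bij_betw_nat_finite[OF fin] by blast
  then obtain e where e: "\<And>q. bij_betw (e q) {0..<card (F q)} (F q)" by metis
  define W where "W = (\<lambda>(q, k). if k < card (F q) then e q k else {})"
  have W: "W (q, k) = {} \<or> W (q, k) \<in> F q" for q k
    using bij_betwE[OF e[of q]] by (auto simp: W_def)
  have ok: "bounded (W p) \<and> diameter (W p) \<le> \<delta>" for p
  proof -
    obtain q k where p: "p = (q, k)" by (cases p)
    show ?thesis using W[of q k] small[of "W (q, k)" q] \<delta> unfolding p by auto
  qed
  have "E \<subseteq> (\<Union>i. W (prod_decode i))"
  proof
    fix x assume "x \<in> E"
    then obtain q U where U: "U \<in> F q" "x \<in> U" using cov by blast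
    then obtain k where "k < card (F q)" "U = e q k" using e[of q] unfolding bij_betw_def by (metis atLeastLessThan_iff imageE)
    then have "x \<in> W (prod_decode (prod_encode (q, k)))" using U by (simp add: W_def)
    then show "x \<in> (\<Union>i. W (prod_decode i))" by blast
  qed
  then have "hausdorff_premeasure s \<delta> E \<le> (\<Sum>i. diam_pow s (W (prod_decode i)))"
    unfolding hausdorff_premeasure_def by (intro INF_lower) (use ok in auto)
  also have "\<dots> = (\<Sum>q. \<Sum>U\<in>F q. diam_pow s U)"
  proof (rule suminf_ennreal_2dimen)
    fix q
    have "(\<Sum>k. diam_pow s (W (q, k))) = (\<Sum>k\<in>{0..<card (F q)}. diam_pow s (W (q, k)))"
      by (rule suminf_finite) (auto simp: W_def diam_pow_def)
    also have "\<dots> = (\<Sum>k\<in>{0..<card (F q)}. diam_pow s (e q k))"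
      by (rule sum.cong) (auto simp: W_def)
    also have "\<dots> = (\<Sum>U\<in>F q. diam_pow s U)" by (rule sum.reindex_bij_betw[OF e])
    finally show "(\<Sum>U\<in>F q. diam_pow s U) = (\<Sum>n. diam_pow s (W (q, n)))" ..
  qed
  finally show ?thesis .
qed

text \<open>The rectangle of sides \<open>2 (q powr (- 1 - h))\<close> and \<open>2 (q powr (- 1 - t))\<close> around \<open>p / q\<close> is cut into squares.\<close>

definition strip_piece :: "real \<Rightarrow> real \<Rightarrow> nat \<Rightarrow> nat \<Rightarrow> nat \<Rightarrow> nat \<Rightarrow> (real^2) set" where
  "strip_piece t h q p1 p2 l = {x. \<bar>x $ 1 - p1 / q\<bar> \<le> real q powr (- 1 - h) \<and>
     2 * real l * real q powr (- 1 - h) \<le> x $ 2 - p2 / q + real q powr (- 1 - t) \<and>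
     x $ 2 - p2 / q + real q powr (- 1 - t) \<le> 2 * (real l + 1) * real q powr (- 1 - h)}"

lemma strip_piece_dist:
  assumes "x \<in> strip_piece t h q p1 p2 l" "y \<in> strip_piece t h q p1 p2 l"
  shows "dist x y \<le> 4 * real q powr (- 1 - h)"
proof -
  have "dist x y \<le> \<bar>x $ 1 - y $ 1\<bar> + \<bar>x $ 2 - y $ 2\<bar>"
    using norm_le_l1_cart[of "x - y"] by (simp add: dist_norm sum_2)
  also have "\<dots> \<le> 4 * real q powr (- 1 - h)"
    using assms unfolding strip_piece_def mem_Collect_eq distrib_left distrib_right by linarith
  finally show ?thesis .
qed

lemma diameter_strip_piece:
  "bounded (strip_piece t h q p1 p2 l)" "diameter (strip_piece t h q p1 p2 l) \<le> 4 * real q powr (- 1 - h)"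
proof -
  show "bounded (strip_piece t h q p1 p2 l)"
    unfolding bounded_two_points using strip_piece_dist by blast
  show "diameter (strip_piece t h q p1 p2 l) \<le> 4 * real q powr (- 1 - h)"
    by (rule diameter_le) (use strip_piece_dist in \<open>auto simp: dist_norm\<close>)
qed

text \<open>Natural indices suffice: an error below 1 at a point of the unit square forces 0 <= p <=
  q. The bound h <= t1 makes a single square wide enough in the first coordinate, so only the second
  is subdivided.\<close>

lemma strip_piece_cover:
  fixes x :: "real^2" and p1 p2 :: int
  assumes q: "0 < q" and t: "0 \<le> t" "t \<le> h" "h \<le> t1"
    and x: "0 \<le> x $ 1" "x $ 1 \<le> 1" "0 \<le> x $ 2" "x $ 2 \<le> 1"
    and p: "\<bar>real q * x $ 1 - real_of_int p1\<bar> < real q powr - t1" "\<bar>real q * x $ 2 - real_of_int p2\<bar> < real q powr - t"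
  shows "\<exists>k1\<le>q. \<exists>k2\<le>q. \<exists>l<nat \<lceil>real q powr (h - t)\<rceil>. x \<in> strip_piece t h q k1 k2 l"
proof -
  have le1: "real q powr - u \<le> 1" if "0 \<le> u" for u
    using q that powr_mono[of "- u" 0 "real q"] by simp
  have range: "0 \<le> p \<and> p \<le> int q" if "\<bar>real q * a - real_of_int p\<bar> < 1" "0 \<le> a" "a \<le> 1" for a and p :: int
  proof -
    have "0 \<le> real q * a" "real q * a \<le> real q" using that by (auto simp: mult_left_le)
    then have "- 1 < real_of_int p" "real_of_int p < real q + 1" using that(1) by linarith+
    then show ?thesis by linarith
  qed
  have r: "0 \<le> p1" "p1 \<le> int q" "0 \<le> p2" "p2 \<le> int q"
    using range[of "x $ 1" p1] range[of "x $ 2" p2] x p le1[of t1] le1[of t] t by fastforce+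
  have dv: "\<bar>a - p / q\<bar> < real q powr (- 1 - u)" if "\<bar>real q * a - p\<bar> < real q powr - u" for a p u
  proof -
    have "a - p / q = (q * a - p) / q" using q by (simp add: field_simps)
    then have "\<bar>a - p / q\<bar> = \<bar>q * a - p\<bar> / q" by (simp add: abs_divide)
    also have "\<dots> < real q powr - u / q" using that q by (intro divide_strict_right_mono) auto
    also have "\<dots> = real q powr (- 1 - u)" using q by (simp add: powr_diff powr_minus_divide powr_add)
    finally show ?thesis .
  qed
  define w where "w = real q powr (- 1 - h)"
  have w: "0 < w" using q by (simp add: w_def)
  define y where "y = x $ 2 - p2 / q + real q powr (- 1 - t)"
  have y: "0 < y" "y < 2 * real q powr (- 1 - t)" using dv[OF p(2)] unfolding y_def by linarith+
  define l where "l = nat \<lfloor>y / (2 * w)\<rfloor>"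
  have yw: "0 \<le> y / (2 * w)" using y w by simp
  have "real l \<le> y / (2 * w)" "y / (2 * w) < real l + 1" using yw by (auto simp: l_def)
  then have l: "2 * real l * w \<le> y" "y \<le> 2 * (real l + 1) * w" using w by (auto simp: field_simps)
  have "real l \<le> y / (2 * w)" using yw by (simp add: l_def)
  also have "\<dots> < real q powr (- 1 - t) / w" using y w by (simp add: field_simps)
  also have "\<dots> = real q powr (h - t)" unfolding w_def using q by (simp flip: powr_diff)
  finally have "l < nat \<lceil>real q powr (h - t)\<rceil>" by linarith
  moreover have "\<bar>x $ 1 - p1 / q\<bar> \<le> w"
  proof -
    have "real q powr (- 1 - t1) \<le> w" unfolding w_def using q t by (intro powr_mono) auto
    then show ?thesis using dv[OF p(1)] by linarith
  qed
  moreover have "x \<in> strip_piece t h q (nat p1) (nat p2) l"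
    unfolding strip_piece_def using calculation l r by (simp add: w_def[symmetric] y_def)
  ultimately show ?thesis using r by (intro exI[of _ "nat p1"] exI[of _ "nat p2"] exI[of _ l] conjI) auto
qed

text \<open>Denominator q needs about \<open>q powr (2 + h - t)\<close> squares of diameter at most
  \<open>4 * q powr (- 1 - h)\<close>. The hypothesis on \<open>\<sigma>\<close> says that the
  resulting exponent \<open>\<beta>\<close> is below -1, so the tails of the convergent series bound
  the premeasure.\<close>

lemma hausdorff_measure_approximable_zero:
  fixes \<tau> :: "real^2" and h \<sigma> :: real
  assumes \<tau>: "0 \<le> \<tau> $ 2" "\<tau> $ 2 \<le> h" "h \<le> \<tau> $ 1" and \<sigma>: "0 < \<sigma>" "3 + h - \<tau> $ 2 < (1 + h) * \<sigma>"
  shows "hausdorff_measure \<sigma> (approximable (Psi_pow \<tau>)) = 0"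
proof -
  define t where "t = \<tau> $ 2"
  have h0: "0 \<le> h" using \<tau> by linarith
  define F where "F q = (\<lambda>(k1, k2, l). strip_piece t h q k1 k2 l) ` ({..q} \<times> {..q} \<times> {..<nat \<lceil>real q powr (h - t)\<rceil>})" for q
  define \<beta> where "\<beta> = 2 + h - t - (1 + h) * \<sigma>"
  have \<beta>: "\<beta> < - 1" using \<sigma> by (simp add: \<beta>_def t_def)
  have finF: "finite (F q)" for q by (simp add: F_def)
  have dF: "bounded U" "diameter U \<le> 4 * real q powr (- 1 - h)" if "U \<in> F q" for U q
    using that diameter_strip_piece by (auto simp: F_def)
  \<comment> \<open>The constant 8 comes from q + 1 <= 2 q twice and from rounding up a number that
    is at least 1.\<close>
  have cost: "(\<Sum>U\<in>F q. diam_pow \<sigma> U) \<le> ennreal (8 * 4 powr \<sigma> * real q powr \<beta>)" if q: "0 < q" for q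
  proof -
    have "diam_pow \<sigma> U \<le> ennreal ((4 * real q powr (- 1 - h)) powr \<sigma>)" if "U \<in> F q" for U
      using dF[OF that] \<sigma> diameter_ge_0[of U] by (auto simp: diam_pow_def intro!: ennreal_leI powr_mono2)
    then have "(\<Sum>U\<in>F q. diam_pow \<sigma> U) \<le> of_nat (card (F q)) * ennreal ((4 * real q powr (- 1 - h)) powr \<sigma>)"
      by (rule sum_bounded_above)
    also have "\<dots> = ennreal (real (card (F q)) * (4 * real q powr (- 1 - h)) powr \<sigma>)"
      by (simp add: ennreal_mult ennreal_of_nat_eq_real_of_nat)
    also have "\<dots> \<le> ennreal ((8 * real q powr (2 + h - t)) * (4 * real q powr (- 1 - h)) powr \<sigma>)"
    proof (intro ennreal_leI mult_right_mono)
      have "card (F q) \<le> card ({..q} \<times> {..q} \<times> {..<nat \<lceil>real q powr (h - t)\<rceil>})"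
        unfolding F_def by (intro card_image_le) simp
      then have "real (card (F q)) \<le> real (Suc q * (Suc q * nat \<lceil>real q powr (h - t)\<rceil>))"
        by (simp only: of_nat_le_iff card_cartesian_product card_atMost card_lessThan)
      also have "\<dots> = (real q + 1) * ((real q + 1) * real (nat \<lceil>real q powr (h - t)\<rceil>))" by (simp add: algebra_simps)
      also have "\<dots> \<le> (2 * real q) * ((2 * real q) * (2 * real q powr (h - t)))"
      proof (intro mult_mono)
        have "1 \<le> real q powr (h - t)" using q \<tau> by (intro ge_one_powr_ge_zero) (auto simp: t_def)
        then show "real (nat \<lceil>real q powr (h - t)\<rceil>) \<le> 2 * real q powr (h - t)" by linarith
      qed (use q in \<open>auto intro!: mult_nonneg_nonneg less_le_trans[OF _ powr_ge_zero]\<close>)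
      also have "\<dots> = 8 * (real q powr 2 * real q powr (h - t))" using q by (simp add: power2_eq_square)
      also have "real q powr 2 * real q powr (h - t) = real q powr (2 + (h - t))" by (rule powr_add[symmetric])
      also have "2 + (h - t) = 2 + h - t" by simp
      finally show "real (card (F q)) \<le> 8 * real q powr (2 + h - t)" .
    qed simp
    also have "(8 * real q powr (2 + h - t)) * (4 * real q powr (- 1 - h)) powr \<sigma>
        = 8 * 4 powr \<sigma> * (real q powr (2 + h - t) * real q powr ((- 1 - h) * \<sigma>))"
      by (simp add: powr_mult powr_powr)
    also have "real q powr (2 + h - t) * real q powr ((- 1 - h) * \<sigma>) = real q powr ((2 + h - t) + (- 1 - h) * \<sigma>)"
      by (rule powr_add[symmetric])
    also have "(2 + h - t) + (- 1 - h) * \<sigma> = \<beta>" by (simp add: \<beta>_def algebra_simps)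
    finally show ?thesis .
  qed
  \<comment> \<open>Infinitely many pairs (q, p) give arbitrarily large q, because each q has
    finitely many p.\<close>
  have cov: "approximable (Psi_pow \<tau>) \<subseteq> (\<Union>q. \<Union>(F (q + m)))" for m
  proof
    fix x assume "x \<in> approximable (Psi_pow \<tau>)"
    then have x: "x \<in> unit_square" and inf: "infinite {(q :: nat, p :: int^2). 0 < q \<and> (\<forall>i. \<bar>real q * x $ i - real_of_int (p $ i)\<bar> < Psi_pow \<tau> q $ i)}"
      (is "infinite ?A") by (auto simp: approximable_def)
    have "\<exists>q p. m \<le> q \<and> (q, p) \<in> ?A"
    proof (rule ccontr)
      assume neg: "\<nexists>q p. m \<le> q \<and> (q, p) \<in> ?A"
      have "?A \<subseteq> (SIGMA q : {..m}. {p :: int^2. \<forall>i. \<bar>(real q *\<^sub>R x) $ i - real_of_int (p $ i)\<bar> < 1})"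
      proof clarify
        fix q :: nat and p :: "int^2"
        assume q: "0 < q" and p: "\<forall>i. \<bar>real q * x $ i - real_of_int (p $ i)\<bar> < Psi_pow \<tau> q $ i"
        have "q < m"
        proof (rule ccontr)
          assume "\<not> q < m"
          then have "m \<le> q \<and> (q, p) \<in> ?A" using q p by simp
          then have "\<exists>q p. m \<le> q \<and> (q, p) \<in> ?A" by (intro exI)
          then show False using neg by (rule notE[rotated])
        qed
        moreover have "Psi_pow \<tau> q $ i \<le> 1" for i
        proof -
          have "0 \<le> \<tau> $ i" using \<tau> h0 exhaust_2[of i] by auto
          then show ?thesis using q powr_mono[of "- (\<tau> $ i)" 0 "real q"] by (simp add: Psi_pow_def)
        qed
        then have "\<forall>i. \<bar>(real q *\<^sub>R x) $ i - real_of_int (p $ i)\<bar> < 1" using p by (auto intro: less_le_trans)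
        ultimately show "q \<in> {..m} \<and> p \<in> {p. \<forall>i. \<bar>(real q *\<^sub>R x) $ i - real_of_int (p $ i)\<bar> < 1}" by simp
      qed
      then have "finite ?A" by (rule finite_subset) (intro finite_SigmaI finite_near_integers, simp)
      then show False using inf by blast
    qed
    then obtain q p where q: "m \<le> q" "0 < q" and p: "\<And>i. \<bar>real q * x $ i - real_of_int (p $ i)\<bar> < Psi_pow \<tau> q $ i" by auto
    have "\<exists>k1\<le>q. \<exists>k2\<le>q. \<exists>l<nat \<lceil>real q powr (h - t)\<rceil>. x \<in> strip_piece t h q k1 k2 l"
      using p[of 1] p[of 2] x \<tau> q
      by (intro strip_piece_cover[of q t h "\<tau> $ 1" x "p $ 1" "p $ 2"]) (auto simp: Psi_pow_def t_def unit_square_def)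
    then have "x \<in> \<Union>(F q)" by (fastforce simp: F_def)
    then have "x \<in> \<Union>(F ((q - m) + m))" using q by simp
    then show "x \<in> (\<Union>q. \<Union>(F (q + m)))" by blast
  qed
  have pre: "hausdorff_premeasure \<sigma> \<delta> (approximable (Psi_pow \<tau>)) = 0" if \<delta>: "0 < \<delta>" for \<delta>
  proof -
    define a where "a q = 8 * 4 powr \<sigma> * real q powr \<beta>" for q :: nat
    have a: "summable a" "\<And>q. 0 \<le> a q" unfolding a_def using \<beta> by (auto simp: summable_real_powr_iff intro!: summable_mult)
    have le: "hausdorff_premeasure \<sigma> \<delta> (approximable (Psi_pow \<tau>)) \<le> 0 + ennreal e" if e: "0 < e" for e
    proof -
      obtain N where N: "\<And>n. N \<le> n \<Longrightarrow> norm (\<Sum>i. a (i + n)) < e"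
        using suminf_exist_split[OF e a(1)] by blast
      have "- 1 - h = - (1 + h)" by simp
      then have "\<forall>\<^sub>F q::nat in sequentially. 4 * real q powr (- 1 - h) \<le> \<delta>"
        using h0 \<delta> by (simp only:) (intro eventually_powr_small, auto)
      then obtain N' where N': "\<And>q. N' \<le> q \<Longrightarrow> 4 * real q powr (- 1 - h) \<le> \<delta>"
        unfolding eventually_sequentially by auto
      define m where "m = max 1 (max N N')"
      have m: "1 \<le> m" "N \<le> m" "N' \<le> m" by (auto simp: m_def)
      have "hausdorff_premeasure \<sigma> \<delta> (approximable (Psi_pow \<tau>)) \<le> (\<Sum>q. \<Sum>U\<in>F (q + m). diam_pow \<sigma> U)"
      proof (rule hausdorff_premeasure_le_suminf[OF finF cov])
        fix q U assume "U \<in> F (q + m)"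
        then show "bounded U \<and> diameter U \<le> \<delta>"
          using dF[of U "q + m"] N'[of "q + m"] m by fastforce
      qed (use \<delta> in simp)
      also have "\<dots> \<le> (\<Sum>q. ennreal (a (q + m)))"
        unfolding a_def by (intro suminf_le cost) (use m in auto)
      also have "\<dots> = ennreal (\<Sum>q. a (q + m))"
        using a by (intro suminf_ennreal2) (auto simp: summable_iff_shift)
      also have "\<dots> \<le> ennreal e" using N[OF m(2)] by (intro ennreal_leI) auto
      finally show ?thesis by simp
    qed
    have "hausdorff_premeasure \<sigma> \<delta> (approximable (Psi_pow \<tau>)) \<le> 0"
      by (rule ennreal_le_epsilon) (rule le)
    then show ?thesis by simp
  qed
  have "hausdorff_measure \<sigma> (approximable (Psi_pow \<tau>)) \<le> 0"
    unfolding hausdorff_measure_def by (rule SUP_least) (simp add: pre)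
  then show ?thesis by simp
qed


theorem theorem1p2:
  fixes \<tau> :: "real^2" and B :: "(real^2) set"
  assumes "\<And>i. 0 \<le> \<tau> $ i"
    and "\<tau> $ 1 + \<tau> $ 2 > 1"
    and "\<tau> $ 1 \<ge> \<tau> $ 2"
    and "is_sup_ball B" and "B \<subseteq> unit_square"
  shows "hausdorff_dim (B \<inter> badly_approximable (Psi_pow \<tau>)) = hausdorff_dim (approximable (Psi_pow \<tau>)) \<and>
    hausdorff_dim (approximable (Psi_pow \<tau>)) =
      ereal (min ((3 + \<tau> $ 1 - \<tau> $ 2) / (1 + \<tau> $ 1)) (3 / (1 + \<tau> $ 2)))"
proof -
  define m where "m = min ((3 + \<tau> $ 1 - \<tau> $ 2) / (1 + \<tau> $ 1)) (3 / (1 + \<tau> $ 2))"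
  let ?A = "approximable (Psi_pow \<tau>)" and ?E = "B \<inter> badly_approximable (Psi_pow \<tau>)"
  have t: "0 \<le> \<tau> $ 1" "0 \<le> \<tau> $ 2" using assms(1) by auto
  have m0: "0 < m" using t assms(3) by (simp add: m_def)
  have "hausdorff_dim ?A \<le> ereal m"
  proof (rule ereal_le_epsilon2)
    fix e :: real assume e: "0 < e"
    define \<sigma> where "\<sigma> = m + e"
    have "0 < \<sigma>" using m0 e by (simp add: \<sigma>_def)
    have "(3 + \<tau> $ 1 - \<tau> $ 2) / (1 + \<tau> $ 1) < \<sigma> \<or> 3 / (1 + \<tau> $ 2) < \<sigma>"
      using e unfolding \<sigma>_def m_def by linarith
    then have "3 + \<tau> $ 1 - \<tau> $ 2 < (1 + \<tau> $ 1) * \<sigma> \<or> 3 + \<tau> $ 2 - \<tau> $ 2 < (1 + \<tau> $ 2) * \<sigma>"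
      using t by (simp add: pos_divide_less_eq mult.commute)
    then have "hausdorff_measure \<sigma> ?A = 0"
      using hausdorff_measure_approximable_zero[of \<tau> "\<tau> $ 1" \<sigma>] hausdorff_measure_approximable_zero[of \<tau> "\<tau> $ 2" \<sigma>]
        t assms(3) \<open>0 < \<sigma>\<close> by blast
    then have "hausdorff_dim ?A \<le> ereal \<sigma>"
      unfolding hausdorff_dim_def using \<open>0 < \<sigma>\<close> by (intro INF_lower) auto
    then show "hausdorff_dim ?A \<le> ereal m + ereal e" by (simp add: \<sigma>_def)
  qed
  moreover have "ereal m \<le> hausdorff_dim ?E"
    unfolding hausdorff_dim_def
  proof (rule INF_greatest)
    fix s assume s: "s \<in> {s. 0 \<le> s \<and> hausdorff_measure s ?E = 0}"
    have "\<not> s < m"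
      using hausdorff_measure_badly_approximable_nonzero[of \<tau> B s] s t assms(2-5) by (auto simp: m_def)
    then show "ereal m \<le> ereal s" by simp
  qed
  \<comment> \<open>Monotonicity squeezes both dimensions between m and m.\<close>
  moreover have "hausdorff_dim ?E \<le> hausdorff_dim ?A"
    unfolding hausdorff_dim_def
  proof (rule INF_superset_mono)
    have "?E \<subseteq> ?A" by (auto simp: badly_approximable_def)
    from hausdorff_measure_mono[OF this]
    show "{s. 0 \<le> s \<and> hausdorff_measure s ?A = 0} \<subseteq> {s. 0 \<le> s \<and> hausdorff_measure s ?E = 0}"
      by (metis (mono_tags, lifting) Collect_mono le_zero_eq)
  qed simp
  ultimately show ?thesis unfolding m_def[symmetric] by (meson order_antisym order_trans)
qed

end
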